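(* The following holds for $\mathbb P$-almost every $\omega$. Pick any $\zeta\preceq\eta$ in $\operatorname{ri}\mathcal U$ such that $[\zeta,\eta]\cap\mathcal V^\omega\ne\varnothing$, including the case $\zeta=\eta=\xi$. Then the instability graph $\mathcal S^*_{[\zeta,\eta]}$ is an infinite directed graph. Furthermore, $\mathcal S^*_{[\zeta,\eta]}$ equals the union of the bi-infinite directed paths of the graph $\mathcal G^*_{\cup[\zeta,\eta]}$. In the backward (north and east) orientation, each such path is $[\underline\zeta,\overline\eta]$-directed.
   Context: Directions. $e_1=e_+=(1,0)$, $e_2=e_-=(0,1)$, $\hat e=e_1+e_2$, $\hat e^*=\hat e/2$. $\mathcal U=\{te_1+(1-t)e_2:0\le t\le1\}$, $\operatorname{ri}\mathcal U=\mathcal U\setminus\{e_1,e_2\}$. For $\zeta,\eta\in\mathbb R^2$ with $\zeta\cdot\hat e=\eta\cdot\hat e$, $\zeta\prec\eta$ (resp. $\zeta\preceq\eta$) means $\zeta\cdot e_1<\eta\cdot e_1$ (resp. $\le$). Intervals $[\zeta,\eta]$, $]\zeta,\eta[$ etc. in $\mathcal U$ and monotone limits $\zeta\nearrow\xi$, $\zeta\searrow\xi$ refer to this order. Vector inequalities $x\le y$, $x<y$ are coordinatewise. $\sigma$ denotes a sign in $\{-,+\}$. Last-passage percolation. $(\Omega,\mathcal F,\mathbb P)$ is a Polish probability space with a group $\{T_x\}_{x\in\mathbb Z^2}$ of measurable $\mathbb P$-preserving bijections ($T_0=$ identity, $T_xT_y=T_{x+y}$) and real random variables (weights) $\omega_x$,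 $x\in\mathbb Z^2$, with $\omega_y(T_x\omega)=\omega_{x+y}(\omega)$, that are i.i.d. with continuous distribution, positive variance, and $\mathbb E|\omega_0|^p<\infty$ for some $p>2$. An up-right path has steps in $\{e_1,e_2\}$ and is indexed so that $\pi_k\cdot\hat e=k$. For $x\le y$, $k=x\cdot\hat e$, $m=y\cdot\hat e$, $G_{x,y}=\max\sum_{i=k}^{m-1}\omega_{\pi_i}$ over up-right paths from $x$ to $y$. The shape function is the deterministic, concave, symmetric, 1-homogeneous $g:\mathbb R_+^2\to\mathbb R$ with a.s. $\lim_n\max_{x\in\mathbb Z_+^2,|x|_1=n}|G_{0,x}-g(x)|/n=0$. For $\xi\in\operatorname{ri}\mathcal U$: $\nabla g(\xi\pm)\cdot e_1=\lim_{\varepsilon\searrow0}\frac{g(\xi\pm\varepsilon e_1)-g(\xi)}{\pm\varepsilon}$, $\nabla g(\xi\pm)\cdot e_2=\lim_{\varepsilon\searrow0}\frac{g(\xi\mp\varepsilon e_2)-g(\xi)}{\mp\varepsilon}$. $\mathcal D=\{\xi\in\operatorname{ri}\mathcal U: g\text{ differentiable at }\xi\}$. $\mathcal U_{\xi\sigma}=\{\zeta\in\operatorname{ri}\mathcal U:g(\zeta)-g(\xi)=\nabla g(\xi\sigma)\cdot(\zeta-\xi)\}$, $\mathcal U_\xi=\mathcal U_{\xi-}\cup\mathcal U_{\xi+}=[\underline\xi,\overline\xi]$ with $\underline\xi\preceq\overline\xi$. Busemann process. On $\Omega$ there is a fixed family of real random variables $B^{\xi\sigma}(x,y)=B^{\xi\sigma}_{x,y}$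 ($x,y\in\mathbb Z^2$, $\xi\in\operatorname{ri}\mathcal U$, $\sigma\in\{-,+\}$), measurable in $(x,y,\omega,\xi)$, constructed in earlier work, with these properties. (B1) On one $T$-invariant event of probability one, for all $x,y,z,\xi,\sigma$: $B^{\xi\sigma}(x+z,y+z,\omega)=B^{\xi\sigma}(x,y,T_z\omega)$; $B^{\xi\sigma}(x,y)+B^{\xi\sigma}(y,z)=B^{\xi\sigma}(x,z)$; $\min_{i}B^{\xi\sigma}(x,x+e_i)=\omega_x$; for $\xi\prec\xi'$, $B^{\xi-}(x,x+e_1)\ge B^{\xi+}(x,x+e_1)\ge B^{\xi'-}(x,x+e_1)\ge B^{\xi'+}(x,x+e_1)$ and the reversed inequalities with $e_2$ in place of $e_1$; $B^{\xi-}(x,y)=\lim_{\zeta\nearrow\xi}B^{\zeta\sigma}(x,y)$ and $B^{\xi+}(x,y)=\lim_{\zeta\searrow\xi}B^{\zeta\sigma}(x,y)$; $B^{\xi\sigma}(x,x+e_i)\to\infty$ as $\xi\to e_{3-i}$. (B2) $B^{\xi\sigma}(x,y)$ is integrable and $\mathbb E[B^{\xi\sigma}(x,x+e_i)]=\nabla g(\xi\sigma)\cdot e_i$. (B3) If $\nabla g(\zeta\sigma)=\nabla g(\eta\sigma)$ then $B^{\zeta\sigma}\equiv B^{\eta\sigma}$. (B4) For any $I\subset\mathbb Z^2$, $\{(\omega_x,B^{\xi\sigma}(x,y)):x\in I,y\ge x,\sigma,\xi\}$ is independent of $\{\omega_x: x\not\ge z\ \forall z\in I\}$. (B5) For each fixed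 $\xi$, a.s.: $B^{\xi\sigma}(x,x+e_1)\ne B^{\xi\sigma}(x,x+e_2)$ for all $x,\sigma$; $n^{-1}\max_{x\in\mathbb Z_+^2,|x|_1=n}|B^{\xi\sigma}(0,x)-x\cdot\nabla g(\xi\sigma)|\to0$; if $\xi\in\mathcal D$ then $B^{\xi+}=B^{\xi-}$; if $\xi,\underline\xi,\overline\xi\in\mathcal D$ then $B^{\xi\pm}(x,y)=\lim_n(G_{x,v_n}-G_{y,v_n})$ whenever $|v_n|\to\infty$, $v_n/n\to\xi$. Busemann measures. For $x,y\in\mathbb Z^2$ and a compact interval $K\subset\operatorname{ri}\mathcal U$, $\mu^K_{x,y}$ is the signed measure on $K$ with $\mu^K_{x,y}(]\zeta,\eta])=B^{\eta+}_{x,y}-B^{\zeta+}_{x,y}$ and $\mu^K_{x,y}([\zeta,\eta[)=B^{\eta-}_{x,y}-B^{\zeta-}_{x,y}$ for $\zeta\prec\eta$, $[\zeta,\eta]\subset K$. $\operatorname{supp}\mu_{x,y}=\bigcup_{\zeta\prec\eta\text{ in }\operatorname{ri}\mathcal U}\operatorname{supp}\mu^{[\zeta,\eta]}_{x,y}$ (support = smallest closed set whose complement has zero total variation measure). $\mathcal V^\omega=\bigcup_{x,y\in\mathbb Z^2}\operatorname{supp}\mu_{x,y}$. Graphs. $\mathcal G_{\xi\sigma}$ is the directed graph on $\mathbb Z^2$ in which each $x$ has exactly one outgoing edge: to $x+e_1$ if $B^{\xi\sigma}(x,x+e_1)<B^{\xi\sigma}(x,x+e_2)$, to $x+e_2$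 if $>$ holds, to $x+e_\sigma$ if equality holds. $\mathcal G^*_{\xi\sigma}$ is the directed graph on the dual lattice $\mathbb Z^{2*}=\hat e^*+\mathbb Z^2$ in which $x+\hat e^*$ points to $x+\hat e^*-e_i$ if and only if $x$ points to $x+e_i$ in $\mathcal G_{\xi\sigma}$. $\mathcal G^*_{\cup[\zeta,\eta]}$ is the union of the graphs $\mathcal G^*_{\xi\sigma}$ over $\xi\in[\zeta,\eta]$, $\sigma\in\{-,+\}$. A dual point $x+\hat e^*$ ($x\in\mathbb Z^2$) is a $[\zeta,\eta]$-instability point if $[\zeta,\eta]\cap\operatorname{supp}\mu_{x+e_1,x+e_2}\ne\varnothing$. The instability graph $\mathcal S^*_{[\zeta,\eta]}$ is the subgraph of $\mathcal G^*_{\cup[\zeta,\eta]}$ whose vertices are the $[\zeta,\eta]$-instability points and whose edges are the directed edges of $\mathcal G^*_{\cup[\zeta,\eta]}$ between such points. Backward $\mathcal A$-directedness of a path $(x^*_n)_{n\in\mathbb Z}$, $x_n^*\cdot\hat e=n$, with $x^*_n$ pointing to $x^*_{n-1}$, means that the limit points of $n^{-1}x^*_n$ as $n\to\infty$ all lie in $\mathcal A$. *)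

theory Defs
  imports "HOL-Probability.Probability" "Graph_Theory.Pair_Digraph"
begin

section \<open>Directions\<close>

type_synonym site = "int \<times> int"
type_synonym point = "real \<times> real"

datatype sign = Minus | Plus

primrec sgnval :: "sign \<Rightarrow> real" where
  "sgnval Minus = -1"
| "sgnval Plus = 1"

definition e1 :: "'a::{zero,one} \<times> 'a" where "e1 = (1, 0)"
definition e2 :: "'a::{zero,one} \<times> 'a" where "e2 = (0, 1)"

primrec e_sign :: "sign \<Rightarrow> site" where
  "e_sign Minus = e2"
| "e_sign Plus = e1"

definition ehat :: point where "ehat = e1 + e2"

definition emb :: "site \<Rightarrow> point" where
  "emb x = (real_of_int (fst x), real_of_int (snd x))"

definition level :: "site \<Rightarrow> int" where
  "level x = fst x + snd x"

definition segU :: "point set" where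
  "segU = {t *\<^sub>R e1 + (1 - t) *\<^sub>R e2 | t. 0 \<le> t \<and> t \<le> 1}"

definition riU :: "point set" where
  "riU = segU - {e1, e2}"

definition dprec :: "point \<Rightarrow> point \<Rightarrow> bool" (infix \<open>\<prec>\<close> 50) where
  "\<zeta> \<prec> \<eta> \<longleftrightarrow> \<zeta> \<bullet> ehat = \<eta> \<bullet> ehat \<and> \<zeta> \<bullet> e1 < \<eta> \<bullet> e1"

definition dpreceq :: "point \<Rightarrow> point \<Rightarrow> bool" (infix \<open>\<preceq>\<close> 50) where
  "\<zeta> \<preceq> \<eta> \<longleftrightarrow> \<zeta> \<bullet> ehat = \<eta> \<bullet> ehat \<and> \<zeta> \<bullet> e1 \<le> \<eta> \<bullet> e1"

definition dIcc :: "point \<Rightarrow> point \<Rightarrow> point set" where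
  "dIcc \<zeta> \<eta> = {\<xi>\<in>segU. \<zeta> \<preceq> \<xi> \<and> \<xi> \<preceq> \<eta>}"

definition dIoc :: "point \<Rightarrow> point \<Rightarrow> point set" where
  "dIoc \<zeta> \<eta> = {\<xi>\<in>segU. \<zeta> \<prec> \<xi> \<and> \<xi> \<preceq> \<eta>}"

definition dIco :: "point \<Rightarrow> point \<Rightarrow> point set" where
  "dIco \<zeta> \<eta> = {\<xi>\<in>segU. \<zeta> \<preceq> \<xi> \<and> \<xi> \<prec> \<eta>}"


section \<open>Last-passage percolation\<close>

text \<open>The order \<open>\<le>\<close> on sites is the coordinatewise order of \<^theory>\<open>HOL-Library.Product_Order\<close>.\<close>

definition up_right_path :: "site \<Rightarrow> site \<Rightarrow> (int \<Rightarrow> site) \<Rightarrow> bool" where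
  "up_right_path x y \<pi> \<longleftrightarrow> \<pi> (level x) = x \<and> \<pi> (level y) = y \<and>
     (\<forall>i\<in>{level x..<level y}. \<pi> (i + 1) = \<pi> i + e1 \<or> \<pi> (i + 1) = \<pi> i + e2)"

text \<open>Meaningful for \<open>x \<le> y\<close> only. The weight of the terminal site is not counted.\<close>
definition passage_time :: "(site \<Rightarrow> 'w \<Rightarrow> real) \<Rightarrow> site \<Rightarrow> site \<Rightarrow> 'w \<Rightarrow> real" where
  "passage_time wt x y \<omega> =
     Max {(\<Sum>i\<in>{level x..<level y}. wt (\<pi> i) \<omega>) | \<pi>. up_right_path x y \<pi>}"

definition quadrant_sphere :: "nat \<Rightarrow> site set" where
  "quadrant_sphere n = {x. 0 \<le> x \<and> level x = int n}"

locale lpp = prob_space M for M :: "'w::polish_space measure" +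
  fixes T :: "site \<Rightarrow> 'w \<Rightarrow> 'w"
    and wt :: "site \<Rightarrow> 'w \<Rightarrow> real"
  assumes sets_borel: "sets M = sets borel"
    and T_bij: "bij (T x)"
    and T_measurable: "T x \<in> measurable M M"
    and T_preserving: "distr M M (T x) = M"
    and T_zero: "T 0 = id"
    and T_add: "T x \<circ> T y = T (x + y)"
    and wt_measurable: "wt x \<in> borel_measurable M"
    and wt_shift: "wt y (T x \<omega>) = wt (x + y) \<omega>"
    and wt_indep: "indep_vars (\<lambda>_. borel) wt UNIV"
    and wt_ident: "distr M borel (wt x) = distr M borel (wt 0)"
    and wt_continuous: "continuous_on UNIV (cdf (distr M borel (wt 0)))"
    and wt_variance: "variance (wt 0) > 0"
    and wt_moment: "\<exists>p>2. integrable M (\<lambda>\<omega>. \<bar>wt 0 \<omega>\<bar> powr p)"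

definition shape_function :: "'w measure \<Rightarrow> (site \<Rightarrow> 'w \<Rightarrow> real) \<Rightarrow> (point \<Rightarrow> real) \<Rightarrow> bool" where
  "shape_function M wt g \<longleftrightarrow>
     concave_on {v. 0 \<le> fst v \<and> 0 \<le> snd v} g \<and>
     (\<forall>a\<ge>0. \<forall>b\<ge>0. g (a, b) = g (b, a)) \<and>
     (\<forall>c\<ge>0. \<forall>v. 0 \<le> fst v \<and> 0 \<le> snd v \<longrightarrow> g (c *\<^sub>R v) = c * g v) \<and>
     (AE \<omega> in M.
        (\<lambda>n. Max ((\<lambda>x. \<bar>passage_time wt 0 x \<omega> - g (emb x)\<bar>) ` quadrant_sphere n) / real n)
          \<longlonglongrightarrow> 0)"

definition grad :: "(point \<Rightarrow> real) \<Rightarrow> point \<Rightarrow> sign \<Rightarrow> point" where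
  "grad g \<xi> \<sigma> =
     (Lim (at_right 0) (\<lambda>\<epsilon>. (g (\<xi> + (sgnval \<sigma> * \<epsilon>) *\<^sub>R e1) - g \<xi>) / (sgnval \<sigma> * \<epsilon>)),
      Lim (at_right 0) (\<lambda>\<epsilon>. (g (\<xi> - (sgnval \<sigma> * \<epsilon>) *\<^sub>R e2) - g \<xi>) / (- (sgnval \<sigma> * \<epsilon>))))"

definition diff_dirs :: "(point \<Rightarrow> real) \<Rightarrow> point set" where
  "diff_dirs g = {\<xi>\<in>riU. g differentiable (at \<xi>)}"

definition lin_seg_sign :: "(point \<Rightarrow> real) \<Rightarrow> point \<Rightarrow> sign \<Rightarrow> point set" where
  "lin_seg_sign g \<xi> \<sigma> = {\<zeta>\<in>riU. g \<zeta> - g \<xi> = grad g \<xi> \<sigma> \<bullet> (\<zeta> - \<xi>)}"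

definition lin_seg :: "(point \<Rightarrow> real) \<Rightarrow> point \<Rightarrow> point set" where
  "lin_seg g \<xi> = lin_seg_sign g \<xi> Minus \<union> lin_seg_sign g \<xi> Plus"

text \<open>The endpoints in \<open>lin_seg g \<xi> = [lower_end g \<xi>, upper_end g \<xi>]\<close>.\<close>

definition lower_end :: "(point \<Rightarrow> real) \<Rightarrow> point \<Rightarrow> point" where
  "lower_end g \<xi> = (THE a. a \<in> riU \<and> (\<exists>b\<in>riU. a \<preceq> b \<and> lin_seg g \<xi> = dIcc a b))"

definition upper_end :: "(point \<Rightarrow> real) \<Rightarrow> point \<Rightarrow> point" where
  "upper_end g \<xi> = (THE b. b \<in> riU \<and> (\<exists>a\<in>riU. a \<preceq> b \<and> lin_seg g \<xi> = dIcc a b))"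


section \<open>The Busemann process\<close>

locale busemann_process = lpp M T wt
  for M :: "'w::polish_space measure" and T wt +
  fixes g :: "point \<Rightarrow> real"
    and B :: "point \<Rightarrow> sign \<Rightarrow> site \<Rightarrow> site \<Rightarrow> 'w \<Rightarrow> real"
  assumes shape: "shape_function M wt g"
    and B_measurable:
      "(\<lambda>(x, y, \<omega>, \<xi>). B \<xi> \<sigma> x y \<omega>) \<in> borel_measurable
         (count_space UNIV \<Otimes>\<^sub>M count_space UNIV \<Otimes>\<^sub>M M \<Otimes>\<^sub>M restrict_space borel riU)"
    and B_cocycle:
      "\<exists>\<Omega>0\<in>events. prob \<Omega>0 = 1 \<and> (\<forall>z. T z -` \<Omega>0 = \<Omega>0) \<and>
         (\<forall>\<omega>\<in>\<Omega>0.
            (\<forall>\<xi>\<in>riU. \<forall>\<sigma> x y z. B \<xi> \<sigma> (x + z) (y + z) \<omega> = B \<xi> \<sigma> x y (T z \<omega>)) \<and>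
            (\<forall>\<xi>\<in>riU. \<forall>\<sigma> x y z. B \<xi> \<sigma> x y \<omega> + B \<xi> \<sigma> y z \<omega> = B \<xi> \<sigma> x z \<omega>) \<and>
            (\<forall>\<xi>\<in>riU. \<forall>\<sigma> x. min (B \<xi> \<sigma> x (x + e1) \<omega>) (B \<xi> \<sigma> x (x + e2) \<omega>) = wt x \<omega>) \<and>
            (\<forall>\<xi>\<in>riU. \<forall>\<xi>'\<in>riU. \<xi> \<prec> \<xi>' \<longrightarrow> (\<forall>x.
               B \<xi> Minus x (x + e1) \<omega> \<ge> B \<xi> Plus x (x + e1) \<omega> \<and>
               B \<xi> Plus x (x + e1) \<omega> \<ge> B \<xi>' Minus x (x + e1) \<omega> \<and>
               B \<xi>' Minus x (x + e1) \<omega> \<ge> B \<xi>' Plus x (x + e1) \<omega> \<and>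
               B \<xi> Minus x (x + e2) \<omega> \<le> B \<xi> Plus x (x + e2) \<omega> \<and>
               B \<xi> Plus x (x + e2) \<omega> \<le> B \<xi>' Minus x (x + e2) \<omega> \<and>
               B \<xi>' Minus x (x + e2) \<omega> \<le> B \<xi>' Plus x (x + e2) \<omega>)) \<and>
            (\<forall>\<xi>\<in>riU. \<forall>\<sigma> x y.
               ((\<lambda>\<zeta>. B \<zeta> \<sigma> x y \<omega>) \<longlongrightarrow> B \<xi> Minus x y \<omega>) (at \<xi> within {\<zeta>\<in>riU. \<zeta> \<prec> \<xi>}) \<and>
               ((\<lambda>\<zeta>. B \<zeta> \<sigma> x y \<omega>) \<longlongrightarrow> B \<xi> Plus x y \<omega>) (at \<xi> within {\<zeta>\<in>riU. \<xi> \<prec> \<zeta>})) \<and>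
            (\<forall>\<sigma> x.
               filterlim (\<lambda>\<xi>. B \<xi> \<sigma> x (x + e1) \<omega>) at_top (at e2 within riU) \<and>
               filterlim (\<lambda>\<xi>. B \<xi> \<sigma> x (x + e2) \<omega>) at_top (at e1 within riU)))"
    and B_integrable: "\<xi> \<in> riU \<Longrightarrow> integrable M (B \<xi> \<sigma> x y)"
    and B_mean:
      "\<xi> \<in> riU \<Longrightarrow> expectation (B \<xi> \<sigma> x (x + e1)) = grad g \<xi> \<sigma> \<bullet> e1"
      "\<xi> \<in> riU \<Longrightarrow> expectation (B \<xi> \<sigma> x (x + e2)) = grad g \<xi> \<sigma> \<bullet> e2"
    and B_grad_determined:
      "AE \<omega> in M. \<forall>\<zeta>\<in>riU. \<forall>\<eta>\<in>riU. \<forall>\<sigma>. grad g \<zeta> \<sigma> = grad g \<eta> \<sigma> \<longrightarrow>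
         (\<forall>x y. B \<zeta> \<sigma> x y \<omega> = B \<eta> \<sigma> x y \<omega>)"
    and B_indep:
      "indep_set
         (sigma_sets (space M)
            ({wt x -` A \<inter> space M | x A. x \<in> I \<and> A \<in> sets borel} \<union>
             {B \<xi> \<sigma> x y -` A \<inter> space M | \<xi> \<sigma> x y A.
                \<xi> \<in> riU \<and> x \<in> I \<and> x \<le> y \<and> A \<in> sets borel}))
         (sigma_sets (space M)
            {wt x -` A \<inter> space M | x A. (\<forall>z\<in>I. \<not> z \<le> x) \<and> A \<in> sets borel})"
    and B_no_ties:
      "\<xi> \<in> riU \<Longrightarrow> AE \<omega> in M. \<forall>x \<sigma>. B \<xi> \<sigma> x (x + e1) \<omega> \<noteq> B \<xi> \<sigma> x (x + e2) \<omega>"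
    and B_shape:
      "\<xi> \<in> riU \<Longrightarrow> AE \<omega> in M. \<forall>\<sigma>.
         (\<lambda>n. Max ((\<lambda>x. \<bar>B \<xi> \<sigma> 0 x \<omega> - emb x \<bullet> grad g \<xi> \<sigma>\<bar>) ` quadrant_sphere n) / real n)
           \<longlonglongrightarrow> 0"
    and B_no_jump:
      "\<xi> \<in> diff_dirs g \<Longrightarrow> AE \<omega> in M. \<forall>x y. B \<xi> Plus x y \<omega> = B \<xi> Minus x y \<omega>"
    and B_limit:
      "\<xi> \<in> diff_dirs g \<Longrightarrow> lower_end g \<xi> \<in> diff_dirs g \<Longrightarrow> upper_end g \<xi> \<in> diff_dirs g \<Longrightarrow>
       AE \<omega> in M. \<forall>\<sigma> x y. \<forall>v :: nat \<Rightarrow> site.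
         filterlim (\<lambda>n. norm (emb (v n))) at_top sequentially \<longrightarrow>
         (\<lambda>n. (1 / real n) *\<^sub>R emb (v n)) \<longlonglongrightarrow> \<xi> \<longrightarrow>
         (\<lambda>n. passage_time wt x (v n) \<omega> - passage_time wt y (v n) \<omega>) \<longlonglongrightarrow> B \<xi> \<sigma> x y \<omega>"


section \<open>Signed measures and Busemann measures\<close>

text \<open>Finite signed measures on the measurable space of \<open>N\<close> are set functions, made
  extensional by the value \<open>0\<close> on non-measurable sets.\<close>
definition signed_measure :: "'a measure \<Rightarrow> ('a set \<Rightarrow> real) \<Rightarrow> bool" where
  "signed_measure N m \<longleftrightarrow>
     m {} = 0 \<and>
     (\<forall>A :: nat \<Rightarrow> 'a set. range A \<subseteq> sets N \<longrightarrow> disjoint_family A \<longrightarrow>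
        (\<lambda>i. m (A i)) sums m (\<Union>i. A i)) \<and>
     (\<forall>A. A \<notin> sets N \<longrightarrow> m A = 0)"

definition total_variation :: "'a measure \<Rightarrow> ('a set \<Rightarrow> real) \<Rightarrow> 'a set \<Rightarrow> ennreal" where
  "total_variation N m A =
     (SUP P \<in> {P. finite P \<and> P \<subseteq> sets N \<and> partition_on A P}. \<Sum>C\<in>P. ennreal \<bar>m C\<bar>)"

definition signed_support :: "point set \<Rightarrow> (point set \<Rightarrow> real) \<Rightarrow> point set" where
  "signed_support K m =
     \<Inter>{C. C \<subseteq> K \<and> closed C \<and> total_variation (restrict_space borel K) m (K - C) = 0}"

context
  fixes B :: "point \<Rightarrow> sign \<Rightarrow> site \<Rightarrow> site \<Rightarrow> 'w \<Rightarrow> real"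
begin

definition busemann_measure :: "'w \<Rightarrow> site \<Rightarrow> site \<Rightarrow> point set \<Rightarrow> (point set \<Rightarrow> real)" where
  "busemann_measure \<omega> x y K =
     (THE m. signed_measure (restrict_space borel K) m \<and>
        (\<forall>\<zeta>\<in>riU. \<forall>\<eta>\<in>riU. \<zeta> \<prec> \<eta> \<and> dIcc \<zeta> \<eta> \<subseteq> K \<longrightarrow>
           m (dIoc \<zeta> \<eta>) = B \<eta> Plus x y \<omega> - B \<zeta> Plus x y \<omega> \<and>
           m (dIco \<zeta> \<eta>) = B \<eta> Minus x y \<omega> - B \<zeta> Minus x y \<omega>))"

definition supp_mu :: "'w \<Rightarrow> site \<Rightarrow> site \<Rightarrow> point set" where
  "supp_mu \<omega> x y =
     (\<Union>(\<zeta>, \<eta>) \<in> {(\<zeta>, \<eta>). \<zeta> \<in> riU \<and> \<eta> \<in> riU \<and> \<zeta> \<prec> \<eta>}.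
        signed_support (dIcc \<zeta> \<eta>) (busemann_measure \<omega> x y (dIcc \<zeta> \<eta>)))"

definition exceptional_dirs :: "'w \<Rightarrow> point set" where
  "exceptional_dirs \<omega> = (\<Union>x y. supp_mu \<omega> x y)"


section \<open>Geodesic, dual and instability graphs\<close>

definition successor :: "'w \<Rightarrow> point \<Rightarrow> sign \<Rightarrow> site \<Rightarrow> site" where
  "successor \<omega> \<xi> \<sigma> x =
     (if B \<xi> \<sigma> x (x + e1) \<omega> < B \<xi> \<sigma> x (x + e2) \<omega> then x + e1
      else if B \<xi> \<sigma> x (x + e1) \<omega> > B \<xi> \<sigma> x (x + e2) \<omega> then x + e2
      else x + e_sign \<sigma>)"

definition geo_graph :: "'w \<Rightarrow> point \<Rightarrow> sign \<Rightarrow> site pair_pre_digraph" where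
  "geo_graph \<omega> \<xi> \<sigma> = \<lparr> pverts = UNIV, parcs = {(x, successor \<omega> \<xi> \<sigma> x) | x. True} \<rparr>"

definition dual :: "site \<Rightarrow> point" where
  "dual x = emb x + (1/2) *\<^sub>R ehat"

definition dual_graph :: "'w \<Rightarrow> point \<Rightarrow> sign \<Rightarrow> point pair_pre_digraph" where
  "dual_graph \<omega> \<xi> \<sigma> = \<lparr> pverts = range dual,
     parcs = {(dual x, dual x - e1) | x. (x, x + e1) \<in> parcs (geo_graph \<omega> \<xi> \<sigma>)} \<union>
             {(dual x, dual x - e2) | x. (x, x + e2) \<in> parcs (geo_graph \<omega> \<xi> \<sigma>)} \<rparr>"

definition graph_Union :: "'a pair_pre_digraph set \<Rightarrow> 'a pair_pre_digraph" where
  "graph_Union \<G> = \<lparr> pverts = (\<Union>G\<in>\<G>. pverts G), parcs = (\<Union>G\<in>\<G>. parcs G) \<rparr>"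

definition dual_graph_Union :: "'w \<Rightarrow> point \<Rightarrow> point \<Rightarrow> point pair_pre_digraph" where
  "dual_graph_Union \<omega> \<zeta> \<eta> = graph_Union {dual_graph \<omega> \<xi> \<sigma> | \<xi> \<sigma>. \<xi> \<in> dIcc \<zeta> \<eta>}"

definition instability_points :: "'w \<Rightarrow> point \<Rightarrow> point \<Rightarrow> point set" where
  "instability_points \<omega> \<zeta> \<eta> = {dual x | x. dIcc \<zeta> \<eta> \<inter> supp_mu \<omega> (x + e1) (x + e2) \<noteq> {}}"

definition instability_graph :: "'w \<Rightarrow> point \<Rightarrow> point \<Rightarrow> point pair_pre_digraph" where
  "instability_graph \<omega> \<zeta> \<eta> = \<lparr> pverts = instability_points \<omega> \<zeta> \<eta>,
     parcs = {(a, b) \<in> parcs (dual_graph_Union \<omega> \<zeta> \<eta>).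
                a \<in> instability_points \<omega> \<zeta> \<eta> \<and> b \<in> instability_points \<omega> \<zeta> \<eta>} \<rparr>"

end

text \<open>Arcs of the dual graphs lower the level by one, so every bi-infinite directed path has
  exactly one parametrization by levels, traversed from \<open>p n\<close> to \<open>p (n - 1)\<close>.\<close>
definition bi_infinite_path :: "point pair_pre_digraph \<Rightarrow> (int \<Rightarrow> point) \<Rightarrow> bool" where
  "bi_infinite_path G p \<longleftrightarrow>
     (\<forall>n. p n \<in> pverts G \<and> p n \<bullet> ehat = real_of_int n \<and> (p n, p (n - 1)) \<in> parcs G)"

definition path_graph :: "(int \<Rightarrow> point) \<Rightarrow> point pair_pre_digraph" where
  "path_graph p = \<lparr> pverts = range p, parcs = {(p n, p (n - 1)) | n. True} \<rparr>"

definition limit_points :: "(nat \<Rightarrow> 'a::topological_space) \<Rightarrow> 'a set" where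
  "limit_points s = {l. \<exists>r :: nat \<Rightarrow> nat. strict_mono r \<and> (s \<circ> r) \<longlonglongrightarrow> l}"

definition backward_directed :: "point set \<Rightarrow> (int \<Rightarrow> point) \<Rightarrow> bool" where
  "backward_directed A p \<longleftrightarrow> limit_points (\<lambda>n. (1 / real n) *\<^sub>R p (int n)) \<subseteq> A"

end

theory Submission
  imports Defs
begin

text \<open>
  Write \<open>V1 x\<close> and \<open>V2 x\<close> if the Busemann increments on the edges from \<open>x\<close> to \<open>x + e1\<close> and \<open>x + e2\<close> vary
  over every neighbourhood of the interval \<open>[\<zeta>, \<eta>]\<close>. By monotonicity no cancellation occurs in the four
  edges around a dual point, so \<open>dual x\<close> is an instability point iff \<open>V1 x \<or> V2 x\<close> iff
  \<open>V1 (x + e2) \<or> V2 (x + e1)\<close>. Since one of the two increments at a site equals its weight, \<open>V1 x\<close> and \<open>V2 x\<close>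
  force the dual arcs from \<open>dual x\<close> across these edges; hence every instability point, and every arc between two of
  them, lies on a bi-infinite path of instability points.

  Conversely, let a bi-infinite path contain a dual point which is not an instability point. The
  Busemann function is then constant there between two rational directions \<open>\<alpha>\<close> and \<open>\<beta>\<close> around \<open>[\<zeta>, \<eta>]\<close>. As there are no
  ties in the directions \<open>\<alpha>\<close> and \<open>\<beta>\<close>, this constancy propagates backwards along the path, which is thus
  a path of the dual graph in the fixed direction \<open>\<beta>\<close>.
  But almost surely that graph has no dual point with infinitely many generations of ancestors. Otherwise
  there would be two of them on one antidiagonal with positive probability. Their ancestry and the Busemann
  function on that antidiagonal are independent of the weights below it, and suitable
  weights below squeeze out the sites between the two paths, which then merge; by
  mass transport, merging has probability zero.

  For the directedness, a path translated by \<open>e1\<close> or \<open>e2\<close> has Busemann increments that are monotone in the direction outside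
  \<open>[\<zeta>, \<eta>]\<close>. By the shape theorem for Busemann functions, a limit point \<open>v\<close> therefore satisfies
  \<open>v \<bullet> grad g \<beta> \<le> v \<bullet> grad g \<beta>'\<close> for rational directions \<open>\<eta> \<prec> \<beta> \<prec> \<beta>'\<close>, and symmetrically
  below \<open>\<zeta>\<close>, which by concavity confines \<open>v\<close> to the linear segments at the two ends.
\<close>

section \<open>Directions\<close>

text \<open>One null set has to serve all pairs \<open>\<zeta>\<close>, \<open>\<eta>\<close>,
  whereas absence of ties, absence of immortal dual points and the shape theorem hold almost surely
  for one direction at a time, and may well fail in the random directions of interest. Probability
  is therefore spent on rational directions only. Everything else is deterministic and happens in
  one sample (\<open>busemann_sample\<close>), where rationals strictly outside
  \<open>[\<zeta>, \<eta>]\<close> are compared with the interval by monotonicity.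

  Independence replaces a modification of the environment: prescribing finitely many weights below
  an antidiagonal has positive probability and does not disturb what happens above it.

  Gradients, Busemann measures and the ends of linear segments are defined through limits and
  definite descriptions, so their existence has to be proved. For the linear segments this means
  that they stay away from \<open>e1\<close> and \<open>e2\<close>: near these corners the Busemann
  increments blow up, and since the gradient determines them, \<open>g\<close> cannot be affine
  there.\<close>

no_notation lesspoll (infixl "\<prec>" 50)

definition dir :: "real \<Rightarrow> point" where "dir t = (t, 1 - t)"

lemma fst_dir [simp]: "fst (dir t) = t" and snd_dir [simp]: "snd (dir t) = 1 - t"
  by (simp_all add: dir_def)

lemma dir_eq_iff [simp]: "dir s = dir t \<longleftrightarrow> s = t"
  by (simp add: dir_def)

lemma segU_eq: "segU = dir ` {0..1}"
  by (auto simp: segU_def e1_def e2_def dir_def)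

lemma riU_eq: "riU = dir ` {0<..<1}"
  by (force simp: riU_def segU_eq e1_def e2_def dir_def)

lemma dir_in_riU [simp]: "dir t \<in> riU \<longleftrightarrow> 0 < t \<and> t < 1"
  by (auto simp: riU_eq)

lemma riU_cases:
  assumes "\<xi> \<in> riU" obtains t where "\<xi> = dir t" "0 < t" "t < 1"
  using assms by (auto simp: riU_eq)

lemma dprec_dir [simp]: "dir s \<prec> dir t \<longleftrightarrow> s < t"
  by (simp add: dprec_def dir_def ehat_def e1_def e2_def)

lemma dpreceq_dir [simp]: "dir s \<preceq> dir t \<longleftrightarrow> s \<le> t"
  by (simp add: dpreceq_def dir_def ehat_def e1_def e2_def)

lemma dIcc_dir: "0 \<le> s \<Longrightarrow> t \<le> 1 \<Longrightarrow> dIcc (dir s) (dir t) = dir ` {s..t}"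
  by (auto simp: dIcc_def segU_eq)

lemma dIoc_dir: "0 \<le> s \<Longrightarrow> t \<le> 1 \<Longrightarrow> dIoc (dir s) (dir t) = dir ` {s<..t}"
  by (auto simp: dIoc_def segU_eq)

lemma dIco_dir: "0 \<le> s \<Longrightarrow> t \<le> 1 \<Longrightarrow> dIco (dir s) (dir t) = dir ` {s..<t}"
  by (auto simp: dIco_def segU_eq)

lemma inj_dir: "inj dir"
  by (auto simp: inj_def)

lemma continuous_on_dir [continuous_intros]: "continuous_on S dir"
  unfolding dir_def by (intro continuous_intros)

primrec at_side :: "sign \<Rightarrow> real \<Rightarrow> real filter" where
  "at_side Minus t = at_left t"
| "at_side Plus t = at_right t"

lemma at_side_neq_bot [simp]: "at_side \<sigma> t \<noteq> bot"
  by (cases \<sigma>) auto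

section \<open>Concave functions and the shape function\<close>

text \<open>The three-point inequality \<open>*\<close> is stated without division; the three
  positions of \<open>t\<close> relative to \<open>r < s\<close> are instances of it.\<close>

lemma concave_slope_antimono:
  fixes f :: "real \<Rightarrow> real"
  assumes f: "concave_on {a..b} f" and "a \<le> r" "r < s" "s \<le> b" "t \<in> {a..b}" "r \<noteq> t" "s \<noteq> t"
  shows "(f s - f t) / (s - t) \<le> (f r - f t) / (r - t)"
proof -
  have *: "(f y - f x) * (z - y) \<ge> (f z - f y) * (y - x)"
    if "a \<le> x" "x < y" "y < z" "z \<le> b" for x y z
  proof -
    define u where "u = (y - x) / (z - x)"
    have uz: "u * (z - x) = y - x" and u: "0 \<le> u" "u \<le> 1"
      using that by (auto simp: u_def)
    from uz have y: "y = (1 - u) * x + u * z" by (simp add: algebra_simps)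
    have "(1 - u) * f x + u * f z \<le> f y"
      using f u y that by (simp add: concave_on_iff)
    then have "(z - x) * ((1 - u) * f x + u * f z) \<le> (z - x) * f y"
      using that by (intro mult_left_mono) auto
    moreover have "(z - x) * ((1 - u) * f x + u * f z) = ((z - x) - u * (z - x)) * f x + (u * (z - x)) * f z"
      by (simp add: algebra_simps)
    ultimately show ?thesis
      unfolding uz by (simp add: algebra_simps)
  qed
  consider "s < t" | "r < t" "t < s" | "t < r" using assms by linarith
  then show ?thesis
  proof cases
    case 1 then show ?thesis using *[of r s t] assms by (simp add: divide_simps) (simp add: algebra_simps)
  next
    case 2 then show ?thesis using *[of r t s] assms by (simp add: divide_simps) (simp add: algebra_simps)
  next
    case 3 then show ?thesis using *[of t r s] assms by (simp add: divide_simps) (simp add: algebra_simps)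
  qed
qed

text \<open>Monotone difference quotients converge from either side, to their supremum on the right
  and to their infimum on the left. This limit separates the quotients left of \<open>t\<close> from
  those right of \<open>t\<close>, which is exactly the supergradient inequality.\<close>

lemma concave_one_sided_derivative:
  fixes f :: "real \<Rightarrow> real"
  assumes f: "concave_on {a..b} f" and t: "a < t" "t < b"
  obtains D where "((\<lambda>s. (f s - f t) / (s - t)) \<longlongrightarrow> D) (at_side \<sigma> t)"
    and "\<And>s. s \<in> {a..b} \<Longrightarrow> f s \<le> f t + D * (s - t)"
proof -
  let ?q = "\<lambda>s. (f s - f t) / (s - t)"
  have anti: "?q s \<le> ?q r" if "a \<le> r" "r < s" "s \<le> b" "r \<noteq> t" "s \<noteq> t" for r s
    using concave_slope_antimono[OF f, of r s t] that t by auto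
  have "\<exists>D. (?q \<longlongrightarrow> D) (at_side \<sigma> t) \<and> (\<forall>s\<in>{a..<t}. D \<le> ?q s) \<and> (\<forall>s\<in>{t<..b}. ?q s \<le> D)"
  proof (cases \<sigma>)
    case Plus
    let ?D = "SUP s\<in>{t<..b}. ?q s"
    have bdd: "bdd_above (?q ` {t<..b})"
      using t anti[of a] by (intro bdd_aboveI[where M = "?q a"]) auto
    have "(?q \<longlongrightarrow> ?D) (at_right t)"
    proof (rule increasing_tendsto)
      show "\<forall>\<^sub>F s in at_right t. ?q s \<le> ?D"
        unfolding eventually_at_right_field
        by (rule exI[of _ b]) (use t in \<open>auto intro!: cSUP_upper bdd\<close>)
      fix x assume "x < ?D"
      then obtain r where r: "r \<in> {t<..b}" "x < ?q r"
        using less_cSUP_iff[OF _ bdd] t by auto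
      then show "\<forall>\<^sub>F s in at_right t. x < ?q s"
        unfolding eventually_at_right_field
        by (intro exI[of _ r]) (use t in \<open>auto intro: less_le_trans[OF _ anti[of _ r]]\<close>)
    qed
    moreover have "?D \<le> ?q s" if "s \<in> {a..<t}" for s
      using that t anti[of s] by (intro cSUP_least) auto
    ultimately show ?thesis
      using Plus bdd by (intro exI[of _ ?D]) (auto intro!: cSUP_upper)
  next
    case Minus
    let ?D = "INF s\<in>{a..<t}. ?q s"
    have bdd: "bdd_below (?q ` {a..<t})"
      using t anti[of _ b] by (intro bdd_belowI[where m = "?q b"]) auto
    have "(?q \<longlongrightarrow> ?D) (at_left t)"
    proof (rule decreasing_tendsto)
      show "\<forall>\<^sub>F s in at_left t. ?D \<le> ?q s"
        unfolding eventually_at_left_field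
        by (rule exI[of _ a]) (use t in \<open>auto intro!: cINF_lower bdd\<close>)
      fix x assume "?D < x"
      then obtain r where r: "r \<in> {a..<t}" "?q r < x"
        using cINF_less_iff[OF _ bdd] t by auto
      then show "\<forall>\<^sub>F s in at_left t. ?q s < x"
        unfolding eventually_at_left_field
        by (intro exI[of _ r]) (use t in \<open>auto intro: le_less_trans[OF anti[of r]]\<close>)
    qed
    moreover have "?q s \<le> ?D" if "s \<in> {t<..b}" for s
      using that t anti[of _ s] by (intro cINF_greatest) auto
    ultimately show ?thesis
      using Minus bdd by (intro exI[of _ ?D]) (auto intro!: cINF_lower)
  qed
  then obtain D where D: "(?q \<longlongrightarrow> D) (at_side \<sigma> t)"
    "\<And>s. s \<in> {a..<t} \<Longrightarrow> D \<le> ?q s" "\<And>s. s \<in> {t<..b} \<Longrightarrow> ?q s \<le> D"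
    by blast
  have "f s \<le> f t + D * (s - t)" if "s \<in> {a..b}" for s
    using D(2,3)[of s] that by (cases s t rule: linorder_cases) (auto simp: field_simps)
  with D(1) show ?thesis using that by blast
qed

lemma at_side_tendsto_if_quotient_tendsto:
  fixes f :: "real \<Rightarrow> real"
  assumes "((\<lambda>s. (f s - f t) / (s - t)) \<longlongrightarrow> D) (at_side \<sigma> t)"
  shows "(f \<longlongrightarrow> f t) (at_side \<sigma> t)"
proof -
  have id: "((\<lambda>s. s) \<longlongrightarrow> t) (at_side \<sigma> t)"
    by (cases \<sigma>) (auto intro: tendsto_ident_at)
  have "((\<lambda>s. f t + (f s - f t) / (s - t) * (s - t)) \<longlongrightarrow> f t + D * (t - t)) (at_side \<sigma> t)"
    by (rule tendsto_add[OF tendsto_const tendsto_mult[OF assms tendsto_diff[OF id tendsto_const]]])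
  moreover have "\<forall>\<^sub>F s in at_side \<sigma> t. f t + (f s - f t) / (s - t) * (s - t) = f s"
    by (cases \<sigma>) (simp_all add: eventually_at_filter)
  ultimately show ?thesis
    by (simp add: Lim_transform_eventually[of _ "f t"])
qed

lemma filterlim_at_side:
  assumes "(S \<longlongrightarrow> t) F" "\<forall>\<^sub>F x in F. 0 < sgnval \<sigma> * (S x - t)"
  shows "filterlim S (at_side \<sigma> t) F"
  using assms by (cases \<sigma>) (simp_all add: filterlim_at, (erule eventually_mono, simp)+)

text \<open>By homogeneity, moving from \<open>dir t\<close> along \<open>e1\<close> or
  \<open>- e2\<close> amounts to rescaling and moving along the segment of directions, to the side
  given by \<open>\<sigma>\<close> in both cases. The product rule then yields both one-sided
  partial derivatives from the single derivative \<open>D\<close>.\<close>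

lemma grad_dir:
  assumes hom: "\<And>c v. 0 \<le> c \<Longrightarrow> 0 \<le> fst v \<Longrightarrow> 0 \<le> snd v \<Longrightarrow> g (c *\<^sub>R v) = c * g v"
    and t: "0 < t" "t < 1"
    and D: "((\<lambda>s. (g (dir s) - g (dir t)) / (s - t)) \<longlongrightarrow> D) (at_side \<sigma> t)"
  shows "grad g (dir t) \<sigma> = (g (dir t) + (1 - t) * D, g (dir t) - t * D)"
proof -
  define f where "f s = g (dir s)" for s
  define \<delta> where "\<delta> \<epsilon> = sgnval \<sigma> * \<epsilon>" for \<epsilon>
  have D': "((\<lambda>s. (f s - f t) / (s - t)) \<longlongrightarrow> D) (at_side \<sigma> t)"
    using D by (simp add: f_def)
  have \<delta>0: "(\<delta> \<longlongrightarrow> 0) (at_right 0)"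
    unfolding \<delta>_def by (auto intro!: tendsto_eq_intros)
  have ev: "\<forall>\<^sub>F \<epsilon> in at_right 0. 0 < \<epsilon> \<and> \<bar>\<delta> \<epsilon>\<bar> < min t (1 - t)"
    unfolding eventually_at_right_field
    by (rule exI[of _ "min t (1 - t)"]) (use t in \<open>cases \<sigma>, auto simp: \<delta>_def\<close>)
  \<comment> \<open>\<open>\<kappa>\<close> is the rate of change of the scale and \<open>c\<close>
    that of the direction: \<open>1\<close> and \<open>1 - t\<close> along \<open>e1\<close>,
    \<open>- 1\<close> and \<open>t\<close> along \<open>- e2\<close>.\<close>
  have ray: "((\<lambda>\<epsilon>. ((1 + \<kappa> * \<delta> \<epsilon>) * f (S \<epsilon>) - f t) / \<delta> \<epsilon>) \<longlongrightarrow> \<kappa> * f t + c * D) (at_right 0)"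
    if c: "0 < c" and S: "(S \<longlongrightarrow> t) (at_right 0)"
      and pos: "\<And>\<epsilon>. \<bar>\<delta> \<epsilon>\<bar> < min t (1 - t) \<Longrightarrow> 0 < 1 + \<kappa> * \<delta> \<epsilon>"
      and eq: "\<And>\<epsilon>. \<bar>\<delta> \<epsilon>\<bar> < min t (1 - t) \<Longrightarrow> S \<epsilon> - t = \<delta> \<epsilon> * c / (1 + \<kappa> * \<delta> \<epsilon>)" for S \<kappa> c
  proof -
    have lim: "filterlim S (at_side \<sigma> t) (at_right 0)"
    proof (rule filterlim_at_side[OF S])
      show "\<forall>\<^sub>F \<epsilon> in at_right 0. 0 < sgnval \<sigma> * (S \<epsilon> - t)"
        using ev
      proof eventually_elim
        case (elim \<epsilon>)
        have "sgnval \<sigma> * (S \<epsilon> - t) = \<epsilon> * c / (1 + \<kappa> * \<delta> \<epsilon>)"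
          using eq[OF conjunct2[OF elim]] by (cases \<sigma>) (simp_all add: \<delta>_def)
        then show ?case using elim c pos[OF conjunct2[OF elim]] by (auto intro!: divide_pos_pos mult_pos_pos)
      qed
    qed
    have "((\<lambda>\<epsilon>. \<kappa> * f (S \<epsilon>) + (f (S \<epsilon>) - f t) / (S \<epsilon> - t) * (c / (1 + \<kappa> * \<delta> \<epsilon>)))
        \<longlongrightarrow> \<kappa> * f t + D * (c / (1 + \<kappa> * 0))) (at_right 0)"
      by (intro tendsto_intros \<delta>0 filterlim_compose[OF D' lim]
            filterlim_compose[OF at_side_tendsto_if_quotient_tendsto[OF D'] lim]) auto
    moreover have "\<forall>\<^sub>F \<epsilon> in at_right 0. \<kappa> * f (S \<epsilon>) + (f (S \<epsilon>) - f t) / (S \<epsilon> - t) * (c / (1 + \<kappa> * \<delta> \<epsilon>))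
        = ((1 + \<kappa> * \<delta> \<epsilon>) * f (S \<epsilon>) - f t) / \<delta> \<epsilon>"
      using ev
    proof eventually_elim
      case (elim \<epsilon>)
      then have d: "1 + \<kappa> * \<delta> \<epsilon> > 0" "\<delta> \<epsilon> \<noteq> 0" using pos[OF conjunct2[OF elim]] by (cases \<sigma>; auto simp: \<delta>_def)+
      then have "(f (S \<epsilon>) - f t) / (S \<epsilon> - t) * (c / (1 + \<kappa> * \<delta> \<epsilon>)) = (f (S \<epsilon>) - f t) / \<delta> \<epsilon>"
        using eq[OF conjunct2[OF elim]] c by simp
      then show ?case using d by (simp add: field_simps)
    qed
    ultimately show ?thesis
      by (subst (asm) tendsto_cong) (simp_all add: mult.commute)
  qed
  have "((\<lambda>\<epsilon>. (g (dir t + \<delta> \<epsilon> *\<^sub>R e1) - g (dir t)) / \<delta> \<epsilon>) \<longlongrightarrow> f t + (1 - t) * D) (at_right 0)"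
  proof -
    define S where "S \<epsilon> = (t + \<delta> \<epsilon>) / (1 + \<delta> \<epsilon>)" for \<epsilon>
    have "((\<lambda>\<epsilon>. ((1 + 1 * \<delta> \<epsilon>) * f (S \<epsilon>) - f t) / \<delta> \<epsilon>) \<longlongrightarrow> 1 * f t + (1 - t) * D) (at_right 0)"
    proof (rule ray)
      show "(S \<longlongrightarrow> t) (at_right 0)"
        unfolding S_def by (auto intro!: tendsto_eq_intros \<delta>0)
    qed (use t in \<open>auto simp: S_def field_simps\<close>)
    moreover have "\<forall>\<^sub>F \<epsilon> in at_right 0. ((1 + 1 * \<delta> \<epsilon>) * f (S \<epsilon>) - f t) / \<delta> \<epsilon> =
        (g (dir t + \<delta> \<epsilon> *\<^sub>R e1) - g (dir t)) / \<delta> \<epsilon>"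
      using ev
    proof eventually_elim
      case (elim \<epsilon>)
      then have "dir t + \<delta> \<epsilon> *\<^sub>R e1 = (1 + \<delta> \<epsilon>) *\<^sub>R dir (S \<epsilon>)" "0 \<le> S \<epsilon>" "S \<epsilon> \<le> 1" "0 \<le> 1 + \<delta> \<epsilon>"
        using t by (auto simp: S_def dir_def e1_def field_simps)
      then show ?case using hom[of "1 + \<delta> \<epsilon>" "dir (S \<epsilon>)"] by (simp add: f_def)
    qed
    ultimately show ?thesis by (subst (asm) tendsto_cong) simp_all
  qed
  then have 1: "Lim (at_right 0) (\<lambda>\<epsilon>. (g (dir t + \<delta> \<epsilon> *\<^sub>R e1) - g (dir t)) / \<delta> \<epsilon>) = f t + (1 - t) * D"
    by (intro tendsto_Lim) auto
  have "((\<lambda>\<epsilon>. (g (dir t - \<delta> \<epsilon> *\<^sub>R e2) - g (dir t)) / (- \<delta> \<epsilon>)) \<longlongrightarrow> f t - t * D) (at_right 0)"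
  proof -
    define S where "S \<epsilon> = t / (1 - \<delta> \<epsilon>)" for \<epsilon>
    have "((\<lambda>\<epsilon>. ((1 + - 1 * \<delta> \<epsilon>) * f (S \<epsilon>) - f t) / \<delta> \<epsilon>) \<longlongrightarrow> - 1 * f t + t * D) (at_right 0)"
    proof (rule ray)
      show "(S \<longlongrightarrow> t) (at_right 0)"
        unfolding S_def by (auto intro!: tendsto_eq_intros \<delta>0)
    qed (use t in \<open>auto simp: S_def field_simps\<close>)
    from tendsto_minus[OF this]
    have "((\<lambda>\<epsilon>. - (((1 + - 1 * \<delta> \<epsilon>) * f (S \<epsilon>) - f t) / \<delta> \<epsilon>)) \<longlongrightarrow> f t - t * D) (at_right 0)" by simp
    moreover have "\<forall>\<^sub>F \<epsilon> in at_right 0. - (((1 + - 1 * \<delta> \<epsilon>) * f (S \<epsilon>) - f t) / \<delta> \<epsilon>) =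
        (g (dir t - \<delta> \<epsilon> *\<^sub>R e2) - g (dir t)) / (- \<delta> \<epsilon>)"
      using ev
    proof eventually_elim
      case (elim \<epsilon>)
      then have "dir t - \<delta> \<epsilon> *\<^sub>R e2 = (1 - \<delta> \<epsilon>) *\<^sub>R dir (S \<epsilon>)" "0 \<le> S \<epsilon>" "S \<epsilon> \<le> 1" "0 \<le> 1 - \<delta> \<epsilon>"
        using t by (auto simp: S_def dir_def e2_def field_simps)
      then show ?case using hom[of "1 - \<delta> \<epsilon>" "dir (S \<epsilon>)"] by (simp add: f_def)
    qed
    ultimately show ?thesis by (subst (asm) tendsto_cong) simp_all
  qed
  then have 2: "Lim (at_right 0) (\<lambda>\<epsilon>. (g (dir t - \<delta> \<epsilon> *\<^sub>R e2) - g (dir t)) / (- \<delta> \<epsilon>)) = f t - t * D"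
    by (intro tendsto_Lim) auto
  show ?thesis
    using 1 2 by (simp add: grad_def \<delta>_def f_def)
qed

text \<open>Concavity makes the contact set convex, continuity makes it relatively closed, and the
  two nonlinearity hypotheses supply points \<open>p\<close> and \<open>q\<close> outside it on
  either side of \<open>t\<close>. It is thus trapped in a compact subinterval of the open unit
  interval and attains its ends.\<close>

lemma affine_contact_interval:
  fixes f :: "real \<Rightarrow> real"
  assumes f: "concave_on {0..1} f" and t: "0 < t" "t < 1"
    and sup: "\<And>s. s \<in> {0..1} \<Longrightarrow> f s \<le> f t + D * (s - t)"
    and nonlin0: "\<And>r. 0 < r \<Longrightarrow> \<exists>s\<in>{0<..<r}. f s \<noteq> f t + D * (s - t)"
    and nonlin1: "\<And>r. r < 1 \<Longrightarrow> \<exists>s\<in>{r<..<1}. f s \<noteq> f t + D * (s - t)"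
  obtains a b where "0 < a" "a \<le> t" "t \<le> b" "b < 1"
    and "{s\<in>{0<..<1}. f s = f t + D * (s - t)} = {a..b}"
proof -
  let ?S = "{s\<in>{0<..<1}. f s = f t + D * (s - t)}"
  define h where "h s = f s - f t - D * (s - t)" for s
  have S: "s \<in> ?S \<longleftrightarrow> s \<in> {0<..<1} \<and> h s = 0" for s by (auto simp: h_def)
  have tS: "t \<in> ?S" using t by simp
  \<comment> \<open>Only on the open interval: a concave function may jump at \<open>0\<close> and
    \<open>1\<close>.\<close>
  have "continuous_on {0<..<1} (\<lambda>x. - f x)"
    using f by (intro convex_on_continuous) (auto simp: concave_on_def intro: convex_on_subset)
  then have "continuous_on {0<..<1} (\<lambda>x. - (- f x))" by (rule continuous_on_minus)
  then have cont_h: "continuous_on {0<..<1} h"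
    unfolding minus_minus h_def[abs_def] by (intro continuous_intros)
  have le: "h s \<le> 0" if "s \<in> {0..1}" for s using sup[OF that] by (simp add: h_def)
  have mid: "y \<in> ?S" if "x \<in> ?S" "z \<in> ?S" "x \<le> y" "y \<le> z" for x y z
  proof (cases "x = z")
    case False
    define u where "u = (y - x) / (z - x)"
    have uz: "u * (z - x) = y - x" and u: "0 \<le> u" "0 \<le> 1 - u"
      using that False by (auto simp: u_def)
    from uz have y: "(1 - u) * x + u * z = y" by (simp add: algebra_simps)
    have "(1 - u) * f x + u * f z \<le> f y"
      using f[unfolded concave_on_iff, THEN conjunct2, THEN bspec, THEN bspec, rule_format,
          of x z "1 - u" u, unfolded real_scaleR_def y] u that by simp
    moreover have "f x = f t + D * (x - t)" "f z = f t + D * (z - t)" using that by auto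
    then have "(1 - u) * f x + u * f z = f t + D * ((1 - u) * x + u * z - t)"
      by (simp only:) (simp add: algebra_simps)
    ultimately have "f t + D * (y - t) \<le> f y" by (simp only: y)
    with le[of y] that show ?thesis by (auto simp: h_def)
  qed (use that in auto)
  obtain p where p: "0 < p" "p < t" "p \<notin> ?S" using nonlin0[OF t(1)] t by auto
  obtain q where q: "t < q" "q < 1" "q \<notin> ?S" using nonlin1[OF t(2)] t by auto
  have sub: "?S \<subseteq> {p..q}"
  proof
    fix s assume s: "s \<in> ?S"
    then have "p \<le> s" "s \<le> q" using mid[OF s tS, of p] mid[OF tS s, of q] p q by linarith+
    then show "s \<in> {p..q}" by simp
  qed
  have eq: "?S = {s\<in>{p..q}. h s = 0}"
  proof (intro equalityI subsetI)
    fix s assume "s \<in> {s\<in>{p..q}. h s = 0}"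
    then have "s \<in> {0<..<1} \<and> h s = 0" using p q by simp
    then show "s \<in> ?S" using S[of s] by blast
  qed (use sub S in blast)
  have "continuous_on {p..q} h"
    using p q by (intro continuous_on_subset[OF cont_h]) auto
  then have "closed {s\<in>{p..q}. h s = 0}"
    by (rule continuous_closed_preimage_constant) simp
  then have "compact ({p..q} \<inter> {s\<in>{p..q}. h s = 0})"
    by (intro compact_Int_closed compact_Icc)
  moreover have "{p..q} \<inter> {s\<in>{p..q}. h s = 0} = {s\<in>{p..q}. h s = 0}" by auto
  ultimately have "compact ?S" unfolding eq by (simp only:)
  then obtain a b where ab: "a \<in> ?S" "\<And>s. s \<in> ?S \<Longrightarrow> a \<le> s" "b \<in> ?S" "\<And>s. s \<in> ?S \<Longrightarrow> s \<le> b"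
    using compact_attains_inf[of ?S] compact_attains_sup[of ?S] tS by blast
  have "?S = {a..b}"
  proof (intro equalityI subsetI)
    fix s assume "s \<in> ?S"
    then show "s \<in> {a..b}" using ab(2,4)[of s] unfolding atLeastAtMost_iff by blast
  next
    fix s assume "s \<in> {a..b}"
    then show "s \<in> ?S" using mid[OF ab(1,3), of s] unfolding atLeastAtMost_iff by blast
  qed
  moreover have "0 < a" using ab(1) by simp
  moreover have "b < 1" using ab(3) by simp
  ultimately show ?thesis using that ab(2)[OF tS] ab(4)[OF tS] by blast
qed

section \<open>One-sided derivatives, tangents and contact sets of a concave profile\<close>

definition side_deriv :: "(real \<Rightarrow> real) \<Rightarrow> sign \<Rightarrow> real \<Rightarrow> real" where
  "side_deriv f \<sigma> t = Lim (at_side \<sigma> t) (\<lambda>s. (f s - f t) / (s - t))"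

locale concave_profile =
  fixes f :: "real \<Rightarrow> real"
  assumes concave: "concave_on {0..1} f"
begin

lemma side_deriv_tendsto:
    "0 < t \<Longrightarrow> t < 1 \<Longrightarrow> ((\<lambda>s. (f s - f t) / (s - t)) \<longlongrightarrow> side_deriv f \<sigma> t) (at_side \<sigma> t)"
  and supergradient: 
    "0 < t \<Longrightarrow> t < 1 \<Longrightarrow> 0 \<le> s \<Longrightarrow> s \<le> 1 \<Longrightarrow> f s \<le> f t + side_deriv f \<sigma> t * (s - t)"
proof -
  assume t: "0 < t" "t < 1"
  obtain D where D: "((\<lambda>s. (f s - f t) / (s - t)) \<longlongrightarrow> D) (at_side \<sigma> t)"
    "\<And>s. s \<in> {0..1} \<Longrightarrow> f s \<le> f t + D * (s - t)"
    using concave_one_sided_derivative[OF concave t] by blast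
  have "side_deriv f \<sigma> t = D"
    unfolding side_deriv_def by (intro tendsto_Lim D) simp
  with D show "((\<lambda>s. (f s - f t) / (s - t)) \<longlongrightarrow> side_deriv f \<sigma> t) (at_side \<sigma> t)"
    "0 \<le> s \<Longrightarrow> s \<le> 1 \<Longrightarrow> f s \<le> f t + side_deriv f \<sigma> t * (s - t)"
    by auto
qed

lemma side_deriv_antimono:
  assumes "0 < s" "s < t" "t < 1"
  shows "side_deriv f \<tau> t \<le> side_deriv f \<sigma> s"
proof -
  have "f t \<le> f s + side_deriv f \<sigma> s * (t - s)" "f s \<le> f t + side_deriv f \<tau> t * (s - t)"
    using supergradient assms by auto
  then have "side_deriv f \<tau> t * (t - s) \<le> side_deriv f \<sigma> s * (t - s)"
    by (simp add: algebra_simps)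
  then show ?thesis using assms by simp
qed

lemma affine_on_side:
  assumes x: "0 < x" "x < 1" and ev: "\<forall>\<^sub>F u in at_side \<sigma> x. f u = c + \<delta> * u"
  shows "f x = c + \<delta> * x" "side_deriv f \<sigma> x = \<delta>"
proof -
  have id: "((\<lambda>s. s) \<longlongrightarrow> x) (at_side \<sigma> x)"
    by (cases \<sigma>) (auto intro: tendsto_ident_at)
  have "((\<lambda>u. c + \<delta> * u) \<longlongrightarrow> c + \<delta> * x) (at_side \<sigma> x)"
    by (rule tendsto_add[OF tendsto_const tendsto_mult[OF tendsto_const id]])
  then have "(f \<longlongrightarrow> c + \<delta> * x) (at_side \<sigma> x)"
    using ev by (subst tendsto_cong)
  with at_side_tendsto_if_quotient_tendsto[OF side_deriv_tendsto[OF x]]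
  show *: "f x = c + \<delta> * x"
    using tendsto_unique[OF at_side_neq_bot] by blast
  have "\<forall>\<^sub>F u in at_side \<sigma> x. u \<noteq> x" by (cases \<sigma>) (simp_all add: eventually_at_filter)
  with ev have "\<forall>\<^sub>F u in at_side \<sigma> x. (f u - f x) / (u - x) = \<delta>"
    by eventually_elim (simp add: * field_simps)
  then have "((\<lambda>u. (f u - f x) / (u - x)) \<longlongrightarrow> \<delta>) (at_side \<sigma> x)"
    by (subst tendsto_cong) auto
  with side_deriv_tendsto[OF x] show "side_deriv f \<sigma> x = \<delta>"
    using tendsto_unique[OF at_side_neq_bot] by blast
qed

text \<open>Slopes are known at rationals only. Two rationals bound each other by their tangents,
  which gives equality. For a real \<open>z\<close> the tangent at a rational bounds
  \<open>f z\<close> from above; the supergradient at \<open>z\<close>, tested at rationals on both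
  sides of \<open>z\<close>, bounds it from below.\<close>

lemma affine_if_slopes_constant:
  assumes pq: "0 \<le> p" "q \<le> 1"
    and const: "\<And>r. r \<in> \<rat> \<Longrightarrow> p < r \<Longrightarrow> r < q \<Longrightarrow> side_deriv f Plus r = \<delta>"
    and xy: "p < x" "x < q" "p < y" "y < q"
  shows "f x = f y + \<delta> * (x - y)"
proof -
  have rat: "f r = f r' + \<delta> * (r - r')" if "r \<in> \<rat>" "r' \<in> \<rat>" "p < r" "r < q" "p < r'" "r' < q" for r r'
    using supergradient[of r r' Plus] supergradient[of r' r Plus] const[of r] const[of r'] that pq
    by (auto simp: algebra_simps)
  have line: "f z = f r + \<delta> * (z - r)" if z: "p < z" "z < q" and r: "r \<in> \<rat>" "p < r" "r < q" for z r
  proof (rule antisym)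
    show "f z \<le> f r + \<delta> * (z - r)"
      using supergradient[of r z Plus] const[of r] that pq by auto
    obtain r1 r2 where r12: "r1 \<in> \<rat>" "p < r1" "r1 < z" "r2 \<in> \<rat>" "z < r2" "r2 < q"
      using Rats_dense_in_real[of p z] Rats_dense_in_real[of z q] z by auto
    define D where "D = side_deriv f Plus z"
    have "f r1 \<le> f z + D * (r1 - z)" "f r2 \<le> f z + D * (r2 - z)"
      using supergradient[of z r1 Plus] supergradient[of z r2 Plus] z r12 pq by (auto simp: D_def)
    then have "f r + \<delta> * (r1 - r) \<le> f z + D * (r1 - z)" "f r + \<delta> * (r2 - r) \<le> f z + D * (r2 - z)"
      using rat[of r1 r] rat[of r2 r] r r12 z by auto
    then have "(f r + \<delta> * (z - r) - f z) \<le> (D - \<delta>) * (r1 - z)" "(f r + \<delta> * (z - r) - f z) \<le> (D - \<delta>) * (r2 - z)"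
      by (auto simp: algebra_simps)
    moreover have "(D - \<delta>) * (r1 - z) \<le> 0 \<or> (D - \<delta>) * (r2 - z) \<le> 0"
      using r12 by (cases "D \<le> \<delta>") (auto simp: mult_le_0_iff)
    ultimately show "f r + \<delta> * (z - r) \<le> f z" by auto
  qed
  obtain r where "r \<in> \<rat>" "p < r" "r < q"
    using Rats_dense_in_real[of p q] xy by auto
  then show ?thesis
    using line[of x r] line[of y r] xy by (simp add: algebra_simps)
qed

text \<open>Since slopes decrease, the tangent at the point \<open>\<beta>'\<close> nearer to
  \<open>s\<close> lies below the tangent at \<open>\<beta>\<close> when evaluated at
  \<open>s\<close>. The hypothesis \<open>le\<close> reverses this, so only equality of slopes is
  left.\<close>

lemma slopes_eq_if_tangents_ordered:
  assumes b: "0 < \<beta>" "\<beta> < 1" "0 < \<beta>'" "\<beta>' < 1"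
    and betw: "\<beta> < \<beta>' \<and> \<beta>' < s \<or> s < \<beta>' \<and> \<beta>' < \<beta>"
    and le: "f \<beta> + side_deriv f Plus \<beta> * (s - \<beta>) \<le> f \<beta>' + side_deriv f Plus \<beta>' * (s - \<beta>')"
  shows "side_deriv f Plus \<beta> = side_deriv f Plus \<beta>'"
proof -
  define D D' where "D = side_deriv f Plus \<beta>" and "D' = side_deriv f Plus \<beta>'"
  have "f \<beta>' \<le> f \<beta> + D * (\<beta>' - \<beta>)" unfolding D_def using supergradient[of \<beta> \<beta>' Plus] b by simp
  with le have "D * (s - \<beta>') \<le> D' * (s - \<beta>')"
    by (simp add: algebra_simps flip: D_def D'_def)
  then show ?thesis
    using betw side_deriv_antimono[of \<beta> \<beta>' Plus Plus] side_deriv_antimono[of \<beta>' \<beta> Plus Plus] b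
    by (auto simp: mult_le_cancel_right D_def D'_def)
qed

definition contact :: "sign \<Rightarrow> real \<Rightarrow> real set" where
  "contact \<sigma> t = {s\<in>{0<..<1}. f s = f t + side_deriv f \<sigma> t * (s - t)}"

text \<open>Only the \<open>\<sigma>\<close> side of \<open>x\<close> has to lie in
  \<open>{p<..<q}\<close>: \<open>x\<close> may be an end of the interval, where affinity arrives by
  a one-sided limit.\<close>

lemma contact_if_slopes_constant:
  assumes pq: "0 \<le> p" "q \<le> 1"
    and const: "\<And>r. r \<in> \<rat> \<Longrightarrow> p < r \<Longrightarrow> r < q \<Longrightarrow> side_deriv f Plus r = \<delta>"
    and x: "0 < x" "x < 1" "\<forall>\<^sub>F u in at_side \<sigma> x. u \<in> {p<..<q}"
    and u: "p < u" "u < q"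
  shows "u \<in> contact \<sigma> x"
proof -
  have line: "f v = (f u - \<delta> * u) + \<delta> * v" if "v \<in> {p<..<q}" for v
    using affine_if_slopes_constant[OF pq const, of v u] u that by (simp add: algebra_simps)
  have "\<forall>\<^sub>F v in at_side \<sigma> x. f v = (f u - \<delta> * u) + \<delta> * v"
    by (rule eventually_mono[OF x(3) line])
  from affine_on_side[OF x(1,2) this] show ?thesis
    using u pq by (simp add: contact_def algebra_simps)
qed

text \<open>If \<open>s\<close> lay beyond \<open>h\<close>, the ordered tangents would make all
  rational slopes between \<open>\<eta>\<close> and \<open>s\<close> equal, so \<open>f\<close>
  would be affine there and the contact set of \<open>\<eta>\<close> would extend past
  \<open>h\<close>.\<close>

lemma right_of_contact_bounded:
  assumes \<eta>: "0 < \<eta>" "\<eta> < 1" and s: "s \<le> 1"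
    and h: "\<eta> \<le> h" "contact Plus \<eta> \<subseteq> {..h}"
    and le: "\<And>\<beta> \<beta>'. \<beta> \<in> \<rat> \<Longrightarrow> \<beta>' \<in> \<rat> \<Longrightarrow> \<eta> < \<beta> \<Longrightarrow> \<beta> < \<beta>' \<Longrightarrow> \<beta>' < 1 \<Longrightarrow>
      f \<beta> + side_deriv f Plus \<beta> * (s - \<beta>) \<le> f \<beta>' + side_deriv f Plus \<beta>' * (s - \<beta>')"
  shows "s \<le> h"
proof (rule ccontr)
  assume "\<not> s \<le> h"
  obtain r where r: "r \<in> \<rat>" "\<eta> < r" "r < s"
    using Rats_dense_in_real[of \<eta> s] h \<open>\<not> s \<le> h\<close> by auto
  define \<delta> where "\<delta> = side_deriv f Plus r"
  have eq: "side_deriv f Plus \<beta> = \<delta>" if "\<beta> \<in> \<rat>" "\<eta> < \<beta>" "\<beta> < s" for \<beta>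
    using slopes_eq_if_tangents_ordered[of \<beta> r s] slopes_eq_if_tangents_ordered[of r \<beta> s] le[of \<beta> r] le[of r \<beta>] r that \<eta> s
    by (cases \<beta> r rule: linorder_cases) (auto simp: \<delta>_def)
  obtain u where u: "h < u" "u < s" using dense[of h s] \<open>\<not> s \<le> h\<close> by auto
  have "\<forall>\<^sub>F v in at_side Plus \<eta>. v \<in> {\<eta><..<s}"
    using r unfolding at_side.simps by (intro eventually_at_right_real) auto
  from contact_if_slopes_constant[OF _ s eq \<eta> this, of u] have "u \<in> contact Plus \<eta>"
    using h(1) u \<eta> by auto
  with h u show False by auto
qed

lemma left_of_contact_bounded:
  assumes \<zeta>: "0 < \<zeta>" "\<zeta> < 1" and s: "0 \<le> s"
    and l: "l \<le> \<zeta>" "contact Minus \<zeta> \<subseteq> {l..}"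
    and le: "\<And>\<beta> \<beta>'. \<beta> \<in> \<rat> \<Longrightarrow> \<beta>' \<in> \<rat> \<Longrightarrow> 0 < \<beta>' \<Longrightarrow> \<beta>' < \<beta> \<Longrightarrow> \<beta> < \<zeta> \<Longrightarrow>
      f \<beta> + side_deriv f Plus \<beta> * (s - \<beta>) \<le> f \<beta>' + side_deriv f Plus \<beta>' * (s - \<beta>')"
  shows "l \<le> s"
proof (rule ccontr)
  assume "\<not> l \<le> s"
  obtain r where r: "r \<in> \<rat>" "s < r" "r < \<zeta>"
    using Rats_dense_in_real[of s \<zeta>] l \<open>\<not> l \<le> s\<close> by auto
  define \<delta> where "\<delta> = side_deriv f Plus r"
  have eq: "side_deriv f Plus \<beta> = \<delta>" if "\<beta> \<in> \<rat>" "s < \<beta>" "\<beta> < \<zeta>" for \<beta>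
    using slopes_eq_if_tangents_ordered[of \<beta> r s] slopes_eq_if_tangents_ordered[of r \<beta> s] le[of \<beta> r] le[of r \<beta>] r that \<zeta> s
    by (cases \<beta> r rule: linorder_cases) (auto simp: \<delta>_def)
  obtain u where u: "s < u" "u < l" using dense[of s l] \<open>\<not> l \<le> s\<close> by auto
  have "\<forall>\<^sub>F v in at_side Minus \<zeta>. v \<in> {s<..<\<zeta>}"
    using r unfolding at_side.simps by (intro eventually_at_left_real) auto
  from contact_if_slopes_constant[OF s _ eq \<zeta> this, of u] have "u \<in> contact Minus \<zeta>"
    using l(1) u \<zeta> by auto
  with l u show False by auto
qed

end

section \<open>The shape function along the segment of directions\<close>

locale concave_shape =
  fixes g :: "point \<Rightarrow> real"
  assumes g_concave: "concave_on {v. 0 \<le> fst v \<and> 0 \<le> snd v} g"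
    and g_hom: "\<And>c v. 0 \<le> c \<Longrightarrow> 0 \<le> fst v \<Longrightarrow> 0 \<le> snd v \<Longrightarrow> g (c *\<^sub>R v) = c * g v"
begin

abbreviation f where "f \<equiv> \<lambda>t. g (dir t)"

sublocale concave_profile f
proof
  have "u * g (dir x) + v * g (dir y) \<le> g (dir (u * x + v * y))"
    if "x \<in> {0..1}" "y \<in> {0..1}" "0 \<le> u" "0 \<le> v" "u + v = 1" for x y u v
  proof -
    have v: "v = 1 - u" using that by simp
    have "u *\<^sub>R dir x + v *\<^sub>R dir y = dir (u * x + v * y)"
      by (simp add: dir_def v algebra_simps)
    then show ?thesis
      using g_concave[unfolded concave_on_iff, THEN conjunct2, THEN bspec, THEN bspec, rule_format,
          of "dir x" "dir y" u v] that by simp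
  qed
  then show "concave_on {0..1} f" by (simp add: concave_on_iff)
qed

lemma grad_dir_eq:
  assumes "0 < t" "t < 1"
  shows "grad g (dir t) \<sigma> = (f t + (1 - t) * side_deriv f \<sigma> t, f t - t * side_deriv f \<sigma> t)"
  using assms by (intro grad_dir side_deriv_tendsto g_hom)

text \<open>Converts the asymptotic slope of Busemann functions, which is given by
  \<open>grad\<close>, into the height of a tangent of the profile.\<close>

lemma dir_inner_grad:
  assumes "0 < t" "t < 1"
  shows "dir s \<bullet> grad g (dir t) \<sigma> = f t + side_deriv f \<sigma> t * (s - t)"
  using assms by (simp add: grad_dir_eq) (simp add: dir_def algebra_simps)

lemma lin_seg_sign_dir:
  assumes "0 < t" "t < 1"
  shows "lin_seg_sign g (dir t) \<sigma> = dir ` contact \<sigma> t"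
proof -
  have "grad g (dir t) \<sigma> \<bullet> (dir s - dir t) = side_deriv f \<sigma> t * (s - t)" for s
    using dir_inner_grad[OF assms, of s] dir_inner_grad[OF assms, of t]
    by (simp add: inner_diff_right inner_commute)
  then show ?thesis
    by (auto simp: lin_seg_sign_def contact_def riU_eq)
qed

text \<open>Both contact sets are compact intervals containing \<open>t\<close>, so their union is
  one interval, and its ends are unique because \<open>dir\<close> is injective. This settles the
  definite descriptions of the two ends.\<close>

lemma lin_seg_ends:
  assumes t: "0 < t" "t < 1"
    and grad0: "\<And>r. 0 < r \<Longrightarrow> r < 1 \<Longrightarrow> \<exists>s\<in>{0<..<r}. \<exists>s'\<in>{0<..<r}. grad g (dir s) Plus \<noteq> grad g (dir s') Plus"
    and grad1: "\<And>r. 0 < r \<Longrightarrow> r < 1 \<Longrightarrow> \<exists>s\<in>{r<..<1}. \<exists>s'\<in>{r<..<1}. grad g (dir s) Plus \<noteq> grad g (dir s') Plus"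
  obtains a b where "0 < a" "a \<le> t" "t \<le> b" "b < 1"
    and "lower_end g (dir t) = dir a" "upper_end g (dir t) = dir b"
    and "\<And>\<sigma>. contact \<sigma> t \<subseteq> {a..b}"
proof -
  \<comment> \<open>An affine piece of the profile has constant gradient; this lets
    \<open>grad0\<close> and \<open>grad1\<close> exclude linearity near the corners.\<close>
  have const: "grad g (dir s) Plus = (c + \<delta>, c)"
    if "0 \<le> p" "q \<le> 1" "\<And>s. p < s \<Longrightarrow> s < q \<Longrightarrow> f s = c + \<delta> * s" "p < s" "s < q" for p q c \<delta> s
  proof -
    have "\<forall>\<^sub>F u in at_side Plus s. f u = c + \<delta> * u"
      unfolding at_side.simps eventually_at_right_field using that by (intro exI[of _ q]) auto
    from affine_on_side[OF _ _ this] grad_dir_eq[of s Plus] that show ?thesis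
      by (auto simp: algebra_simps)
  qed
  have "\<exists>a b. 0 < a \<and> a \<le> t \<and> t \<le> b \<and> b < 1 \<and> contact \<sigma> t = {a..b}" for \<sigma>
  proof -
    let ?D = "side_deriv f \<sigma> t"
    have eq: "f t + ?D * (s - t) = (f t - ?D * t) + ?D * s" for s by (simp add: algebra_simps)
    obtain a b where "0 < a" "a \<le> t" "t \<le> b" "b < 1"
      "{s\<in>{0<..<1}. f s = f t + ?D * (s - t)} = {a..b}"
    proof (rule affine_contact_interval[OF concave t])
      show "f s \<le> f t + ?D * (s - t)" if "s \<in> {0..1}" for s using supergradient t that by auto
      show "\<exists>s\<in>{0<..<r}. f s \<noteq> f t + ?D * (s - t)" if "0 < r" for r
      proof (rule ccontr)
        assume "\<not> ?thesis"
        \<comment> \<open>The bound \<open>1/2\<close> keeps the interval inside the unit interval,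
          since \<open>r\<close> is only known to be positive.\<close>
        then have "f s = (f t - ?D * t) + ?D * s" if "0 < s" "s < min r (1/2)" for s
          using that eq by auto
        then have "grad g (dir s) Plus = ((f t - ?D * t) + ?D, f t - ?D * t)" if "s \<in> {0<..<min r (1/2)}" for s
          using const[of 0 "min r (1/2)" "f t - ?D * t" ?D s] that by auto
        moreover have r': "0 < min r (1/2)" "min r (1/2) < 1"
          using \<open>0 < r\<close> by (auto simp: min_less_iff_disj)
        ultimately show False using grad0[OF r'] by metis
      qed
      show "\<exists>s\<in>{r<..<1}. f s \<noteq> f t + ?D * (s - t)" if "r < 1" for r
      proof (rule ccontr)
        assume "\<not> ?thesis"
        then have "f s = (f t - ?D * t) + ?D * s" if "max r (1/2) < s" "s < 1" for s
          using that eq by auto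
        then have "grad g (dir s) Plus = ((f t - ?D * t) + ?D, f t - ?D * t)" if "s \<in> {max r (1/2)<..<1}" for s
          using const[of "max r (1/2)" 1 "f t - ?D * t" ?D s] that by auto
        moreover have r': "0 < max r (1/2)" "max r (1/2) < 1"
          using \<open>r < 1\<close> by (auto simp: min_less_iff_disj)
        ultimately show False using grad1[OF r'] by metis
      qed
    qed
    then show ?thesis unfolding contact_def by blast
  qed
  then obtain a b where ab: "\<And>\<sigma>. 0 < a \<sigma> \<and> a \<sigma> \<le> t \<and> t \<le> b \<sigma> \<and> b \<sigma> < 1 \<and> contact \<sigma> t = {a \<sigma>..b \<sigma>}"
    by metis
  define A B where "A = min (a Minus) (a Plus)" and "B = max (b Minus) (b Plus)"
  have AB: "0 < A" "A \<le> t" "t \<le> B" "B < 1" using ab[of Plus] ab[of Minus] by (auto simp: A_def B_def)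
  have "contact Minus t \<union> contact Plus t = {A..B}"
    using ab[of Plus] ab[of Minus] by (auto simp: A_def B_def)
  then have seg: "lin_seg g (dir t) = dIcc (dir A) (dir B)"
    using AB by (simp add: lin_seg_def lin_seg_sign_dir[OF t] dIcc_dir flip: image_Un)
  have uniq: "x = A \<and> y = B" if "lin_seg g (dir t) = dIcc (dir x) (dir y)" "x \<le> y" "0 < x" "y < 1" for x y
  proof -
    have "{A..B} = {x..y}"
      using that AB unfolding seg by (simp add: dIcc_dir inj_image_eq_iff[OF inj_dir])
    then show ?thesis using AB that by (simp add: Icc_eq_Icc)
  qed
  have lower: "a \<in> riU \<and> (\<exists>b\<in>riU. a \<preceq> b \<and> lin_seg g (dir t) = dIcc a b) \<longleftrightarrow> a = dir A" for a
  proof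
    assume "a \<in> riU \<and> (\<exists>b\<in>riU. a \<preceq> b \<and> lin_seg g (dir t) = dIcc a b)"
    then obtain x y where "a = dir x" "x \<le> y" "0 < x" "y < 1" "lin_seg g (dir t) = dIcc (dir x) (dir y)"
      by (auto simp: riU_eq)
    then show "a = dir A" using uniq by blast
  qed (use AB seg in \<open>auto intro!: bexI[of _ "dir B"]\<close>)
  have upper: "b \<in> riU \<and> (\<exists>a\<in>riU. a \<preceq> b \<and> lin_seg g (dir t) = dIcc a b) \<longleftrightarrow> b = dir B" for b
  proof
    assume "b \<in> riU \<and> (\<exists>a\<in>riU. a \<preceq> b \<and> lin_seg g (dir t) = dIcc a b)"
    then obtain x y where "b = dir y" "x \<le> y" "0 < x" "y < 1" "lin_seg g (dir t) = dIcc (dir x) (dir y)"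
      by (auto simp: riU_eq)
    then show "b = dir B" using uniq by blast
  qed (use AB seg in \<open>auto intro!: bexI[of _ "dir A"]\<close>)
  have "lower_end g (dir t) = dir A" "upper_end g (dir t) = dir B"
    unfolding lower_end_def upper_end_def lower upper by simp_all
  moreover have "contact \<sigma> t \<subseteq> {A..B}" for \<sigma>
    using ab[of \<sigma>] by (cases \<sigma>) (auto simp: A_def B_def)
  ultimately show ?thesis using that AB by blast
qed

end

section \<open>Coalescence in a fixed direction\<close>

text \<open>\<open>D\<close> will be the child map of a dual graph, so that \<open>x + e1\<close>
  and \<open>x + e2\<close> are the only candidates for parents. Counting generations up to
  \<open>n\<close> makes immortality a countable intersection of measurable events.\<close>

primrec ancestry :: "(site \<Rightarrow> site) \<Rightarrow> nat \<Rightarrow> site \<Rightarrow> bool" where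
  "ancestry D 0 x \<longleftrightarrow> True"
| "ancestry D (Suc n) x \<longleftrightarrow>
     D (x + e1) = x \<and> ancestry D n (x + e1) \<or> D (x + e2) = x \<and> ancestry D n (x + e2)"

definition immortal :: "(site \<Rightarrow> site) \<Rightarrow> site \<Rightarrow> bool" where
  "immortal D x \<longleftrightarrow> (\<forall>n. ancestry D n x)"

lemma ancestry_SucD: "ancestry D (Suc n) x \<Longrightarrow> ancestry D n x"
proof (induction n arbitrary: x)
  case (Suc n)
  from Suc.prems show ?case
    using Suc.IH[of "x + e1"] Suc.IH[of "x + e2"] by (auto simp del: ancestry.simps(2) simp: ancestry.simps(2)[of D "Suc n" x] ancestry.simps(2)[of D n x])
qed simp

lemma ancestry_antimono: "m \<le> n \<Longrightarrow> ancestry D n x \<Longrightarrow> ancestry D m x"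
  by (induction n rule: dec_induct) (auto simp del: ancestry.simps dest: ancestry_SucD)

text \<open>Koenig's lemma for at most two parents: if each of them fails at some depth,
  \<open>x\<close> fails one generation after the larger of these depths.\<close>

lemma immortal_iff:
  "immortal D x \<longleftrightarrow> D (x + e1) = x \<and> immortal D (x + e1) \<or> D (x + e2) = x \<and> immortal D (x + e2)"
proof
  assume L: "immortal D x"
  show "D (x + e1) = x \<and> immortal D (x + e1) \<or> D (x + e2) = x \<and> immortal D (x + e2)"
  proof (rule ccontr)
    assume "\<not> ?thesis"
    then obtain m n where mn: "D (x + e1) = x \<Longrightarrow> \<not> ancestry D m (x + e1)"
      "D (x + e2) = x \<Longrightarrow> \<not> ancestry D n (x + e2)"
      unfolding immortal_def by blast
    have "ancestry D (Suc (max m n)) x" using L by (simp add: immortal_def del: ancestry.simps)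
    then show False
      using mn ancestry_antimono[of m "max m n" D "x + e1"] ancestry_antimono[of n "max m n" D "x + e2"]
      by auto
  qed
next
  assume R: "D (x + e1) = x \<and> immortal D (x + e1) \<or> D (x + e2) = x \<and> immortal D (x + e2)"
  have "ancestry D n x" for n
    using R by (cases n) (auto simp: immortal_def)
  then show "immortal D x" by (simp add: immortal_def)
qed

lemma immortal_step:
  assumes "D x = x - e1 \<or> D x = x - e2" "immortal D x"
  shows "immortal D (D x)"
  using assms by (subst immortal_iff) auto

lemma immortal_if_infinite_path:
  assumes "\<And>m. D (q (Suc m)) = q m" "\<And>m. q (Suc m) = q m + e1 \<or> q (Suc m) = q m + e2"
  shows "immortal D (q 0)"
proof -
  have "ancestry D n (q m)" for n m
  proof (induction n arbitrary: m)
    case (Suc n)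
    show ?case using assms(1)[of m] assms(2)[of m] Suc.IH[of "Suc m"] by auto
  qed simp
  then show ?thesis by (simp add: immortal_def)
qed

text \<open>Children of immortal points are immortal, so the first meeting point of two orbits would
  have two immortal parents.\<close>

lemma immortal_never_merge:
  assumes step: "\<And>x. D x = x - e1 \<or> D x = x - e2"
    and single: "\<And>y. \<not> (D (y + e1) = y \<and> immortal D (y + e1) \<and> D (y + e2) = y \<and> immortal D (y + e2))"
    and ab: "immortal D a" "immortal D b" "a \<noteq> b"
  shows "(D ^^ n) a \<noteq> (D ^^ n) b"
proof -
  have "immortal D ((D ^^ n) a) \<and> immortal D ((D ^^ n) b) \<and> (D ^^ n) a \<noteq> (D ^^ n) b"
  proof (induction n)
    case (Suc n)
    define z z' where "z = (D ^^ n) a" and "z' = (D ^^ n) b"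
    have zz: "immortal D z" "immortal D z'" "z \<noteq> z'" using Suc by (auto simp: z_def z'_def)
    have "D z \<noteq> D z'"
    proof
      assume eq: "D z = D z'"
      have "z = D z + e1 \<or> z = D z + e2" using step[of z] by auto
      moreover have "z' = D z' + e1 \<or> z' = D z' + e2" using step[of z'] by auto
      ultimately show False using zz eq single[of "D z"] by metis
    qed
    then show ?case
      using immortal_step[OF step zz(1)] immortal_step[OF step zz(2)] by (simp add: z_def z'_def)
  qed (use ab in auto)
  then show ?thesis by blast
qed

lemma ancestry_shift: "ancestry D n (x + z) \<longleftrightarrow> ancestry (\<lambda>y. D (y + z) - z) n x"
proof (induction n arbitrary: x)
  case (Suc n)
  show ?case using Suc[of "x + e1"] Suc[of "x + e2"]
    by (simp add: algebra_simps)
qed simp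

lemma immortal_shift: "immortal D (x + z) \<longleftrightarrow> immortal (\<lambda>y. D (y + z) - z) x"
  by (simp add: immortal_def ancestry_shift)

text \<open>The column \<open>i\<close> at time \<open>n\<close> stands for the site \<open>(i, 1 - n - i)\<close>, and \<open>h n i\<close> for the
  Busemann function from that site to a fixed far corner; \<open>a\<close> and \<open>b\<close> are the two dual paths, read downwards. The sites between the
  paths are confined to a region with low weights, which is bounded by two rays with high weights
  that first open up during \<open>N\<close> time steps and then close.\<close>
lemma squeezed_paths_meet:
  fixes h w :: "nat \<Rightarrow> int \<Rightarrow> real" and a b :: "nat \<Rightarrow> int"
  assumes rec: "\<And>n i. h (Suc n) i = w (Suc n) i + max (h n i) (h n (i + 1))"
    and a: "\<And>n. a (Suc n) = (if h n (a n) \<le> h n (a n + 1) then a n - 1 else a n)"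
    and b: "\<And>n. b (Suc n) = (if h n (b n) \<le> h n (b n + 1) then b n - 1 else b n)"
    and start: "a 0 = 0" "b 0 = int d"
    and init: "\<And>i. 0 \<le> i \<Longrightarrow> i \<le> int d + 1 \<Longrightarrow> \<bar>h 0 i\<bar> \<le> c"
    and N: "real N * (u - l) > 2 * c"  "l < u"
    and low: "\<And>n i. 1 \<le> n \<Longrightarrow> n \<le> 2 * N + d \<Longrightarrow> - int (min n N) < i \<Longrightarrow> i \<le> int d - int (n - N) \<Longrightarrow> w n i \<le> l"
    and high: "\<And>n i. 1 \<le> n \<Longrightarrow> n \<le> 2 * N + d \<Longrightarrow> i = - int (min n N) \<or> i = int d + 1 - int (n - N) \<Longrightarrow> u \<le> w n i"
  shows "\<exists>n. b n \<le> a n"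
proof (rule ccontr)
  assume "\<not> ?thesis"
  then have ab: "a n < b n" for n by (simp add: not_le)
  \<comment> \<open>The paths stay between the rays \<open>L\<close> and \<open>R\<close>. Until
    time \<open>N\<close> the left ray retreats as fast as \<open>a\<close> can move, and the right
    ray stands still. Afterwards the left ray stands still and the right one advances; now
    \<open>h\<close> is larger on the rays than between the paths, which stops \<open>a\<close> at
    the left ray and drives \<open>b\<close> ahead of the right one. At time
    \<open>2 * N + d\<close> this leaves \<open>- N \<le> a\<close> and
    \<open>b \<le> - N\<close>.\<close>
  have inv: "- int (min n N) \<le> a n \<and> b n \<le> int d - int (n - N) \<and>
      (\<forall>i. a n < i \<and> i \<le> b n \<longrightarrow> h n i \<le> c + n * l) \<and>
      h n (- int (min n N)) \<ge> n * u - c \<and> h n (int d + 1 - int (n - N)) \<ge> n * u - c"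
    if "n \<le> 2 * N + d" for n
    using that
  proof (induction n)
    case 0
    have "h 0 i \<le> c" if "0 < i" "i \<le> int d" for i using init[of i] that by auto
    moreover have "- c \<le> h 0 0" "- c \<le> h 0 (int d + 1)" using init[of 0] init[of "int d + 1"] by auto
    ultimately show ?case by (auto simp: start)
  next
    case (Suc n)
    define L R where "L = - int (min n N)" and "R = int d + 1 - int (n - N)"
    define L' R' where "L' = - int (min (Suc n) N)" and "R' = int d + 1 - int (Suc n - N)"
    have IH: "L \<le> a n" "b n < R" "\<And>i. a n < i \<Longrightarrow> i \<le> b n \<Longrightarrow> h n i \<le> c + n * l"
      "h n L \<ge> n * u - c" "h n R \<ge> n * u - c"
      using Suc by (auto simp: L_def R_def)
    \<comment> \<open>The rays start from at least \<open>- c\<close> and gain at least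
      \<open>u\<close> per step, the middle starts from at most \<open>c\<close> and gains at most
      \<open>l\<close>; \<open>N\<close> steps suffice to overtake.\<close>
    have gap: "c + n * l < n * u - c" if "N \<le> n"
    proof -
      have "real N * (u - l) \<le> real n * (u - l)" using that N(2) by (intro mult_right_mono) auto
      then show ?thesis using N(1) by (simp add: algebra_simps)
    qed
    have aL: "L' \<le> a (Suc n)"
    proof (cases "n < N")
      case False
      have "h n (a n + 1) < h n (a n)" if "a n = L"
        using IH(3)[of "a n + 1"] IH(4) ab[of n] gap False that by auto
      then show ?thesis using IH(1) False a[of n] by (cases "a n = L") (auto simp: L_def L'_def)
    qed (use IH(1) a[of n] in \<open>auto simp: L_def L'_def\<close>)
    have bR: "b (Suc n) < R'"
    proof (cases "n < N")
      case False
      have "h n (b n) \<le> h n (b n + 1)" if "b n + 1 = R"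
        using IH(3)[of "b n"] IH(5) ab[of n] gap False that by auto
      then show ?thesis using IH(2) False b[of n] by (cases "b n + 1 = R") (auto simp: R_def R'_def)
    qed (use IH(2) b[of n] in \<open>auto simp: R_def R'_def\<close>)
    \<comment> \<open>A predecessor outside \<open>]a n, b n]\<close> occurs only at an end where
      the path has just found it not larger than its neighbour inside, so the neighbour dominates
      it.\<close>
    have int: "h (Suc n) i \<le> c + Suc n * l" if i: "a (Suc n) < i" "i \<le> b (Suc n)" for i
    proof -
      have "w (Suc n) i \<le> l"
        using low[of "Suc n" i] Suc.prems i aL bR by (auto simp: L'_def R'_def)
      moreover have "h n i \<le> c + n * l \<or> h n i \<le> h n (i + 1) \<and> i = a n"
        using IH(3)[of i] i a[of n] b[of n] by (cases "i = a n") (auto split: if_splits)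
      moreover have "h n (i + 1) \<le> c + n * l \<or> h n (i + 1) \<le> h n i \<and> i = b n"
        using IH(3)[of "i + 1"] i a[of n] b[of n] by (cases "i = b n") (auto split: if_splits)
      ultimately have "w (Suc n) i + max (h n i) (h n (i + 1)) \<le> l + (c + n * l)"
        using ab[of n] by auto
      then show ?thesis by (simp add: rec algebra_simps)
    qed
    have "L' = L \<or> L' + 1 = L" "R' = R \<or> R' + 1 = R" by (auto simp: L_def L'_def R_def R'_def)
    then have "h n L \<le> max (h n L') (h n (L' + 1))" "h n R \<le> max (h n R') (h n (R' + 1))" by auto
    moreover have "u \<le> w (Suc n) L'" "u \<le> w (Suc n) R'"
      using high[of "Suc n"] Suc.prems by (auto simp: L'_def R'_def)
    ultimately have "h (Suc n) L' \<ge> Suc n * u - c" "h (Suc n) R' \<ge> Suc n * u - c"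
      using IH(4,5) by (auto simp: rec algebra_simps)
    with aL bR int show ?case by (auto simp: L'_def R'_def)
  qed
  from inv[of "2 * N + d"] ab[of "2 * N + d"] show False by auto
qed

text \<open>The dual arc is the reflection in \<open>x\<close> of the primal arc, with the site
  \<open>x\<close> standing for \<open>dual x\<close>.\<close>

definition dual_succ :: "(point \<Rightarrow> sign \<Rightarrow> site \<Rightarrow> site \<Rightarrow> 'w \<Rightarrow> real) \<Rightarrow> 'w \<Rightarrow> point \<Rightarrow> sign \<Rightarrow> site \<Rightarrow> site" where
  "dual_succ B \<omega> \<xi> \<sigma> x = x + x - successor B \<omega> \<xi> \<sigma> x"

lemma dual_succ_Plus:
  "dual_succ B \<omega> \<xi> Plus x =
     (if B \<xi> Plus x (x + e1) \<omega> \<le> B \<xi> Plus x (x + e2) \<omega> then x - e1 else x - e2)"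
  by (auto simp: dual_succ_def successor_def)

lemma dual_succ_eq_iff:
  "dual_succ B \<omega> \<xi> Plus (x + e1) = x \<longleftrightarrow>
     B \<xi> Plus (x + e1) (x + e1 + e1) \<omega> \<le> B \<xi> Plus (x + e1) (x + e1 + e2) \<omega>"
  "dual_succ B \<omega> \<xi> Plus (x + e2) = x \<longleftrightarrow>
     B \<xi> Plus (x + e2) (x + e2 + e2) \<omega> < B \<xi> Plus (x + e2) (x + e2 + e1) \<omega>"
  by (auto simp: dual_succ_Plus e1_def e2_def prod_eq_iff)

lemma dual_succ_step: "dual_succ B \<omega> \<xi> Plus x = x - e1 \<or> dual_succ B \<omega> \<xi> Plus x = x - e2"
  by (simp add: dual_succ_Plus)

section \<open>Weights: stationarity and nondegeneracy\<close>

lemma (in lpp) space_M [simp]: "space M = UNIV"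
  using sets_eq_imp_space_eq[OF sets_borel] by simp

lemma (in lpp) AE_T: "AE \<omega> in M. P \<omega> \<Longrightarrow> AE \<omega> in M. P (T z \<omega>)"
  using AE_distrD[OF T_measurable, of P z] by (simp only: T_preserving)

lemma (in lpp) prob_T:
  assumes "A \<in> events"
  shows "prob {\<omega>. T z \<omega> \<in> A} = prob A"
proof -
  have "prob A = measure (distr M M (T z)) A" by (simp add: T_preserving)
  also have "\<dots> = prob (T z -` A \<inter> space M)" by (rule measure_distr[OF T_measurable assms])
  finally show ?thesis by (simp add: vimage_def)
qed

lemma (in lpp) prob_wt_in:
  assumes "A \<in> sets borel"
  shows "prob (wt x -` A) = prob (wt 0 -` A)"
proof -
  have "prob (wt y -` A) = measure (distr M borel (wt y)) A" for y
    using measure_distr[OF wt_measurable assms, of y] by simp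
  then show ?thesis by (simp add: wt_ident[of x])
qed

lemma (in lpp) integrable_wt: "integrable M (wt 0)"
proof -
  obtain p where p: "p > 2" "integrable M (\<lambda>\<omega>. \<bar>wt 0 \<omega>\<bar> powr p)" using wt_moment by blast
  show ?thesis
  proof (rule Bochner_Integration.integrable_bound)
    show "integrable M (\<lambda>\<omega>. 1 + \<bar>wt 0 \<omega>\<bar> powr p)" using p by simp
    have "\<bar>x\<bar> \<le> 1 + \<bar>x\<bar> powr p" for x :: real
    proof (cases "\<bar>x\<bar> \<le> 1")
      case False
      then have "\<bar>x\<bar> powr 1 \<le> \<bar>x\<bar> powr p" using p by (intro powr_mono) auto
      then show ?thesis using False by simp
    qed (auto intro: order_trans)
    then show "AE \<omega> in M. norm (wt 0 \<omega>) \<le> norm (1 + \<bar>wt 0 \<omega>\<bar> powr p)" by simp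
  qed (rule wt_measurable)
qed

text \<open>\<open>l\<close> is the mean. If the weight were almost surely above it, or almost
  surely not above it, a centred variable of constant sign would vanish, and so would the variance.
  The gap between \<open>l\<close> and \<open>u\<close> comes from countably many levels decreasing
  to the mean.\<close>

lemma (in lpp) nondegenerate_wt:
  obtains l u where "l < u" "prob (wt 0 -` {..l}) > 0" "prob (wt 0 -` {u..}) > 0"
proof -
  define m where "m = expectation (wt 0)"
  note [measurable] = wt_measurable
  have int: "integrable M (\<lambda>\<omega>. wt 0 \<omega> - m)" "integrable M (\<lambda>\<omega>. m - wt 0 \<omega>)"
    using integrable_wt by auto
  have E0: "expectation (\<lambda>\<omega>. wt 0 \<omega> - m) = 0" "expectation (\<lambda>\<omega>. m - wt 0 \<omega>) = 0"
    using integrable_wt prob_space by (simp_all add: m_def)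
  have nconst: "\<not> (AE \<omega> in M. wt 0 \<omega> = m)"
  proof
    assume "AE \<omega> in M. wt 0 \<omega> = m"
    then have "variance (wt 0) = expectation (\<lambda>\<omega>. 0)"
      unfolding m_def[symmetric] by (intro integral_cong_AE) auto
    then show False using wt_variance by simp
  qed
  have "\<not> (AE \<omega> in M. m < wt 0 \<omega>)"
  proof
    assume *: "AE \<omega> in M. m < wt 0 \<omega>"
    then have "AE \<omega> in M. 0 \<le> wt 0 \<omega> - m" by auto
    from integral_nonneg_eq_0_iff_AE[OF int(1) this] E0 have "AE \<omega> in M. wt 0 \<omega> - m = 0" by simp
    with nconst show False by auto
  qed
  then have "prob (wt 0 -` {..m}) \<noteq> 0"
    using AE_iff_measurable[of "wt 0 -` {..m}" M "\<lambda>\<omega>. m < wt 0 \<omega>"] measurable_sets[OF wt_measurable, of "{..m}" 0]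
    by (auto simp: emeasure_eq_measure vimage_def not_less)
  then have l: "prob (wt 0 -` {..m}) > 0" by (simp add: zero_less_measure_iff)
  have "\<exists>k. prob (wt 0 -` {m + 1 / real (Suc k)..}) > 0"
  proof (rule ccontr)
    assume "\<not> ?thesis"
    then have z: "prob (wt 0 -` {m + 1 / real (Suc k)..}) = 0" for k
      by (auto simp: not_less intro: antisym)
    have "AE \<omega> in M. wt 0 \<omega> < m + 1 / real (Suc k)" for k
      using AE_iff_measurable[of "wt 0 -` {m + 1 / real (Suc k)..}" M "\<lambda>\<omega>. wt 0 \<omega> < m + 1 / real (Suc k)"]
        measurable_sets[OF wt_measurable, of "{m + 1 / real (Suc k)..}" 0] z[of k]
      by (auto simp: emeasure_eq_measure vimage_def not_less)
    then have "AE \<omega> in M. \<forall>k. wt 0 \<omega> < m + 1 / real (Suc k)" by (simp add: AE_all_countable)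
    then have "AE \<omega> in M. 0 \<le> m - wt 0 \<omega>"
    proof eventually_elim
      case (elim \<omega>)
      show ?case
      proof (rule ccontr)
        assume "\<not> ?case"
        then obtain k where "inverse (real (Suc k)) < wt 0 \<omega> - m"
          using reals_Archimedean[of "wt 0 \<omega> - m"] by auto
        with elim[rule_format, of k] show False by (simp add: field_simps)
      qed
    qed
    from integral_nonneg_eq_0_iff_AE[OF int(2) this] E0 have "AE \<omega> in M. m - wt 0 \<omega> = 0" by simp
    then have "AE \<omega> in M. wt 0 \<omega> = m" by eventually_elim simp
    with nconst show False ..
  qed
  then obtain k where "prob (wt 0 -` {m + 1 / real (Suc k)..}) > 0" ..
  then show ?thesis using l by (intro that[of m "m + 1 / real (Suc k)"]) auto
qed

context busemann_process
begin

lemma AE_sample: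
  shows AE_shift:
    "AE \<omega> in M. \<forall>\<xi>\<in>riU. \<forall>\<sigma> x y z. B \<xi> \<sigma> (x + z) (y + z) \<omega> = B \<xi> \<sigma> x y (T z \<omega>)"
    and AE_cocycle:
    "AE \<omega> in M. \<forall>\<xi>\<in>riU. \<forall>\<sigma> x y z. B \<xi> \<sigma> x y \<omega> + B \<xi> \<sigma> y z \<omega> = B \<xi> \<sigma> x z \<omega>"
    and AE_recovery:
    "AE \<omega> in M. \<forall>\<xi>\<in>riU. \<forall>\<sigma> x. min (B \<xi> \<sigma> x (x + e1) \<omega>) (B \<xi> \<sigma> x (x + e2) \<omega>) = wt x \<omega>"
    and AE_monotone:
    "AE \<omega> in M. \<forall>\<xi>\<in>riU. \<forall>\<xi>'\<in>riU. dprec \<xi> \<xi>' \<longrightarrow> (\<forall>x.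
               B \<xi> Minus x (x + e1) \<omega> \<ge> B \<xi> Plus x (x + e1) \<omega> \<and>
               B \<xi> Plus x (x + e1) \<omega> \<ge> B \<xi>' Minus x (x + e1) \<omega> \<and>
               B \<xi>' Minus x (x + e1) \<omega> \<ge> B \<xi>' Plus x (x + e1) \<omega> \<and>
               B \<xi> Minus x (x + e2) \<omega> \<le> B \<xi> Plus x (x + e2) \<omega> \<and>
               B \<xi> Plus x (x + e2) \<omega> \<le> B \<xi>' Minus x (x + e2) \<omega> \<and>
               B \<xi>' Minus x (x + e2) \<omega> \<le> B \<xi>' Plus x (x + e2) \<omega>)"
    and AE_one_sided_limits:
    "AE \<omega> in M. \<forall>\<xi>\<in>riU. \<forall>\<sigma> x y.
     ((\<lambda>\<zeta>. B \<zeta> \<sigma> x y \<omega>) \<longlongrightarrow> B \<xi> Minus x y \<omega>) (at \<xi> within {\<zeta>\<in>riU. dprec \<zeta> \<xi>}) \<and>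
     ((\<lambda>\<zeta>. B \<zeta> \<sigma> x y \<omega>) \<longlongrightarrow> B \<xi> Plus x y \<omega>) (at \<xi> within {\<zeta>\<in>riU. dprec \<xi> \<zeta>})"
    and AE_blow_up:
    "AE \<omega> in M. \<forall>\<sigma> x.
     filterlim (\<lambda>\<xi>. B \<xi> \<sigma> x (x + e1) \<omega>) at_top (at e2 within riU) \<and>
     filterlim (\<lambda>\<xi>. B \<xi> \<sigma> x (x + e2) \<omega>) at_top (at e1 within riU)"
  by - (rule bexE[OF B_cocycle], elim conjE, drule AE_prob_1, erule eventually_mono,
    drule (1) bspec, elim conjE, assumption)+

end

lemma level_add_e [simp]: "level (x + e1) = level x + 1" "level (x + e2) = level x + 1"
  by (simp_all add: level_def e1_def e2_def)

lemma le_add_e [simp]: "(x :: site) \<le> x + e1" "(x :: site) \<le> x + e2"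
  by (simp_all add: less_eq_prod_def e1_def e2_def)

text \<open>Having ancestors is decided by increments at sites of strictly higher level.
  Measurability is therefore available for a sigma-algebra \<open>N\<close> generated by those sites
  alone, as independence from the weights below requires.\<close>

lemma pred_ancestry:
  assumes "\<And>y. level x < level y \<Longrightarrow> B \<xi> Plus y (y + e1) \<in> borel_measurable N"
    and "\<And>y. level x < level y \<Longrightarrow> B \<xi> Plus y (y + e2) \<in> borel_measurable N"
  shows "Measurable.pred N (\<lambda>\<omega>. ancestry (dual_succ B \<omega> \<xi> Plus) n x)"
  using assms
proof (induction n arbitrary: x)
  case (Suc n)
  have [measurable]: "Measurable.pred N (\<lambda>\<omega>. ancestry (dual_succ B \<omega> \<xi> Plus) n (x + e1))"
    "Measurable.pred N (\<lambda>\<omega>. ancestry (dual_succ B \<omega> \<xi> Plus) n (x + e2))"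
    using Suc.prems by (intro Suc.IH; simp)+
  have [measurable]: "B \<xi> Plus (x + e1) (x + e1 + e1) \<in> borel_measurable N"
    "B \<xi> Plus (x + e1) (x + e1 + e2) \<in> borel_measurable N"
    "B \<xi> Plus (x + e2) (x + e2 + e1) \<in> borel_measurable N"
    "B \<xi> Plus (x + e2) (x + e2 + e2) \<in> borel_measurable N"
    using Suc.prems by auto
  show ?case unfolding ancestry.simps dual_succ_eq_iff by measurable
qed simp

lemma pred_immortal:
  assumes "\<And>y. level x < level y \<Longrightarrow> B \<xi> Plus y (y + e1) \<in> borel_measurable N"
    and "\<And>y. level x < level y \<Longrightarrow> B \<xi> Plus y (y + e2) \<in> borel_measurable N"
  shows "Measurable.pred N (\<lambda>\<omega>. immortal (dual_succ B \<omega> \<xi> Plus) x)"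
proof -
  have [measurable]: "Measurable.pred N (\<lambda>\<omega>. ancestry (dual_succ B \<omega> \<xi> Plus) n x)" for n
    by (rule pred_ancestry) (use assms in auto)
  show ?thesis unfolding immortal_def by measurable
qed

section \<open>Immortal dual points in a fixed direction\<close>

context busemann_process
begin

context
  fixes \<xi> assumes \<xi>: "\<xi> \<in> riU"
begin

abbreviation D where "D \<omega> \<equiv> dual_succ B \<omega> \<xi> Plus"

lemma B_borel [measurable]: "B \<xi> \<sigma> x y \<in> borel_measurable M"
  using B_integrable[OF \<xi>] by (rule borel_measurable_integrable)

lemma immortal_events [measurable]: "Measurable.pred M (\<lambda>\<omega>. immortal (D \<omega>) x)"
  by (rule pred_immortal) simp_all

lemma dual_succ_events [measurable]: "Measurable.pred M (\<lambda>\<omega>. D \<omega> x = y)"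
proof -
  have "D \<omega> x = y \<longleftrightarrow> (if B \<xi> Plus x (x + e1) \<omega> \<le> B \<xi> Plus x (x + e2) \<omega> then x - e1 = y else x - e2 = y)" for \<omega>
    by (simp add: dual_succ_Plus)
  then show ?thesis by simp
qed

lemma AE_dual_shift: "AE \<omega> in M. \<forall>z. (\<lambda>y. D \<omega> (y + z) - z) = D (T z \<omega>)"
  using AE_shift
proof eventually_elim
  case (elim \<omega>)
  have "B \<xi> \<sigma> (y + z) (y + z + e) \<omega> = B \<xi> \<sigma> y (y + e) (T z \<omega>)" for \<sigma> y z e
    using elim \<xi> by (metis add.assoc add.commute)
  then show ?case by (auto simp: dual_succ_Plus)
qed

lemma prob_dual_shift:
  assumes "{\<omega>. Q (D \<omega>)} \<in> events" "{\<omega>. Q (\<lambda>y. D \<omega> (y + z) - z)} \<in> events"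
  shows "prob {\<omega>. Q (\<lambda>y. D \<omega> (y + z) - z)} = prob {\<omega>. Q (D \<omega>)}"
proof -
  have "prob {\<omega>. Q (\<lambda>y. D \<omega> (y + z) - z)} = prob {\<omega>. T z \<omega> \<in> {\<omega>. Q (D \<omega>)}}"
  proof (rule measure_eq_AE)
    show "AE \<omega> in M. \<omega> \<in> {\<omega>. Q (\<lambda>y. D \<omega> (y + z) - z)} \<longleftrightarrow> \<omega> \<in> {\<omega>. T z \<omega> \<in> {\<omega>. Q (D \<omega>)}}"
      using AE_dual_shift by eventually_elim (simp del: split_paired_All)
    show "{\<omega>. T z \<omega> \<in> {\<omega>. Q (D \<omega>)}} \<in> events"
      using measurable_sets[OF T_measurable assms(1), of z] by (simp add: vimage_def)
  qed (rule assms)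
  then show ?thesis using prob_T[OF assms(1)] by simp
qed

lemma immortal_at: "immortal (D \<omega>) x \<longleftrightarrow> immortal (\<lambda>y. D \<omega> (y + x) - x) 0"
  using immortal_shift[of "D \<omega>" 0 x] by simp

lemma prob_immortal: "prob {\<omega>. immortal (D \<omega>) x} = prob {\<omega>. immortal (D \<omega>) 0}"
proof -
  have "{\<omega>. immortal (D \<omega>) z} \<in> events" for z
    using immortal_events[of z] by (simp add: pred_def)
  then show ?thesis
    using prob_dual_shift[of "\<lambda>D. immortal D 0" x] by (simp flip: immortal_at)
qed

text \<open>Mass transport: an immortal dual point has on average one immortal child, so almost surely
  none has two immortal parents.\<close>
lemma AE_single_immortal_parent:
  "AE \<omega> in M. \<forall>y. \<not> (D \<omega> (y + e1) = y \<and> immortal (D \<omega>) (y + e1) \<and>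
     D \<omega> (y + e2) = y \<and> immortal (D \<omega>) (y + e2))"
  unfolding AE_all_countable
proof
  fix y
  let ?A = "\<lambda>e. {\<omega>. D \<omega> (y + e) = y \<and> immortal (D \<omega>) (y + e)}"
  let ?C = "\<lambda>e. {\<omega>. D \<omega> 0 = - e \<and> immortal (D \<omega>) 0}"
  have pred: "Measurable.pred M (\<lambda>\<omega>. D \<omega> (y + e) = y \<and> immortal (D \<omega>) (y + e))"
    "Measurable.pred M (\<lambda>\<omega>. D \<omega> 0 = - e \<and> immortal (D \<omega>) 0)" for e
    by measurable
  then have [measurable]: "?A e \<in> events" "?C e \<in> events" for e
    by (simp_all add: pred_def)
  have AC: "prob (?A e) = prob (?C e)" for e
  proof -
    have "?A e = {\<omega>. D \<omega> (0 + (y + e)) - (y + e) = - e \<and> immortal (\<lambda>z. D \<omega> (z + (y + e)) - (y + e)) 0}"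
      unfolding immortal_at by (auto simp: algebra_simps)
    then show ?thesis
      using prob_dual_shift[of "\<lambda>D. D 0 = - e \<and> immortal D 0" "y + e"] \<open>?A e \<in> events\<close> \<open>?C e \<in> events\<close>
      by simp
  qed
  \<comment> \<open>Seen from the child, \<open>y\<close> is immortal iff one of
    \<open>?A e1\<close> and \<open>?A e2\<close> occurs; seen from the parent, an immortal point
    steps along \<open>- e1\<close> or along \<open>- e2\<close>, never both. Stationarity equates
    the two counts, which leaves no mass for the overlap.\<close>
  have "prob (?A e1 \<union> ?A e2) = prob {\<omega>. immortal (D \<omega>) y}"
    by (rule arg_cong[of _ _ prob]) (auto simp: immortal_iff[of _ y])
  also have "\<dots> = prob {\<omega>. immortal (D \<omega>) 0}" by (rule prob_immortal)
  also have "{\<omega>. immortal (D \<omega>) 0} = ?C e1 \<union> ?C e2"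
    using dual_succ_step[of B _ \<xi> 0] by auto
  also have "prob \<dots> = prob (?C e1) + prob (?C e2)"
    by (rule finite_measure_Union[OF \<open>?C e1 \<in> events\<close> \<open>?C e2 \<in> events\<close>]) (auto simp: e1_def e2_def)
  finally have "prob (?A e1 \<union> ?A e2) = prob (?A e1) + prob (?A e2)" by (simp add: AC)
  moreover have "prob (?A e1 \<union> ?A e2) = prob (?A e1) + (prob (?A e2) - prob (?A e2 \<inter> ?A e1))"
    by (subst finite_measure_Union') (simp_all add: finite_measure_Diff')
  ultimately have "prob (?A e2 \<inter> ?A e1) = 0" by simp
  then have "AE \<omega> in M. \<omega> \<notin> ?A e2 \<inter> ?A e1"
    by (subst (asm) prob_eq_0) auto
  then show "AE \<omega> in M. \<not> (D \<omega> (y + e1) = y \<and> immortal (D \<omega>) (y + e1) \<and>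
     D \<omega> (y + e2) = y \<and> immortal (D \<omega>) (y + e2))"
    by eventually_elim auto
qed

text \<open>Infinitely many translates along the antidiagonal have equally probable immortality
  events, and these are almost surely disjoint, so their common probability is zero.\<close>

lemma not_immortal_if_no_pairs:
  assumes "\<And>d. d \<ge> 1 \<Longrightarrow> AE \<omega> in M. \<not> (immortal (D \<omega>) 0 \<and> immortal (D \<omega>) (int d, - int d))"
  shows "AE \<omega> in M. \<not> immortal (D \<omega>) 0"
proof -
  let ?E = "\<lambda>k::nat. {\<omega>. immortal (D \<omega>) (int k, - int k)}"
  have E: "?E k \<in> events" for k
    using immortal_events by (simp add: pred_def)
  have E2: "{\<omega>. immortal (D \<omega>) x \<and> immortal (D \<omega>) y} \<in> events" for x y
    using pred_intros_logic(3)[OF immortal_events immortal_events] by (simp add: pred_def)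
  have pE: "prob (?E k) = prob {\<omega>. immortal (D \<omega>) 0}" for k
    by (rule prob_immortal)
  have disj: "AE \<omega> in M. \<omega> \<notin> ?E i \<or> \<omega> \<notin> ?E j" if "i < j" for i j
  proof -
    define d where "d = j - i"
    have sh: "int d + int i = int j" "- int d - int i = - int j" using that by (simp_all add: d_def)
    have "immortal (\<lambda>y. D \<omega> (y + (int i, - int i)) - (int i, - int i)) (int d, - int d) \<longleftrightarrow>
      immortal (D \<omega>) (int j, - int j)" for \<omega>
      using immortal_shift[of "D \<omega>" "(int d, - int d)" "(int i, - int i)"] by (simp add: sh)
    then have "prob {\<omega>. immortal (D \<omega>) (int i, - int i) \<and> immortal (D \<omega>) (int j, - int j)}
      = prob {\<omega>. immortal (D \<omega>) 0 \<and> immortal (D \<omega>) (int d, - int d)}"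
      using prob_dual_shift[of "\<lambda>D. immortal D 0 \<and> immortal D (int d, - int d)" "(int i, - int i)"]
      by (simp add: E2 flip: immortal_at)
    also have "\<dots> = 0"
      using assms[of d] that E2[of 0 "(int d, - int d)"] by (subst prob_eq_0) (auto simp: d_def)
    finally show ?thesis
      using E2[of "(int i, - int i)" "(int j, - int j)"] by (subst (asm) prob_eq_0) (auto elim: eventually_mono)
  qed
  have "real n * prob {\<omega>. immortal (D \<omega>) 0} \<le> 1" for n
  proof -
    have "prob (\<Union>k<n. ?E k) = (\<Sum>k<n. prob (?E k))"
    proof (rule measure_UNION_AE)
      show "?E i \<in> fmeasurable M" for i using E[of i] by (simp add: fmeasurable_eq_sets)
      show "pairwise (\<lambda>i j. AE \<omega> in M. \<omega> \<notin> ?E i \<or> \<omega> \<notin> ?E j) {..<n}"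
      proof (rule pairwiseI)
        fix i j :: nat assume "i \<noteq> j"
        then consider "i < j" | "j < i" by linarith
        then show "AE \<omega> in M. \<omega> \<notin> ?E i \<or> \<omega> \<notin> ?E j"
        proof cases
          case 2 from disj[OF this] show ?thesis by eventually_elim auto
        qed (rule disj)
      qed
    qed simp
    also have "\<dots> = real n * prob {\<omega>. immortal (D \<omega>) 0}" by (simp add: pE)
    finally show ?thesis using prob_le_1[of "\<Union>k<n. ?E k"] by simp
  qed
  then have "prob {\<omega>. immortal (D \<omega>) 0} = 0"
    by (metis reals_Archimedean3 measure_nonneg less_eq_real_def not_le)
  then show ?thesis
    using immortal_events[of 0] by (subst (asm) prob_eq_0) (auto simp: pred_def)
qed

end

end

section \<open>Excluding immortal pairs by the weights below an antidiagonal\<close>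

context busemann_process
begin

text \<open>Seen from a fixed site \<open>z\<close>, the Busemann function obeys a last-passage
  recursion: the smaller increment at \<open>x\<close> belongs to the larger of the two values
  ahead.\<close>

lemma corner_recursion:
  assumes cocycle: "\<forall>\<xi>\<in>riU. \<forall>\<sigma> x y z. B \<xi> \<sigma> x y \<omega> + B \<xi> \<sigma> y z \<omega> = B \<xi> \<sigma> x z \<omega>"
    and recovery: "\<forall>\<xi>\<in>riU. \<forall>\<sigma> x. min (B \<xi> \<sigma> x (x + e1) \<omega>) (B \<xi> \<sigma> x (x + e2) \<omega>) = wt x \<omega>"
    and \<xi>: "\<xi> \<in> riU"
  shows "B \<xi> \<sigma> x z \<omega> = wt x \<omega> + max (B \<xi> \<sigma> (x + e1) z \<omega>) (B \<xi> \<sigma> (x + e2) z \<omega>)"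
    and "B \<xi> \<sigma> x (x + e1) \<omega> \<le> B \<xi> \<sigma> x (x + e2) \<omega> \<longleftrightarrow>
      B \<xi> \<sigma> (x + e2) z \<omega> \<le> B \<xi> \<sigma> (x + e1) z \<omega>"
proof -
  have "B \<xi> \<sigma> x (x + e1) \<omega> + B \<xi> \<sigma> (x + e1) z \<omega> = B \<xi> \<sigma> x z \<omega>"
    "B \<xi> \<sigma> x (x + e2) \<omega> + B \<xi> \<sigma> (x + e2) z \<omega> = B \<xi> \<sigma> x z \<omega>"
    "min (B \<xi> \<sigma> x (x + e1) \<omega>) (B \<xi> \<sigma> x (x + e2) \<omega>) = wt x \<omega>"
    using cocycle recovery \<xi> by blast+
  then show "B \<xi> \<sigma> x z \<omega> = wt x \<omega> + max (B \<xi> \<sigma> (x + e1) z \<omega>) (B \<xi> \<sigma> (x + e2) z \<omega>)"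
    "B \<xi> \<sigma> x (x + e1) \<omega> \<le> B \<xi> \<sigma> x (x + e2) \<omega> \<longleftrightarrow>
      B \<xi> \<sigma> (x + e2) z \<omega> \<le> B \<xi> \<sigma> (x + e1) z \<omega>"
    by linarith+
qed

context
  fixes \<xi> assumes \<xi>: "\<xi> \<in> riU"
begin

text \<open>No site of level at most \<open>0\<close> dominates one of level at least
  \<open>1\<close>, so \<open>B_indep\<close> applies to the half-plane of levels at least
  \<open>1\<close>.\<close>

lemma indep_above_below:
  assumes F: "F \<in> sets (sigma UNIV
        ({wt x -` A \<inter> space M | x A. x \<in> {y. 1 \<le> level y} \<and> A \<in> sets borel} \<union>
         {B \<xi> \<sigma> x y -` A \<inter> space M | \<xi> \<sigma> x y A.
            \<xi> \<in> riU \<and> x \<in> {y. 1 \<le> level y} \<and> x \<le> y \<and> A \<in> sets borel}))"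
    and J: "finite J" "J \<noteq> {}" "\<And>x. x \<in> J \<Longrightarrow> level x \<le> 0"
    and A: "\<And>x. x \<in> J \<Longrightarrow> A x \<in> sets borel"
  shows "prob (F \<inter> (\<Inter>x\<in>J. wt x -` A x)) = prob F * prob (\<Inter>x\<in>J. wt x -` A x)"
proof -
  let ?I = "{y :: site. 1 \<le> level y}"
  let ?G = "{wt x -` A \<inter> space M | x A. (\<forall>z\<in>?I. \<not> z \<le> x) \<and> A \<in> sets borel}"
  have below: "\<forall>z\<in>?I. \<not> z \<le> x" if "level x \<le> 0" for x
    using that by (auto simp: level_def less_eq_prod_def)
  have "(\<Inter>x\<in>J. wt x -` A x) \<in> sets (sigma UNIV ?G)"
  proof (intro sets.finite_INT J)
    fix x assume "x \<in> J"
    then have "\<forall>z\<in>?I. \<not> z \<le> x" "A x \<in> sets borel" using below J(3) A by blast+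
    then have "wt x -` A x \<inter> space M \<in> ?G" by blast
    then have "wt x -` A x \<in> ?G" by simp
    then show "wt x -` A x \<in> sets (sigma UNIV ?G)" by auto
  qed
  then have W: "(\<Inter>x\<in>J. wt x -` A x) \<in> sigma_sets (space M) ?G" by simp
  from F have "F \<in> sigma_sets (space M) ({wt x -` A \<inter> space M | x A. x \<in> ?I \<and> A \<in> sets borel} \<union>
         {B \<xi> \<sigma> x y -` A \<inter> space M | \<xi> \<sigma> x y A.
            \<xi> \<in> riU \<and> x \<in> ?I \<and> x \<le> y \<and> A \<in> sets borel})" by simp
  from indep_setD[OF B_indep this W] show ?thesis .
qed

lemma prob_weights_pos:
  assumes J: "finite J" "J \<noteq> {}"
    and A: "\<And>x. x \<in> J \<Longrightarrow> A x \<in> sets borel" "\<And>x. x \<in> J \<Longrightarrow> prob (wt 0 -` A x) > 0"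
  shows "prob (\<Inter>x\<in>J. wt x -` A x) > 0"
proof -
  have "prob (\<Inter>x\<in>J. wt x -` A x \<inter> space M) = (\<Prod>x\<in>J. prob (wt x -` A x \<inter> space M))"
    by (rule indep_varsD[OF wt_indep]) (use J A in auto)
  moreover have "(\<Prod>x\<in>J. prob (wt x -` A x \<inter> space M)) > 0"
  proof (rule prod_pos)
    fix x assume "x \<in> J"
    then show "prob (wt x -` A x \<inter> space M) > 0" using prob_wt_in[OF A(1), of x x] A(2)[of x] by simp
  qed
  ultimately show ?thesis by simp
qed

text \<open>The bound \<open>c\<close> on the Busemann function along the antidiagonal allows the
  length \<open>N\<close> of the squeeze to be fixed in advance, so that \<open>W\<close> prescribes
  finitely many weights. As \<open>c\<close> grows, the events \<open>F c\<close> exhaust the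
  immortal pairs.\<close>

lemma AE_no_immortal_pair:
  assumes "d \<ge> 1"
  shows "AE \<omega> in M. \<not> (immortal (D \<xi> \<omega>) 0 \<and> immortal (D \<xi> \<omega>) (int d, - int d))"
proof -
  obtain l u where lu: "l < u" "prob (wt 0 -` {..l}) > 0" "prob (wt 0 -` {u..}) > 0"
    by (rule nondegenerate_wt)
  \<comment> \<open>The corner dominates all sites \<open>(i, 1 - i)\<close> with
    \<open>0 \<le> i \<le> d + 1\<close>, because \<open>B_indep\<close> covers only increments from
    \<open>x\<close> to \<open>y\<close> with \<open>x \<le> y\<close>.\<close>
  define corner :: site where "corner = (int d + 1, 1)"
  define H where "H i \<omega> = B \<xi> Plus (i, 1 - i) corner \<omega>" for i \<omega>
  define F where "F c = {\<omega>. (immortal (D \<xi> \<omega>) 0 \<and> immortal (D \<xi> \<omega>) (int d, - int d)) \<and> (\<forall>i\<in>{0..int d + 1}. \<bar>H i \<omega>\<bar> \<le> real c)}" for c :: nat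
  have "AE \<omega> in M. \<omega> \<notin> F c" for c
  proof -
    obtain N :: nat where N: "2 * real c < real N * (u - l)"
      using reals_Archimedean3[of "u - l"] lu by auto
    define low where "low n i \<longleftrightarrow> - int (min n N) < i \<and> i \<le> int d - int (n - N)" for n i
    \<comment> \<open>The time is recovered from the level of the site. Giving high weights to
      everything in the box \<open>J\<close> outside the low region covers the two rays in
      particular.\<close>
    define A where "A x = (if low (nat (1 - fst x - snd x)) (fst x) then {..l} else {u..})" for x :: site
    define J where "J = (\<lambda>(n, i). (i, 1 - int n - i)) ` ({1..2 * N + d} \<times> {- int N..int d + 1})"
    define W where "W = (\<Inter>x\<in>J. wt x -` A x)"
    have J: "finite J" "J \<noteq> {}" "\<And>x. x \<in> J \<Longrightarrow> level x \<le> 0"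
      using assms by (auto simp: J_def level_def)
    have A: "A x \<in> sets borel" "prob (wt 0 -` A x) > 0" for x
      using lu by (auto simp: A_def)
    have W0: "prob W > 0" unfolding W_def using J A by (intro prob_weights_pos) auto
    let ?G = "{wt x -` A \<inter> space M | x A. x \<in> {y. 1 \<le> level y} \<and> A \<in> sets borel} \<union>
         {B \<xi> \<sigma> x y -` A \<inter> space M | \<xi> \<sigma> x y A.
            \<xi> \<in> riU \<and> x \<in> {y. 1 \<le> level y} \<and> x \<le> y \<and> A \<in> sets borel}"
    define N' where "N' = sigma UNIV ?G"
    have space_N' [simp]: "space N' = UNIV" by (simp add: N'_def)
    have BN: "B \<xi> \<sigma> x y \<in> borel_measurable N'" if "1 \<le> level x" "x \<le> y" for \<sigma> x y
    proof (rule measurableI)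
      fix S :: "real set" assume "S \<in> sets borel"
      then have "B \<xi> \<sigma> x y -` S \<inter> space M \<in> ?G" using that \<xi> by blast
      then show "B \<xi> \<sigma> x y -` S \<inter> space N' \<in> sets N'" by (simp add: N'_def)
    qed simp
    have [measurable]: "H i \<in> borel_measurable N'" if "i \<in> {0..int d + 1}" for i
      unfolding H_def[abs_def] using that by (intro BN) (auto simp: level_def corner_def less_eq_prod_def)
    have [measurable]: "Measurable.pred N' (\<lambda>\<omega>. immortal (D \<xi> \<omega>) x)" if "level x = 0" for x
      using that by (intro pred_immortal BN) auto
    have "Measurable.pred N' (\<lambda>\<omega>. (immortal (D \<xi> \<omega>) 0 \<and> immortal (D \<xi> \<omega>) (int d, - int d)) \<and> (\<forall>i\<in>{0..int d + 1}. \<bar>H i \<omega>\<bar> \<le> real c))"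
      by (intro pred_intros_logic pred_intros_finite) (auto simp: level_def)
    then have "F c \<in> sets N'" by (simp add: F_def pred_def)
    then have FW: "prob (F c \<inter> W) = prob (F c) * prob W"
      unfolding N'_def W_def using J A by (intro indep_above_below) auto
    have "sets N' \<subseteq> events"
    proof -
      have "?G \<subseteq> events"
        using measurable_sets[OF wt_measurable] measurable_sets[OF borel_measurable_integrable[OF B_integrable]] by auto
      then show ?thesis unfolding N'_def by (simp add: sets.sigma_sets_subset[of _ M, simplified])
    qed
    then have Fe: "F c \<in> events" using \<open>F c \<in> sets N'\<close> by auto
    have We: "W \<in> events"
      unfolding W_def using J A measurable_sets[OF wt_measurable] by (intro sets.finite_INT) auto
    have "AE \<omega> in M. \<omega> \<notin> F c \<inter> W"
      using AE_cocycle AE_recovery AE_single_immortal_parent[OF \<xi>]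
    proof eventually_elim
      case (elim \<omega>)
      show ?case
      proof
        assume \<omega>: "\<omega> \<in> F c \<inter> W"
        note rec = corner_recursion[OF elim(1,2) \<xi>]
        \<comment> \<open>Time \<open>n\<close> is the level \<open>1 - n\<close>, one above the
          paths: a path at \<open>y\<close> of level \<open>- n\<close> compares the values at
          \<open>y + e2\<close>, in its own column, and at \<open>y + e1\<close>, in the next
          one.\<close>
        define h where "h n i = B \<xi> Plus (i, 1 - int n - i) corner \<omega>" for n i
        define w where "w n i = wt (i, 1 - int n - i) \<omega>" for n i
        define orbit where "orbit x n = fst ((D \<xi> \<omega> ^^ n) x)" for x n
        have orbit: "(D \<xi> \<omega> ^^ n) x = (orbit x n, - int n - orbit x n)" if "level x = 0" for x n
        proof -
          have "level ((D \<xi> \<omega> ^^ n) x) = - int n"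
          proof (induction n)
            case (Suc n)
            then show ?case using dual_succ_step[of B \<omega> \<xi> "(D \<xi> \<omega> ^^ n) x"]
              by (auto simp: level_def e1_def e2_def)
          qed (use that in simp)
          then show ?thesis by (auto simp: orbit_def level_def prod_eq_iff)
        qed
        have step: "orbit x (Suc n) = (if h n (orbit x n) \<le> h n (orbit x n + 1) then orbit x n - 1 else orbit x n)"
          if "level x = 0" for x n
        proof -
          define y where "y = (D \<xi> \<omega> ^^ n) x"
          have y: "y = (orbit x n, - int n - orbit x n)" unfolding y_def by (rule orbit[OF that])
          have "orbit x (Suc n) = fst (D \<xi> \<omega> y)" by (simp add: orbit_def y_def)
          moreover have "B \<xi> Plus (y + e2) corner \<omega> = h n (orbit x n)" "B \<xi> Plus (y + e1) corner \<omega> = h n (orbit x n + 1)"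
            by (simp_all add: h_def y e1_def e2_def algebra_simps)
          ultimately show ?thesis
            by (simp add: dual_succ_Plus rec(2)[of Plus y corner]) (simp add: y e1_def e2_def)
        qed
        have lev: "level (0::site) = 0" "level (int d, - int d) = 0" by (simp_all add: level_def)
        have "\<exists>n. orbit (int d, - int d) n \<le> orbit 0 n"
        proof (rule squeezed_paths_meet[where h = h and w = w and d = d and c = c and N = N and l = l and u = u])
          show "h (Suc n) i = w (Suc n) i + max (h n i) (h n (i + 1))" for n i
          proof -
            have "(i, 1 - int (Suc n) - i) + e1 = (i + 1, 1 - int n - (i + 1))"
              "(i, 1 - int (Suc n) - i) + e2 = (i, 1 - int n - i)"
              by (simp_all add: e1_def e2_def)
            then show ?thesis
              using rec(1)[of Plus "(i, 1 - int (Suc n) - i)" corner] by (simp only: h_def w_def max.commute)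
          qed
          show "\<bar>h 0 i\<bar> \<le> c" if "0 \<le> i" "i \<le> int d + 1" for i
            using \<omega> that by (auto simp: F_def H_def h_def)
          have wA: "w n i \<in> (if low n i then {..l} else {u..})"
            if "1 \<le> n" "n \<le> 2 * N + d" "- int N \<le> i" "i \<le> int d + 1" for n i
          proof -
            have "(i, 1 - int n - i) \<in> J" using that by (force simp: J_def)
            then have "wt (i, 1 - int n - i) \<omega> \<in> A (i, 1 - int n - i)" using \<omega> by (auto simp: W_def)
            then show ?thesis by (simp add: w_def A_def)
          qed
          show "w n i \<le> l" if "1 \<le> n" "n \<le> 2 * N + d" "- int (min n N) < i" "i \<le> int d - int (n - N)" for n i
            using wA[of n i] that by (auto simp: low_def)
          show "u \<le> w n i" if "1 \<le> n" "n \<le> 2 * N + d" "i = - int (min n N) \<or> i = int d + 1 - int (n - N)" for n i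
            using wA[of n i] that by (auto simp: low_def)
          show "orbit 0 (Suc n) = (if h n (orbit 0 n) \<le> h n (orbit 0 n + 1) then orbit 0 n - 1 else orbit 0 n)" for n
            by (rule step[OF lev(1)])
          show "orbit (int d, - int d) (Suc n) =
            (if h n (orbit (int d, - int d) n) \<le> h n (orbit (int d, - int d) n + 1)
             then orbit (int d, - int d) n - 1 else orbit (int d, - int d) n)" for n
            by (rule step[OF lev(2)])
          show "orbit 0 0 = 0" "orbit (int d, - int d) 0 = int d" by (simp_all add: orbit_def)
        qed (use N lu in auto)
        \<comment> \<open>Both orbits move left by at most one column per step, so their order could
          change only through a meeting.\<close>
        moreover have "orbit 0 n < orbit (int d, - int d) n" for n
        proof (induction n)
          case (Suc n)
          have "orbit 0 (Suc n) \<noteq> orbit (int d, - int d) (Suc n)"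
          proof
            assume "orbit 0 (Suc n) = orbit (int d, - int d) (Suc n)"
            then have "(D \<xi> \<omega> ^^ Suc n) 0 = (D \<xi> \<omega> ^^ Suc n) (int d, - int d)"
              unfolding orbit[OF lev(1)] orbit[OF lev(2)] by simp
            moreover have "(D \<xi> \<omega> ^^ Suc n) 0 \<noteq> (D \<xi> \<omega> ^^ Suc n) (int d, - int d)"
              using \<omega> elim(3) assms
              by (intro immortal_never_merge dual_succ_step) (auto simp: F_def zero_prod_def)
            ultimately show False by simp
          qed
          then show ?case using Suc step[OF lev(1), of n] step[OF lev(2), of n] by (auto split: if_splits)
        qed (use assms in \<open>simp add: orbit_def\<close>)
        ultimately show False by (meson not_le)
      qed
    qed
    then have "prob (F c \<inter> W) = 0" using Fe We by (subst prob_eq_0) auto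
    then have "prob (F c) = 0" using FW W0 by simp
    then show ?thesis using Fe by (simp add: prob_eq_0)
  qed
  then have "AE \<omega> in M. \<forall>c. \<omega> \<notin> F c" by (simp add: AE_all_countable)
  then show ?thesis
  proof eventually_elim
    case (elim \<omega>)
    obtain c :: nat where c: "Max ((\<lambda>i. \<bar>H i \<omega>\<bar>) ` {0..int d + 1}) \<le> real c"
      using real_arch_simple by blast
    have "\<bar>H i \<omega>\<bar> \<le> real c" if "i \<in> {0..int d + 1}" for i
      using Max_ge[of "(\<lambda>i. \<bar>H i \<omega>\<bar>) ` {0..int d + 1}" "\<bar>H i \<omega>\<bar>"] that c by (auto intro: order_trans)
    with elim[rule_format, of c] show ?case by (auto simp: F_def)
  qed
qed

lemma AE_no_immortal: "AE \<omega> in M. \<forall>x. \<not> immortal (D \<xi> \<omega>) x"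
  unfolding AE_all_countable
proof
  fix x
  have ev: "{\<omega>. immortal (D \<xi> \<omega>) y} \<in> events" for y
    using immortal_events[OF \<xi>, of y] by (simp add: pred_def)
  have "AE \<omega> in M. \<not> immortal (D \<xi> \<omega>) 0"
    by (intro not_immortal_if_no_pairs[OF \<xi>] AE_no_immortal_pair)
  then have "prob {\<omega>. immortal (D \<xi> \<omega>) x} = 0"
    unfolding prob_immortal[OF \<xi>, of x] using ev[of 0] by (subst prob_eq_0) auto
  then show "AE \<omega> in M. \<not> immortal (D \<xi> \<omega>) x"
    using ev[of x] by (subst (asm) prob_eq_0) auto
qed

end

end

section \<open>Busemann measures\<close>

lemma signed_measure_empty: "signed_measure N m \<Longrightarrow> m {} = 0"
  by (simp add: signed_measure_def)

lemma signed_measure_sums: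
  "signed_measure N m \<Longrightarrow> range A \<subseteq> sets N \<Longrightarrow> disjoint_family A \<Longrightarrow> (\<lambda>i. m (A i)) sums m (\<Union>i. A i)"
  for A :: "nat \<Rightarrow> 'a set"
  by (simp add: signed_measure_def)

lemma signed_measure_Un:
  assumes m: "signed_measure N m" and AB: "A \<in> sets N" "B \<in> sets N" "A \<inter> B = {}"
  shows "m (A \<union> B) = m A + m B"
proof -
  have "range (binaryset A B) \<subseteq> sets N" using AB by (auto simp: range_binaryset_eq)
  from signed_measure_sums[OF m this] have "(\<lambda>i. m (binaryset A B i)) sums m (A \<union> B)"
    using AB(3) by (simp add: disjoint_family_on_def binaryset_def UN_binaryset_eq Int_commute)
  moreover have "(\<lambda>i. m (binaryset A B i)) sums (m A + m B)"
    by (rule binaryset_sums) (rule signed_measure_empty[OF m])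
  ultimately show ?thesis by (rule sums_unique2)
qed

lemma signed_measure_diff:
  assumes "signed_measure N m" "signed_measure N m'"
  shows "signed_measure N (\<lambda>A. m A - m' A)"
  using assms unfolding signed_measure_def by (auto intro!: sums_diff)

lemma null_if_total_variation_zero:
  assumes m: "signed_measure N m" and S: "S \<in> sets N" "total_variation N m S = 0"
    and A: "A \<in> sets N" "A \<subseteq> S"
  shows "m A = 0"
proof (cases "A = {}")
  case False
  define P where "P = {A, S - A} - {{}}"
  have P: "finite P" "P \<subseteq> sets N" "partition_on S P" "A \<in> P"
    using S A False by (auto simp: P_def partition_on_def disjoint_def)
  have "ennreal \<bar>m A\<bar> \<le> (\<Sum>C\<in>P. ennreal \<bar>m C\<bar>)"
    using P by (intro member_le_sum) auto
  also have "\<dots> \<le> total_variation N m S"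
    unfolding total_variation_def using P by (intro SUP_upper) auto
  finally show ?thesis using S(2) by (simp add: ennreal_eq_0_iff)
qed (simp add: signed_measure_empty[OF m])

lemma total_variation_zero_if_null:
  assumes "\<And>A. A \<in> sets N \<Longrightarrow> A \<subseteq> S \<Longrightarrow> m A = 0"
  shows "total_variation N m S = 0"
proof -
  have "(\<Sum>C\<in>P. ennreal \<bar>m C\<bar>) = 0" if "P \<subseteq> sets N" "partition_on S P" for P
    using that assms by (intro sum.neutral) (auto simp: partition_on_def)
  then have "total_variation N m S \<le> 0"
    unfolding total_variation_def by (intro SUP_least) auto
  then show ?thesis by simp
qed

definition seg :: "real \<Rightarrow> real \<Rightarrow> point set" where "seg a b = dIcc (dir a) (dir b)"

abbreviation borel_on :: "point set \<Rightarrow> point measure" where "borel_on K \<equiv> restrict_space borel K"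

lemma seg_eq: "0 < a \<Longrightarrow> b < 1 \<Longrightarrow> seg a b = dir ` {a..b}"
  by (simp add: seg_def dIcc_dir)

lemma dir_borel [measurable]: "dir \<in> borel_measurable borel"
  by (intro borel_measurable_continuous_onI continuous_on_dir)

lemma dir_image_in_sets:
  assumes "0 < a" "b < 1" "I \<in> sets borel" "I \<subseteq> {a..b}"
  shows "dir ` I \<in> sets (borel_on (seg a b))"
proof -
  have "dir ` I = seg a b \<inter> {x. fst x \<in> I}"
    using assms by (auto simp: seg_eq image_iff)
  moreover have "{x :: point. fst x \<in> I} \<in> sets borel"
  proof -
    have "(\<lambda>x :: point. fst x) \<in> borel_measurable borel"
      by (intro borel_measurable_continuous_onI continuous_intros)
    from measurable_sets[OF this assms(3)] show ?thesis by (simp add: vimage_def)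
  qed
  ultimately show ?thesis by (auto simp: sets_restrict_space)
qed

lemma sets_seg_cases:
  assumes "0 < a" "b < 1" "A \<in> sets (borel_on (seg a b))"
  obtains I where "I \<in> sets borel" "A = dir ` (I \<inter> {a..b})"
proof -
  obtain A' where A': "A' \<in> sets borel" "A = seg a b \<inter> A'" using assms(3) by (auto simp: sets_restrict_space)
  show ?thesis
  proof
    show "dir -` A' \<in> sets borel" using measurable_sets[OF dir_borel A'(1)] by simp
    show "A = dir ` (dir -` A' \<inter> {a..b})" using A' assms by (auto simp: seg_eq)
  qed
qed

lemma greaterThanLessThan_as_UN:
  fixes s t :: real
  assumes "s < t"
  obtains c where "incseq c" "\<forall>n. s \<le> c n \<and> c n < t" "c \<longlonglongrightarrow> t" "(\<Union>n. {s<..c n}) = {s<..<t}"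
proof
  define c where "c n = t - (t - s) * inverse (real (Suc n))" for n
  have "inverse (real (Suc n)) \<le> inverse (real (Suc m))" if "m \<le> n" for m n
    using that by (intro le_imp_inverse_le) auto
  then show "incseq c" using assms by (auto simp: incseq_def c_def intro!: mult_left_mono)
  have lt: "c n < t" for n using assms by (simp add: c_def)
  moreover have "s \<le> c n" for n
  proof -
    define d where "d = (t - s) * inverse (real (Suc n))"
    have "d \<le> (t - s) * 1"
      unfolding d_def using assms by (intro mult_left_mono) (auto simp: inverse_le_1_iff)
    then show ?thesis unfolding c_def d_def[symmetric] by simp
  qed
  ultimately show "\<forall>n. s \<le> c n \<and> c n < t" by blast
  have "c \<longlonglongrightarrow> t - (t - s) * 0"
    unfolding c_def by (intro tendsto_intros LIMSEQ_inverse_real_of_nat)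
  then show lim: "c \<longlonglongrightarrow> t" by simp
  show "(\<Union>n. {s<..c n}) = {s<..<t}"
  proof (intro equalityI subsetI)
    fix x assume x: "x \<in> {s<..<t}"
    then have "\<forall>\<^sub>F n in sequentially. x < c n" by (intro order_tendstoD(1)[OF lim]) simp
    from eventually_happens'[OF sequentially_bot this] obtain n where "x < c n" ..
    then have "x \<in> {s<..c n}" using x by simp
    then show "x \<in> (\<Union>n. {s<..c n})" by blast
  next
    fix x assume "x \<in> (\<Union>n. {s<..c n})"
    then obtain n where "s < x" "x \<le> c n" by auto
    then show "x \<in> {s<..<t}" using le_less_trans[OF _ lt] by auto
  qed
qed

text \<open>Intervals \<open>{s<..t}\<close> inside \<open>{a..b}\<close> never contain
  \<open>a\<close>. That point is caught by \<open>[a, b[\<close>, once the open interval is known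
  to be null. After that the half-open intervals are an intersection-stable generator to which
  Dynkin's argument applies.\<close>

lemma signed_measure_eq_zero:
  assumes ab: "0 < a" "a < b" "b < 1" and m: "signed_measure (borel_on (seg a b)) m"
    and Ioc: "\<And>s t. a \<le> s \<Longrightarrow> s < t \<Longrightarrow> t \<le> b \<Longrightarrow> m (dir ` {s<..t}) = 0"
    and Ico: "\<And>s t. a \<le> s \<Longrightarrow> s < t \<Longrightarrow> t \<le> b \<Longrightarrow> m (dir ` {s..<t}) = 0"
  shows "m A = 0"
proof -
  let ?N = "borel_on (seg a b)"
  have sets: "dir ` I \<in> sets ?N" if "I \<in> sets borel" "I \<subseteq> {a..b}" for I
    using dir_image_in_sets ab that by simp
  have Un: "m (dir ` (I \<union> J)) = m (dir ` I) + m (dir ` J)"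
    if "I \<in> sets borel" "I \<subseteq> {a..b}" "J \<in> sets borel" "J \<subseteq> {a..b}" "I \<inter> J = {}" for I J
    unfolding image_Un using that
    by (intro signed_measure_Un[OF m] sets) (auto simp: image_iff)
  obtain c where inc_c: "incseq c" and cab: "\<forall>n. a \<le> c n \<and> c n < b"
    and "c \<longlonglongrightarrow> b" and Uc: "(\<Union>n. {a<..c n}) = {a<..<b}"
    by (rule greaterThanLessThan_as_UN[OF ab(2)])
  have c: "a \<le> c n" "c n < b" for n using cab by auto
  have inc: "incseq (\<lambda>n. {a<..c n})" using inc_c by (fastforce simp: incseq_def)
  have open0: "m (dir ` {a<..<b}) = 0"
  proof -
    \<comment> \<open>Signed measures are summed over disjoint families, so the increasing union is
      cut into consecutive half-open pieces.\<close>
    let ?J = "disjointed (\<lambda>n. {a<..c n})"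
    have Ioc_cases: "{p<..q} = {} \<or> (\<exists>s t. a \<le> s \<and> s < t \<and> t \<le> b \<and> {p<..q} = {s<..t})"
      if "a \<le> p" "q \<le> b" for p q
      using that by (cases "p < q") (blast, simp)
    have J: "?J n = {} \<or> (\<exists>s t. a \<le> s \<and> s < t \<and> t \<le> b \<and> ?J n = {s<..t})" for n
    proof (cases n)
      case 0
      then have J0: "?J n = {a<..c 0}" by (simp add: disjointed_def)
      show ?thesis unfolding J0 by (rule Ioc_cases) (use c(2)[of 0] in auto)
    next
      case (Suc k)
      have Jn: "?J n = {c k<..c n}"
        unfolding Suc disjointed_mono[OF inc] using c(1)[of k] by auto
      show ?thesis unfolding Jn by (rule Ioc_cases) (use c(1)[of k] c(2)[of n] in auto)
    qed
    have U: "(\<Union>n. ?J n) = {a<..<b}" using Uc by (simp add: UN_disjointed_eq)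
    have "(\<lambda>n. m (dir ` ?J n)) sums m (\<Union>n. dir ` ?J n)"
    proof (rule signed_measure_sums[OF m])
      have "dir ` ?J n \<in> sets ?N" for n
        using J[of n] U by (intro sets) auto
      then show "range (\<lambda>n. dir ` ?J n) \<subseteq> sets ?N" by auto
      show "disjoint_family (\<lambda>n. dir ` ?J n)"
        using disjoint_family_disjointed[of "\<lambda>n. {a<..c n}"]
        by (fastforce simp: disjoint_family_on_def)
    qed
    moreover have "m (dir ` ?J n) = 0" for n using J[of n] Ioc signed_measure_empty[OF m] by auto
    ultimately have "m (\<Union>n. dir ` ?J n) = 0" using sums_unique2[OF _ sums_zero] by simp
    then show ?thesis using U by (metis image_UN)
  qed
  have a0: "m (dir ` {a}) = 0"
  proof -
    have "{a..<b} = {a} \<union> {a<..<b}" "{a<..<b} \<subseteq> {a..b}" using ab by auto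
    then show ?thesis using Un[of "{a}" "{a<..<b}"] open0 Ico[of a b] ab by simp
  qed
  have Icc: "m (dir ` {a..t}) = 0" if "t \<le> b" for t
  proof -
    consider "t < a" | "t = a" | "a < t" by linarith
    then show ?thesis
    proof cases
      case 3
      then have "{a..t} = {a} \<union> {a<..t}" "{a<..t} \<subseteq> {a..b}" using that by auto
      then show ?thesis using Un[of "{a}" "{a<..t}"] a0 Ioc[of a t] that 3 ab by simp
    qed (use a0 signed_measure_empty[OF m] in auto)
  qed
  have all: "m (dir ` (I \<inter> {a..b})) = 0" if "I \<in> sets borel" for I
  proof -
    have I: "I \<in> sigma_sets UNIV (range (\<lambda>(s, t). {s<..t::real}))"
      using that unfolding borel_sigma_sets_Ioc by simp
    show ?thesis
    proof (rule sigma_sets_induct_disjoint[OF _ _ I])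
      show "Int_stable (range (\<lambda>(s, t). {s<..t::real}))"
      proof (rule Int_stableI)
        fix x y assume "x \<in> range (\<lambda>(s, t). {s<..t::real})" "y \<in> range (\<lambda>(s, t). {s<..t::real})"
        then obtain s t s' t' where "x = {s<..t}" "y = {s'<..t'}" by auto
        then have "x \<inter> y = {max s s'<..min t t'}" by auto
        then show "x \<inter> y \<in> range (\<lambda>(s, t). {s<..t::real})" by auto
      qed
      fix J assume "J \<in> range (\<lambda>(s, t). {s<..t::real})"
      then obtain s t where J: "J = {s<..t}" by auto
      consider "s < a" | "a \<le> s" "s < min t b" | "min t b \<le> s" by linarith
      then show "m (dir ` (J \<inter> {a..b})) = 0"
      proof cases
        case 1
        then have "J \<inter> {a..b} = {a..min t b}" using J by auto
        then show ?thesis using Icc[of "min t b"] by simp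
      next
        case 2
        then have "J \<inter> {a..b} = {s<..min t b}" using J by auto
        then show ?thesis using Ioc[of s "min t b"] 2 by simp
      next
        case 3
        then have "J \<inter> {a..b} = {}" using J by auto
        then show ?thesis using signed_measure_empty[OF m] by simp
      qed
    next
      show "m (dir ` ({} \<inter> {a..b})) = 0" using signed_measure_empty[OF m] by simp
    next
      fix J assume J: "J \<in> sigma_sets UNIV (range (\<lambda>(s, t). {s<..t::real}))" "m (dir ` (J \<inter> {a..b})) = 0"
      then have "J \<in> sets borel" unfolding borel_sigma_sets_Ioc by simp
      then have "m (dir ` ((J \<inter> {a..b}) \<union> ((UNIV - J) \<inter> {a..b}))) =
          m (dir ` (J \<inter> {a..b})) + m (dir ` ((UNIV - J) \<inter> {a..b}))"
        by (intro Un) auto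
      moreover have "(J \<inter> {a..b}) \<union> ((UNIV - J) \<inter> {a..b}) = {a..b}" by auto
      ultimately show "m (dir ` ((UNIV - J) \<inter> {a..b})) = 0" using J(2) Icc[of b] by simp
    next
      fix J :: "nat \<Rightarrow> real set"
      assume J: "disjoint_family J" "range J \<subseteq> sigma_sets UNIV (range (\<lambda>(s, t). {s<..t::real}))"
        "\<And>i. m (dir ` (J i \<inter> {a..b})) = 0"
      then have Jb: "J i \<in> sets borel" for i unfolding borel_sigma_sets_Ioc by auto
      have "(\<lambda>i. m (dir ` (J i \<inter> {a..b}))) sums m (\<Union>i. dir ` (J i \<inter> {a..b}))"
      proof (rule signed_measure_sums[OF m])
        show "range (\<lambda>i. dir ` (J i \<inter> {a..b})) \<subseteq> sets ?N" using Jb by (auto intro!: sets)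
        show "disjoint_family (\<lambda>i. dir ` (J i \<inter> {a..b}))"
          using J(1) by (fastforce simp: disjoint_family_on_def)
      qed
      then have "m (\<Union>i. dir ` (J i \<inter> {a..b})) = 0" using sums_unique2[OF _ sums_zero] J(3) by simp
      moreover have "(\<Union>i. dir ` (J i \<inter> {a..b})) = dir ` ((\<Union>i. J i) \<inter> {a..b})" by auto
      ultimately show "m (dir ` ((\<Union>i. J i) \<inter> {a..b})) = 0" by simp
    qed auto
  qed
  show ?thesis
  proof (cases "A \<in> sets ?N")
    case True
    then show ?thesis using sets_seg_cases[of a b A] all ab by metis
  qed (use m in \<open>simp add: signed_measure_def\<close>)
qed

text \<open>A function of a direction \<open>t\<close> and a side, such as a nondecreasing Busemann function.\<close>
locale sided_mono =
  fixes \<phi> :: "real \<Rightarrow> sign \<Rightarrow> real"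
  assumes Minus_le_Plus: "0 < t \<Longrightarrow> t < 1 \<Longrightarrow> \<phi> t Minus \<le> \<phi> t Plus"
    and Plus_le_Minus: "0 < s \<Longrightarrow> s < t \<Longrightarrow> t < 1 \<Longrightarrow> \<phi> s Plus \<le> \<phi> t Minus"
    and left_limit: "0 < t \<Longrightarrow> t < 1 \<Longrightarrow> ((\<lambda>s. \<phi> s Plus) \<longlongrightarrow> \<phi> t Minus) (at_left t)"
    and right_limit: "0 < t \<Longrightarrow> t < 1 \<Longrightarrow> ((\<lambda>s. \<phi> s Plus) \<longlongrightarrow> \<phi> t Plus) (at_right t)"
begin

lemma mono_Plus: "0 < s \<Longrightarrow> s \<le> t \<Longrightarrow> t < 1 \<Longrightarrow> \<phi> s Plus \<le> \<phi> t Plus"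
  using Plus_le_Minus[of s t] Minus_le_Plus[of t] by (cases "s = t") auto

lemma between:
  assumes "0 < s" "s < t" "t < u" "u < 1"
  shows "\<phi> s Plus \<le> \<phi> t \<sigma>" "\<phi> t \<sigma> \<le> \<phi> u Plus"
  using Plus_le_Minus[of s t] Minus_le_Plus[of t] Plus_le_Minus[of t u] Minus_le_Plus[of u] assms
  by (cases \<sigma>; auto)+

lemma constant_between:
  assumes "0 < s" "s < t" "t < u" "u < 1" "\<phi> s Plus = \<phi> u Plus"
  shows "\<phi> t \<sigma> = \<phi> s Plus"
  using between[of s t u \<sigma>] assms by auto

lemma constant_within:
  assumes "0 < s" "s \<le> t" "t \<le> u" "u < 1" "\<phi> s Plus = \<phi> u Plus"
  shows "\<phi> t Plus = \<phi> s Plus"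
  using mono_Plus[of s t] mono_Plus[of t u] assms by auto

lemma constant_on_common_interval:
  assumes "sided_mono \<psi>" and "x \<le> y"
    and "0 < \<alpha>" "\<alpha> < x" "y < \<beta>" "\<beta> < 1" "\<phi> \<alpha> Plus = \<phi> \<beta> Plus"
    and "0 < \<alpha>'" "\<alpha>' < x" "y < \<beta>'" "\<beta>' < 1" "\<psi> \<alpha>' Plus = \<psi> \<beta>' Plus"
  obtains a b where "0 < a" "a < x" "y < b" "b < 1" "\<phi> a Plus = \<phi> b Plus" "\<psi> a Plus = \<psi> b Plus"
proof
  interpret \<psi>: sided_mono \<psi> by fact
  let ?a = "max \<alpha> \<alpha>'" and ?b = "min \<beta> \<beta>'"
  show "\<phi> ?a Plus = \<phi> ?b Plus"
    using constant_within[of \<alpha> ?a \<beta>] constant_within[of \<alpha> ?b \<beta>] assms by simp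
  show "\<psi> ?a Plus = \<psi> ?b Plus"
    using \<psi>.constant_within[of \<alpha>' ?a \<beta>'] \<psi>.constant_within[of \<alpha>' ?b \<beta>'] assms by simp
  show "0 < ?a" "?a < x" "y < ?b" "?b < 1"
    using assms by (simp_all add: less_max_iff_disj min_less_iff_disj)
qed

section \<open>The measure with a given monotone distribution function on
  \<open>[a, b]\<close>\<close>

context
  fixes a b :: real
  assumes ab: "0 < a" "a < b" "b < 1"
begin

text \<open>A distribution function on the whole line. Its value \<open>\<phi> a Minus\<close> left
  of \<open>a\<close> gives the point \<open>a\<close> the mass
  \<open>\<phi> a Plus - \<phi> a Minus\<close>, which is part of the prescribed mass of
  \<open>[a, t[\<close>.\<close>

definition clamped :: "real \<Rightarrow> real" where
  "clamped t = (if t < a then \<phi> a Minus else if b \<le> t then \<phi> b Plus else \<phi> t Plus)"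

definition clamped_left :: "real \<Rightarrow> real" where
  "clamped_left t = (if t \<le> a then \<phi> a Minus else \<phi> t Minus)"

lemma mono_clamped: "s \<le> t \<Longrightarrow> clamped s \<le> clamped t"
  using mono_Plus[of s t] mono_Plus[of s b] mono_Plus[of a t] mono_Plus[of a b] Minus_le_Plus[of a] ab
  unfolding clamped_def by (auto split: if_splits)

lemma continuous_clamped: "continuous (at_right t) clamped"
proof -
  consider "t < a" | "a \<le> t" "t < b" | "b \<le> t" by linarith
  then have "(clamped \<longlongrightarrow> clamped t) (at_right t)"
  proof cases
    case 1
    then have "\<forall>\<^sub>F s in at_right t. clamped t = clamped s"
      unfolding eventually_at_right_field by (intro exI[of _ a]) (auto simp: clamped_def)
    then show ?thesis by (rule Lim_transform_eventually[OF tendsto_const])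
  next
    case 2
    then have "\<forall>\<^sub>F s in at_right t. \<phi> s Plus = clamped s"
      unfolding eventually_at_right_field by (intro exI[of _ b]) (auto simp: clamped_def)
    moreover have "((\<lambda>s. \<phi> s Plus) \<longlongrightarrow> clamped t) (at_right t)"
      using right_limit[of t] 2 ab by (simp add: clamped_def)
    ultimately show ?thesis by (rule Lim_transform_eventually[rotated])
  next
    case 3
    then have "\<forall>\<^sub>F s in at_right t. clamped t = clamped s"
      unfolding eventually_at_right_field by (intro exI[of _ "t + 1"]) (use ab in \<open>auto simp: clamped_def\<close>)
    then show ?thesis by (rule Lim_transform_eventually[OF tendsto_const])
  qed
  then show ?thesis by (simp add: continuous_within)
qed

lemma clamped_left_limit:
  assumes "t \<le> b"
  shows "(clamped \<longlongrightarrow> clamped_left t) (at_left t)"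
proof (cases "t \<le> a")
  case True
  then have "\<forall>\<^sub>F s in at_left t. clamped_left t = clamped s"
    unfolding eventually_at_left_field by (intro exI[of _ "t - 1"]) (auto simp: clamped_def clamped_left_def)
  then show ?thesis by (rule Lim_transform_eventually[OF tendsto_const])
next
  case False
  then have "\<forall>\<^sub>F s in at_left t. \<phi> s Plus = clamped s"
    unfolding eventually_at_left_field using assms by (intro exI[of _ a]) (auto simp: clamped_def)
  moreover have "((\<lambda>s. \<phi> s Plus) \<longlongrightarrow> clamped_left t) (at_left t)"
    using left_limit[of t] False assms ab by (simp add: clamped_left_def)
  ultimately show ?thesis by (rule Lim_transform_eventually[rotated])
qed

abbreviation \<mu> where "\<mu> \<equiv> interval_measure clamped"

lemma emeasure_\<mu>_Ioc: "s \<le> t \<Longrightarrow> emeasure \<mu> {s<..t} = ennreal (clamped t - clamped s)"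
  using mono_clamped continuous_clamped by (intro emeasure_interval_measure_Ioc) auto

lemma measure_\<mu>_Ioc: "s \<le> t \<Longrightarrow> measure \<mu> {s<..t} = clamped t - clamped s"
  using mono_clamped continuous_clamped by (intro measure_interval_measure_Ioc) auto

lemma emeasure_\<mu>_finite:
  assumes "I \<subseteq> {s<..t}"
  shows "emeasure \<mu> I \<noteq> \<infinity>"
proof -
  have "emeasure \<mu> I \<le> emeasure \<mu> {s<..max s t}" using assms by (intro emeasure_mono) auto
  then show ?thesis using emeasure_\<mu>_Ioc[of s "max s t"] by (auto simp: top_unique)
qed

lemma measure_\<mu>_Ioo:
  assumes "s < t" "t \<le> b"
  shows "measure \<mu> {s<..<t} = clamped_left t - clamped s"
proof -
  obtain c where mono: "incseq c" and cst: "\<forall>n. s \<le> c n \<and> c n < t" and lim: "c \<longlonglongrightarrow> t"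
    and U: "(\<Union>n. {s<..c n}) = {s<..<t}"
    by (rule greaterThanLessThan_as_UN[OF assms(1)])
  have c: "s \<le> c n" "c n < t" for n using cst by auto
  have clim: "filterlim c (at_left t) sequentially"
    using lim c(2) less_imp_neq[OF c(2)] by (simp add: filterlim_at)
  have "(\<lambda>n. measure \<mu> {s<..c n}) \<longlonglongrightarrow> measure \<mu> (\<Union>n. {s<..c n})"
  proof (rule Lim_measure_incseq)
    show "incseq (\<lambda>n. {s<..c n})" using mono by (fastforce simp: incseq_def)
    show "emeasure \<mu> (\<Union>n. {s<..c n}) \<noteq> \<infinity>" unfolding U by (rule emeasure_\<mu>_finite[of _ s t]) auto
  qed auto
  moreover have "(\<lambda>n. measure \<mu> {s<..c n}) \<longlonglongrightarrow> clamped_left t - clamped s"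
    unfolding measure_\<mu>_Ioc[OF c(1)]
    by (intro tendsto_diff tendsto_const filterlim_compose[OF clamped_left_limit[OF assms(2)] clim])
  ultimately show ?thesis unfolding U by (rule LIMSEQ_unique)
qed

lemma measure_\<mu>_Ico:
  assumes "s < t" "t \<le> b"
  shows "measure \<mu> {s..<t} = clamped_left t - clamped_left s"
proof -
  have eq: "{s..<t} = {s-1<..<t} - {s-1<..<s}" using assms by auto
  have "measure \<mu> {s..<t} = measure \<mu> {s-1<..<t} - measure \<mu> {s-1<..<s}"
    unfolding eq
  proof (rule measure_Diff)
    show "emeasure \<mu> {s-1<..<t} \<noteq> \<infinity>" by (rule emeasure_\<mu>_finite[of _ "s - 1" t]) auto
  qed (use assms in auto)
  then show ?thesis using assms by (simp add: measure_\<mu>_Ioo)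
qed

definition side_measure :: "point set \<Rightarrow> real" where
  "side_measure A = (if A \<in> sets (borel_on (seg a b)) then measure \<mu> (dir -` A) else 0)"

lemma signed_measure_side_measure: "signed_measure (borel_on (seg a b)) side_measure"
proof -
  have sub: "dir -` A \<in> sets borel \<and> dir -` A \<subseteq> {a-1<..b}" if A: "A \<in> sets (borel_on (seg a b))" for A
  proof -
    obtain I where "I \<in> sets borel" "A = dir ` (I \<inter> {a..b})" using sets_seg_cases[of a b A] ab A by auto
    then show ?thesis by (auto simp: inj_vimage_image_eq[OF inj_dir])
  qed
  have "(\<lambda>i. side_measure (A i)) sums side_measure (\<Union>i. A i)"
    if A: "range A \<subseteq> sets (borel_on (seg a b))" "disjoint_family A" for A :: "nat \<Rightarrow> point set"
  proof -
    have AU: "(\<Union>i. A i) \<in> sets (borel_on (seg a b))" using A(1) by auto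
    have "(\<lambda>i. measure \<mu> (dir -` A i)) sums measure \<mu> (\<Union>i. dir -` A i)"
    proof (rule measure_UNION)
      show "range (\<lambda>i. dir -` A i) \<subseteq> sets \<mu>" using sub A(1) by auto
      show "disjoint_family (\<lambda>i. dir -` A i)" using A(2) by (fastforce simp: disjoint_family_on_def)
      have "(\<Union>i. dir -` A i) \<subseteq> {a-1<..b}" using sub A(1) by blast
      then show "emeasure \<mu> (\<Union>i. dir -` A i) \<noteq> \<infinity>" by (rule emeasure_\<mu>_finite)
    qed
    then show ?thesis using A(1) AU by (simp add: side_measure_def vimage_UN range_subsetD)
  qed
  then show ?thesis by (auto simp: signed_measure_def side_measure_def)
qed

lemma side_measure_Ioc:
  assumes "a \<le> s" "s < t" "t \<le> b"
  shows "side_measure (dir ` {s<..t}) = \<phi> t Plus - \<phi> s Plus"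
proof -
  have "dir ` {s<..t} \<in> sets (borel_on (seg a b))" using ab assms by (intro dir_image_in_sets) auto
  then show ?thesis
    using assms ab by (simp add: side_measure_def inj_vimage_image_eq[OF inj_dir] measure_\<mu>_Ioc) (auto simp: clamped_def)
qed

lemma side_measure_Ico:
  assumes "a \<le> s" "s < t" "t \<le> b"
  shows "side_measure (dir ` {s..<t}) = \<phi> t Minus - \<phi> s Minus"
proof -
  have "dir ` {s..<t} \<in> sets (borel_on (seg a b))" using ab assms by (intro dir_image_in_sets) auto
  then show ?thesis
    using assms ab by (simp add: side_measure_def inj_vimage_image_eq[OF inj_dir] measure_\<mu>_Ico) (auto simp: clamped_left_def)
qed

text \<open>\<open>s\<close> and \<open>t\<close> may lie outside \<open>[a, b]\<close>. Constancy
  then also covers the clamped values \<open>\<phi> a Minus\<close> and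
  \<open>\<phi> b Plus\<close>.\<close>

lemma side_measure_null:
  assumes "0 < s" "t < 1" "\<phi> s Plus = \<phi> t Plus" "A \<subseteq> dir ` {s<..<t}"
  shows "side_measure A = 0"
proof (cases "A \<in> sets (borel_on (seg a b))")
  case True
  then obtain I where I: "I \<in> sets borel" "A = dir ` (I \<inter> {a..b})" using sets_seg_cases[of a b A] ab by auto
  show ?thesis
  proof (cases "I \<inter> {a..b} = {}")
    case False
    then obtain u where u: "u \<in> I" "a \<le> u" "u \<le> b" by auto
    have I_sub: "I \<inter> {a..b} \<subseteq> {s<..<t}"
      using I(2) assms(4) by (simp add: inj_image_subset_iff[OF inj_dir])
    then have "s < u" "u < t" and sub: "I \<inter> {a..b} \<subseteq> {s<..min t b}" using u by auto
    have c: "\<phi> r \<sigma> = \<phi> s Plus" if "s < r" "r < t" for r \<sigma>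
      using constant_between[of s r t \<sigma>] that assms by auto
    have s: "clamped s = \<phi> s Plus"
      using c[of a Minus] \<open>s < u\<close> \<open>u < t\<close> u ab by (auto simp: clamped_def)
    have t: "clamped (min t b) = \<phi> s Plus"
      using c[of b Plus] c[of a Plus] \<open>s < u\<close> \<open>u < t\<close> u ab assms(3) by (auto simp: clamped_def min_def)
    have "emeasure \<mu> (I \<inter> {a..b}) \<le> emeasure \<mu> {s<..min t b}" using sub by (intro emeasure_mono) auto
    also have "\<dots> = ennreal (clamped (min t b) - clamped s)"
      using \<open>s < u\<close> \<open>u < t\<close> u by (intro emeasure_\<mu>_Ioc) auto
    also have "\<dots> = 0" by (simp add: s t)
    finally have "measure \<mu> (I \<inter> {a..b}) = 0" by (simp add: measure_def)
    then show ?thesis by (simp add: side_measure_def I inj_vimage_image_eq[OF inj_dir])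
  qed (simp add: side_measure_def I)
qed (simp add: side_measure_def)

end

end

text \<open>Connectedness of the interval turns local into global constancy; the neighbourhoods of
  \<open>x\<close> and \<open>y\<close> push it beyond both ends.\<close>

lemma (in sided_mono) locally_constant_imp_constant:
  assumes xy: "0 < x" "x \<le> y" "y < 1"
    and loc: "\<And>u. x \<le> u \<Longrightarrow> u \<le> y \<Longrightarrow> \<exists>\<alpha> \<beta>. 0 < \<alpha> \<and> \<alpha> < u \<and> u < \<beta> \<and> \<beta> < 1 \<and> \<phi> \<alpha> Plus = \<phi> \<beta> Plus"
  shows "\<exists>\<alpha> \<beta>. 0 < \<alpha> \<and> \<alpha> < x \<and> y < \<beta> \<and> \<beta> < 1 \<and> \<phi> \<alpha> Plus = \<phi> \<beta> Plus"
proof -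
  obtain \<alpha> \<alpha>' where \<alpha>: "0 < \<alpha>" "\<alpha> < x" "x < \<alpha>'" "\<alpha>' < 1" "\<phi> \<alpha> Plus = \<phi> \<alpha>' Plus" using loc[of x] xy by auto
  obtain \<beta>' \<beta> where \<beta>: "0 < \<beta>'" "\<beta>' < y" "y < \<beta>" "\<beta> < 1" "\<phi> \<beta>' Plus = \<phi> \<beta> Plus" using loc[of y] xy by auto
  have "\<phi> x Plus = \<phi> y Plus"
  proof (rule connected_local_const[where A = "{x..y}" and f = "\<lambda>u. \<phi> u Plus"])
    show "\<forall>u\<in>{x..y}. \<forall>\<^sub>F v in at u within {x..y}. \<phi> u Plus = \<phi> v Plus"
    proof
      fix u assume "u \<in> {x..y}"
      then obtain p q where pq: "0 < p" "p < u" "u < q" "q < 1" "\<phi> p Plus = \<phi> q Plus" using loc[of u] by auto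
      have "\<forall>\<^sub>F v in nhds u. v \<in> {p<..<q}" using pq by (intro eventually_nhds_in_open) auto
      then have "\<forall>\<^sub>F v in at u within {x..y}. v \<in> {p<..<q}" by (simp add: eventually_at_filter eventually_mono)
      then show "\<forall>\<^sub>F v in at u within {x..y}. \<phi> u Plus = \<phi> v Plus"
      proof eventually_elim
        case (elim v)
        then show ?case using constant_between[of p v q Plus] constant_between[of p u q Plus] pq by auto
      qed
    qed
  qed (use xy in auto)
  moreover have "\<phi> x Plus = \<phi> \<alpha> Plus" using constant_between[of \<alpha> x \<alpha>' Plus] \<alpha> by auto
  moreover have "\<phi> y Plus = \<phi> \<beta> Plus" using constant_between[of \<beta>' y \<beta> Plus] \<beta> by auto
  ultimately show ?thesis using \<alpha> \<beta> by auto
qed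

lemma sided_mono_const: "sided_mono (\<lambda>_ _. c)"
  by unfold_locales auto

lemma sided_mono_add:
  assumes "sided_mono \<phi>" "sided_mono \<psi>"
  shows "sided_mono (\<lambda>t \<sigma>. \<phi> t \<sigma> + \<psi> t \<sigma>)"
proof -
  interpret \<phi>: sided_mono \<phi> by fact
  interpret \<psi>: sided_mono \<psi> by fact
  show ?thesis
    by unfold_locales (auto intro: add_mono tendsto_add \<phi>.Minus_le_Plus \<psi>.Minus_le_Plus
        \<phi>.Plus_le_Minus \<psi>.Plus_le_Minus \<phi>.left_limit \<psi>.left_limit \<phi>.right_limit \<psi>.right_limit)
qed

section \<open>Supports of Busemann measures\<close>

lemma subinterval_of_seg:
  assumes "\<zeta> \<in> riU" "\<eta> \<in> riU" "dprec \<zeta> \<eta>" "dIcc \<zeta> \<eta> \<subseteq> seg a b" "0 < a" "b < 1"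
  obtains s t where "\<zeta> = dir s" "\<eta> = dir t" "a \<le> s" "s < t" "t \<le> b"
proof -
  obtain s t where st: "\<zeta> = dir s" "\<eta> = dir t" "0 < s" "s < 1" "0 < t" "t < 1" "s < t"
    using assms(1-3) by (auto elim!: riU_cases)
  then have "dir s \<in> seg a b" "dir t \<in> seg a b"
    using assms(4) by (auto simp: dIcc_dir)
  then show ?thesis using that st assms(5,6) by (auto simp: seg_eq)
qed

text \<open>Discharges the definite description in the definition of \<open>busemann_measure\<close>.\<close>
lemma busemann_measure_eq:
  assumes ab: "0 < a" "a < b" "b < 1" and P: "sided_mono P" and N: "sided_mono N"
    and B: "\<And>t \<sigma>. 0 < t \<Longrightarrow> t < 1 \<Longrightarrow> B (dir t) \<sigma> x y \<omega> = P t \<sigma> - N t \<sigma>"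
  shows "busemann_measure B \<omega> x y (seg a b) =
    (\<lambda>A. sided_mono.side_measure P a b A - sided_mono.side_measure N a b A)"
    (is "_ = ?m")
proof -
  interpret P: sided_mono P by fact
  interpret N: sided_mono N by fact
  let ?ok = "\<lambda>m. signed_measure (borel_on (seg a b)) m \<and>
    (\<forall>\<zeta>\<in>riU. \<forall>\<eta>\<in>riU. dprec \<zeta> \<eta> \<and> dIcc \<zeta> \<eta> \<subseteq> seg a b \<longrightarrow>
       m (dIoc \<zeta> \<eta>) = B \<eta> Plus x y \<omega> - B \<zeta> Plus x y \<omega> \<and>
       m (dIco \<zeta> \<eta>) = B \<eta> Minus x y \<omega> - B \<zeta> Minus x y \<omega>)"
  have ok: "?ok ?m"
  proof (intro conjI ballI impI)
    show "signed_measure (borel_on (seg a b)) ?m"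
      by (intro signed_measure_diff P.signed_measure_side_measure N.signed_measure_side_measure ab)
    fix \<zeta> \<eta> assume *: "\<zeta> \<in> riU" "\<eta> \<in> riU" "dprec \<zeta> \<eta> \<and> dIcc \<zeta> \<eta> \<subseteq> seg a b"
    obtain s t where st: "\<zeta> = dir s" "\<eta> = dir t" "a \<le> s" "s < t" "t \<le> b"
      by (rule subinterval_of_seg[of \<zeta> \<eta> a b]) (use * ab in auto)
    show "?m (dIoc \<zeta> \<eta>) = B \<eta> Plus x y \<omega> - B \<zeta> Plus x y \<omega>"
      using st ab by (simp add: dIoc_dir P.side_measure_Ioc N.side_measure_Ioc B)
    show "?m (dIco \<zeta> \<eta>) = B \<eta> Minus x y \<omega> - B \<zeta> Minus x y \<omega>"
      using st ab by (simp add: dIco_dir P.side_measure_Ico N.side_measure_Ico B)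
  qed
  have uniq: "m = ?m" if m: "?ok m" for m
  proof
    fix A
    have d: "m (dir ` {s<..t}) = ?m (dir ` {s<..t}) \<and> m (dir ` {s..<t}) = ?m (dir ` {s..<t})"
      if st: "a \<le> s" "s < t" "t \<le> b" for s t
    proof -
      have "dir s \<in> riU" "dir t \<in> riU" "dprec (dir s) (dir t) \<and> dIcc (dir s) (dir t) \<subseteq> seg a b"
        using st ab by (auto simp: dIcc_dir seg_eq)
      then have "m (dIoc (dir s) (dir t)) = ?m (dIoc (dir s) (dir t))"
        "m (dIco (dir s) (dir t)) = ?m (dIco (dir s) (dir t))"
        using m ok by auto
      then show ?thesis using st ab by (simp add: dIoc_dir dIco_dir)
    qed
    have "(\<lambda>A. m A - ?m A) A = 0"
    proof (rule signed_measure_eq_zero[OF ab])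
      show "signed_measure (borel_on (seg a b)) (\<lambda>A. m A - ?m A)"
        by (rule signed_measure_diff[OF conjunct1[OF m] conjunct1[OF ok]])
    qed (use d in auto)
    then show "m A = ?m A" by simp
  qed
  show ?thesis
    unfolding busemann_measure_def by (rule the_equality) (use ok uniq in blast)+
qed

text \<open>Between distant sites a Busemann function is only a difference \<open>P - N\<close> of
  monotone functions. Constancy of both makes every subset of \<open>]\<alpha>, \<beta>[\<close>
  null without appeal to cancellation, and removing this open interval leaves the closed witness
  \<open>?C\<close>.\<close>

lemma not_in_signed_support:
  assumes ab: "0 < a" "a < b" "b < 1" and P: "sided_mono P" and N: "sided_mono N"
    and B: "\<And>t \<sigma>. 0 < t \<Longrightarrow> t < 1 \<Longrightarrow> B (dir t) \<sigma> x y \<omega> = P t \<sigma> - N t \<sigma>"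
    and u: "0 < \<alpha>" "\<alpha> < u" "u < \<beta>" "\<beta> < 1"
    and const: "P \<alpha> Plus = P \<beta> Plus" "N \<alpha> Plus = N \<beta> Plus"
  shows "dir u \<notin> signed_support (seg a b) (busemann_measure B \<omega> x y (seg a b))"
proof -
  let ?C = "dir ` ({a..b} - {\<alpha><..<\<beta>})"
  have "compact ({a..b} - {\<alpha><..<\<beta>})" by (intro compact_diff compact_Icc open_greaterThanLessThan)
  then have "closed ?C" by (intro compact_imp_closed compact_continuous_image continuous_on_dir)
  moreover have "total_variation (borel_on (seg a b)) (busemann_measure B \<omega> x y (seg a b)) (seg a b - ?C) = 0"
  proof (rule total_variation_zero_if_null)
    fix A assume "A \<subseteq> seg a b - ?C"
    then have "A \<subseteq> dir ` {\<alpha><..<\<beta>}" using ab by (auto simp: seg_eq)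
    moreover have "busemann_measure B \<omega> x y (seg a b) =
        (\<lambda>A. sided_mono.side_measure P a b A - sided_mono.side_measure N a b A)"
      by (rule busemann_measure_eq) (use ab P N B in auto)
    ultimately show "busemann_measure B \<omega> x y (seg a b) A = 0"
      using u const by (simp add:
          sided_mono.side_measure_null[OF P ab, of \<alpha> \<beta>] sided_mono.side_measure_null[OF N ab, of \<alpha> \<beta>])
  qed
  moreover have "?C \<subseteq> seg a b" "dir u \<notin> ?C" using ab u by (auto simp: seg_eq)
  ultimately show ?thesis unfolding signed_support_def by blast
qed

lemma not_in_supp_mu:
  assumes P: "sided_mono P" and N: "sided_mono N"
    and B: "\<And>t \<sigma>. 0 < t \<Longrightarrow> t < 1 \<Longrightarrow> B (dir t) \<sigma> x y \<omega> = P t \<sigma> - N t \<sigma>"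
    and u: "0 < \<alpha>" "\<alpha> < u" "u < \<beta>" "\<beta> < 1"
    and const: "P \<alpha> Plus = P \<beta> Plus" "N \<alpha> Plus = N \<beta> Plus"
  shows "dir u \<notin> supp_mu B \<omega> x y"
proof
  assume "dir u \<in> supp_mu B \<omega> x y"
  then obtain \<zeta> \<eta> where "\<zeta> \<in> riU" "\<eta> \<in> riU" "dprec \<zeta> \<eta>"
    and supp: "dir u \<in> signed_support (dIcc \<zeta> \<eta>) (busemann_measure B \<omega> x y (dIcc \<zeta> \<eta>))"
    unfolding supp_mu_def by blast
  then obtain a b where "\<zeta> = dir a" "\<eta> = dir b" "0 < a" "a < b" "b < 1"
    by (auto elim!: riU_cases)
  with supp show False
    using not_in_signed_support[of a b P N B x y \<omega> \<alpha> u \<beta>] assms by (simp add: seg_def)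
qed

text \<open>Off the support some half-open interval around \<open>u\<close> has mass zero, that is,
  equal values at its ends; for a monotone function this already means constancy in between.\<close>

lemma locally_constant_off_supp_mu:
  assumes P: "sided_mono P" and B: "\<And>t \<sigma>. 0 < t \<Longrightarrow> t < 1 \<Longrightarrow> B (dir t) \<sigma> x y \<omega> = P t \<sigma>"
    and u: "0 < u" "u < 1" "dir u \<notin> supp_mu B \<omega> x y"
  obtains \<alpha> \<beta> where "0 < \<alpha>" "\<alpha> < u" "u < \<beta>" "\<beta> < 1" "P \<alpha> Plus = P \<beta> Plus"
proof -
  define a b where "a = u / 2" and "b = (1 + u) / 2"
  have ab: "0 < a" "a < u" "u < b" "b < 1" using u by (auto simp: a_def b_def)
  let ?m = "busemann_measure B \<omega> x y (seg a b)"
  have "signed_support (seg a b) ?m \<subseteq> supp_mu B \<omega> x y"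
    unfolding supp_mu_def seg_def using ab
    by (intro order_trans[OF _ UN_upper[of "(dir a, dir b)"]]) auto
  with u(3) have "dir u \<notin> signed_support (seg a b) ?m" by blast
  then obtain C where C: "C \<subseteq> seg a b" "closed C" "total_variation (borel_on (seg a b)) ?m (seg a b - C) = 0" "dir u \<notin> C"
    unfolding signed_support_def by blast
  interpret P: sided_mono P by fact
  have m: "?m = (\<lambda>A. P.side_measure a b A - sided_mono.side_measure (\<lambda>_ _. 0) a b A)"
    by (rule busemann_measure_eq) (use ab P B in \<open>auto intro: sided_mono_const\<close>)
  have sm: "signed_measure (borel_on (seg a b)) ?m"
    unfolding m using ab
    by (intro signed_measure_diff P.signed_measure_side_measure sided_mono.signed_measure_side_measure[OF sided_mono_const]) auto
  have "open (dir -` (- C))"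
    using C(2) continuous_on_dir by (intro open_vimage) auto
  then obtain e where e: "e > 0" "\<And>v. dist v u < e \<Longrightarrow> dir v \<notin> C"
    using C(4) unfolding open_dist by (metis ComplD ComplI vimageD vimageI)
  define \<alpha> \<beta> where "\<alpha> = max a (u - e / 2)" and "\<beta> = min b (u + e / 2)"
  have \<alpha>\<beta>: "a \<le> \<alpha>" "\<alpha> < u" "u < \<beta>" "\<beta> \<le> b" using ab e(1) by (auto simp: \<alpha>_def \<beta>_def)
  have "dir v \<notin> C" if "v \<in> {\<alpha><..\<beta>}" for v
    using that e by (intro e(2)) (auto simp: dist_real_def \<alpha>_def \<beta>_def abs_less_iff)
  then have sub: "dir ` {\<alpha><..\<beta>} \<subseteq> seg a b - C" using \<alpha>\<beta> ab by (auto simp: seg_eq)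
  have "?m (dir ` {\<alpha><..\<beta>}) = 0"
  proof (rule null_if_total_variation_zero[OF sm _ C(3) _ sub])
    show "seg a b - C \<in> sets (borel_on (seg a b))"
      using C(2) by (auto simp: sets_restrict_space intro!: image_eqI[of _ _ "- C"])
    show "dir ` {\<alpha><..\<beta>} \<in> sets (borel_on (seg a b))"
      using \<alpha>\<beta> ab by (intro dir_image_in_sets) auto
  qed
  moreover have "?m (dir ` {\<alpha><..\<beta>}) = P \<beta> Plus - P \<alpha> Plus"
    unfolding m using \<alpha>\<beta> ab
    by (simp add: P.side_measure_Ioc sided_mono.side_measure_Ioc[OF sided_mono_const])
  ultimately show ?thesis using that[of \<alpha> \<beta>] \<alpha>\<beta> ab by auto
qed

section \<open>Instability points and dual edges\<close>

locale busemann_sample =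
  fixes B :: "point \<Rightarrow> sign \<Rightarrow> site \<Rightarrow> site \<Rightarrow> 'w \<Rightarrow> real" and \<omega> :: 'w and w :: "site \<Rightarrow> real"
  assumes cocycle: "0 < t \<Longrightarrow> t < 1 \<Longrightarrow> B (dir t) \<sigma> x y \<omega> + B (dir t) \<sigma> y z \<omega> = B (dir t) \<sigma> x z \<omega>"
    and recovery: "0 < t \<Longrightarrow> t < 1 \<Longrightarrow> min (B (dir t) \<sigma> x (x + e1) \<omega>) (B (dir t) \<sigma> x (x + e2) \<omega>) = w x"
    and mono1: "sided_mono (\<lambda>t \<sigma>. - B (dir t) \<sigma> x (x + e1) \<omega>)"
    and mono2: "sided_mono (\<lambda>t \<sigma>. B (dir t) \<sigma> x (x + e2) \<omega>)"
begin

abbreviation b where "b t \<sigma> x y \<equiv> B (dir t) \<sigma> x y \<omega>"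

abbreviation \<rho> where "\<rho> x t \<sigma> \<equiv> b t \<sigma> (x + e1) (x + e2)"

lemma b_refl: "0 < t \<Longrightarrow> t < 1 \<Longrightarrow> b t \<sigma> x x = 0"
  using cocycle[of t \<sigma> x x x] by simp

lemma \<rho>_below: "0 < t \<Longrightarrow> t < 1 \<Longrightarrow> \<rho> x t \<sigma> = b t \<sigma> x (x + e2) - b t \<sigma> x (x + e1)"
  using cocycle[of t \<sigma> x "x + e1" "x + e2"] by simp

lemma \<rho>_above: "0 < t \<Longrightarrow> t < 1 \<Longrightarrow>
    \<rho> x t \<sigma> = b t \<sigma> (x + e1) (x + e1 + e2) - b t \<sigma> (x + e2) (x + e2 + e1)"
  using cocycle[of t \<sigma> "x + e1" "x + e2" "x + e1 + e2"] by (simp add: algebra_simps)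

lemma sided_mono_cong:
  assumes "sided_mono \<phi>" "\<And>t \<sigma>. 0 < t \<Longrightarrow> t < 1 \<Longrightarrow> \<psi> t \<sigma> = \<phi> t \<sigma>"
  shows "sided_mono \<psi>"
proof -
  interpret \<phi>: sided_mono \<phi> by fact
  have ev: "\<forall>\<^sub>F s in at_left t. \<phi> s Plus = \<psi> s Plus" "\<forall>\<^sub>F s in at_right t. \<phi> s Plus = \<psi> s Plus"
    if "0 < t" "t < 1" for t
  proof -
    show "\<forall>\<^sub>F s in at_left t. \<phi> s Plus = \<psi> s Plus"
      unfolding eventually_at_left_field using that assms(2) by (intro exI[of _ 0]) auto
    show "\<forall>\<^sub>F s in at_right t. \<phi> s Plus = \<psi> s Plus"
      unfolding eventually_at_right_field using that assms(2) by (intro exI[of _ 1]) auto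
  qed
  show ?thesis
  proof
    fix t :: real assume t: "0 < t" "t < 1"
    show "((\<lambda>s. \<psi> s Plus) \<longlongrightarrow> \<psi> t Minus) (at_left t)"
      using Lim_transform_eventually[OF \<phi>.left_limit[OF t] ev(1)[OF t]] assms(2)[OF t] by simp
    show "((\<lambda>s. \<psi> s Plus) \<longlongrightarrow> \<psi> t Plus) (at_right t)"
      using Lim_transform_eventually[OF \<phi>.right_limit[OF t] ev(2)[OF t]] assms(2)[OF t] by simp
  qed (use assms(2) \<phi>.Minus_le_Plus \<phi>.Plus_le_Minus in auto)
qed

lemma sided_mono_\<rho>: "sided_mono (\<rho> x)"
  by (rule sided_mono_cong[OF sided_mono_add[OF mono1[of x] mono2[of x]]]) (simp add: \<rho>_below)

definition locally_constant :: "(real \<Rightarrow> sign \<Rightarrow> real) \<Rightarrow> real \<Rightarrow> bool" where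
  "locally_constant \<phi> u \<longleftrightarrow> (\<exists>\<alpha> \<beta>. 0 < \<alpha> \<and> \<alpha> < u \<and> u < \<beta> \<and> \<beta> < 1 \<and> \<phi> \<alpha> Plus = \<phi> \<beta> Plus)"

text \<open>Every Busemann function is a signed sum of steps along a lattice path from
  \<open>x\<close> to \<open>y\<close>. The class \<open>good\<close>, differences of monotone
  functions that are locally constant at \<open>u\<close>, contains the steps and is closed under
  sums and negation.\<close>

lemma not_in_supp_mu_if_steps_locally_constant:
  assumes u: "0 < u" "u < 1"
    and lc1: "\<And>z. locally_constant (\<lambda>t \<sigma>. b t \<sigma> z (z + e1)) u"
    and lc2: "\<And>z. locally_constant (\<lambda>t \<sigma>. b t \<sigma> z (z + e2)) u"
  shows "dir u \<notin> supp_mu B \<omega> x y"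
proof -
  define good where "good \<psi> \<longleftrightarrow> (\<exists>P N. sided_mono P \<and> sided_mono N \<and> locally_constant P u \<and> locally_constant N u \<and>
    (\<forall>t \<sigma>. 0 < t \<longrightarrow> t < 1 \<longrightarrow> \<psi> t \<sigma> = P t \<sigma> - N t \<sigma>))" for \<psi> :: "real \<Rightarrow> sign \<Rightarrow> real"
  have lc_add: "locally_constant (\<lambda>t \<sigma>. \<phi> t \<sigma> + \<psi> t \<sigma>) u"
    if mono: "sided_mono \<phi>" "sided_mono \<psi>" and lc: "locally_constant \<phi> u" "locally_constant \<psi> u" for \<phi> \<psi>
  proof -
    obtain \<alpha> \<beta> \<alpha>' \<beta>' where ab: "0 < \<alpha>" "\<alpha> < u" "u < \<beta>" "\<beta> < 1" "\<phi> \<alpha> Plus = \<phi> \<beta> Plus"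
      "0 < \<alpha>'" "\<alpha>' < u" "u < \<beta>'" "\<beta>' < 1" "\<psi> \<alpha>' Plus = \<psi> \<beta>' Plus"
      using lc unfolding locally_constant_def by auto
    obtain p q where "0 < p" "p < u" "u < q" "q < 1" "\<phi> p Plus = \<phi> q Plus" "\<psi> p Plus = \<psi> q Plus"
      by (rule sided_mono.constant_on_common_interval[OF mono order_refl ab])
    then show ?thesis unfolding locally_constant_def by (intro exI[of _ p] exI[of _ q]) simp
  qed
  have lc0: "locally_constant (\<lambda>_ _. 0) u"
    unfolding locally_constant_def using u by (intro exI[of _ "u / 2"] exI[of _ "(1 + u) / 2"]) auto
  have add: "good (\<lambda>t \<sigma>. \<phi> t \<sigma> + \<psi> t \<sigma>)" if "good \<phi>" "good \<psi>" for \<phi> \<psi>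
  proof -
    obtain P N where PN: "sided_mono P" "sided_mono N" "locally_constant P u" "locally_constant N u"
      "\<forall>t \<sigma>. 0 < t \<longrightarrow> t < 1 \<longrightarrow> \<phi> t \<sigma> = P t \<sigma> - N t \<sigma>"
      using \<open>good \<phi>\<close> unfolding good_def by blast
    obtain P' N' where PN': "sided_mono P'" "sided_mono N'" "locally_constant P' u" "locally_constant N' u"
      "\<forall>t \<sigma>. 0 < t \<longrightarrow> t < 1 \<longrightarrow> \<psi> t \<sigma> = P' t \<sigma> - N' t \<sigma>"
      using \<open>good \<psi>\<close> unfolding good_def by blast
    show ?thesis unfolding good_def
      by (rule exI[of _ "\<lambda>t \<sigma>. P t \<sigma> + P' t \<sigma>"], rule exI[of _ "\<lambda>t \<sigma>. N t \<sigma> + N' t \<sigma>"])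
         (use PN PN' in \<open>simp add: sided_mono_add lc_add\<close>)
  qed
  have neg: "good (\<lambda>t \<sigma>. - \<phi> t \<sigma>)" if \<phi>: "good \<phi>" for \<phi>
  proof -
    obtain P N where "sided_mono P" "sided_mono N" "locally_constant P u" "locally_constant N u"
      "\<forall>t \<sigma>. 0 < t \<longrightarrow> t < 1 \<longrightarrow> \<phi> t \<sigma> = P t \<sigma> - N t \<sigma>"
      using \<phi> unfolding good_def by blast
    then show ?thesis unfolding good_def by (intro exI[of _ N] exI[of _ P]) simp
  qed
  have cong: "good \<psi>" if "good \<phi>" "\<And>t \<sigma>. 0 < t \<Longrightarrow> t < 1 \<Longrightarrow> \<psi> t \<sigma> = \<phi> t \<sigma>" for \<phi> \<psi>
    using that unfolding good_def by simp
  have step2: "good (\<lambda>t \<sigma>. b t \<sigma> z (z + e2))" for z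
    unfolding good_def using mono2[of z] lc2[of z] lc0 sided_mono_const[of 0]
    by (intro exI[of _ "\<lambda>t \<sigma>. b t \<sigma> z (z + e2)"] exI[of _ "\<lambda>_ _. 0"]) simp
  have "good (\<lambda>t \<sigma>. - b t \<sigma> z (z + e1))" for z
    unfolding good_def using mono1[of z] lc1[of z] lc0 sided_mono_const[of 0]
    by (intro exI[of _ "\<lambda>t \<sigma>. - b t \<sigma> z (z + e1)"] exI[of _ "\<lambda>_ _. 0"]) (simp add: locally_constant_def)
  from neg[OF this] have step1: "good (\<lambda>t \<sigma>. b t \<sigma> z (z + e1))" for z by simp
  have fwd: "good (\<lambda>t \<sigma>. b t \<sigma> x (y + e))" if "good (\<lambda>t \<sigma>. b t \<sigma> x y)" "e = e1 \<or> e = e2" for y e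
  proof (rule cong[OF add[OF that(1)]])
    show "good (\<lambda>t \<sigma>. b t \<sigma> y (y + e))" using that(2) step1[of y] step2[of y] by auto
  qed (use cocycle in simp)
  have bwd: "good (\<lambda>t \<sigma>. b t \<sigma> x (y - e))" if "good (\<lambda>t \<sigma>. b t \<sigma> x y)" "e = e1 \<or> e = e2" for y e
  proof (rule cong[OF add[OF that(1)]])
    show "good (\<lambda>t \<sigma>. - b t \<sigma> (y - e) (y - e + e))" using that(2) step1[of "y - e"] step2[of "y - e"] by (intro neg) auto
  qed (use cocycle[of _ _ x "y - e" y] in \<open>simp add: algebra_simps\<close>)
  have "good (\<lambda>t \<sigma>. b t \<sigma> x x)"
    by (rule cong[of "\<lambda>_ _. 0"]) (auto simp: good_def b_refl intro!: exI[of _ "\<lambda>_ _. 0"] sided_mono_const lc0)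
  \<comment> \<open>\<open>y\<close> may lie on any side of \<open>x\<close>, hence integer
    induction in both coordinates, with forward and backward steps.\<close>
  then have "good (\<lambda>t \<sigma>. b t \<sigma> x (x + (i, 0)))" for i
  proof (induction i rule: int_induct[of _ 0])
    case (step1 i)
    have eq: "x + (i, 0) + e1 = x + (i + 1, 0)" by (simp add: e1_def prod_eq_iff)
    have "good (\<lambda>t \<sigma>. b t \<sigma> x (x + (i, 0) + e1))"
      by (rule fwd) (use step1 in auto)
    then show ?case unfolding eq .
  next
    case (step2 i)
    have eq: "x + (i, 0) - e1 = x + (i - 1, 0)" by (simp add: e1_def prod_eq_iff)
    have "good (\<lambda>t \<sigma>. b t \<sigma> x (x + (i, 0) - e1))"
      by (rule bwd) (use step2 in auto)
    then show ?case unfolding eq .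
  qed (simp flip: zero_prod_def)
  then have "good (\<lambda>t \<sigma>. b t \<sigma> x (x + (i, j)))" for i j
  proof (induction j rule: int_induct[of _ 0])
    case (step1 j)
    have eq: "x + (i, j) + e2 = x + (i, j + 1)" by (simp add: e2_def prod_eq_iff)
    have "good (\<lambda>t \<sigma>. b t \<sigma> x (x + (i, j) + e2))"
      by (rule fwd) (use step1 in auto)
    then show ?case unfolding eq .
  next
    case (step2 j)
    have eq: "x + (i, j) - e2 = x + (i, j - 1)" by (simp add: e2_def prod_eq_iff)
    have "good (\<lambda>t \<sigma>. b t \<sigma> x (x + (i, j) - e2))"
      by (rule bwd) (use step2 in auto)
    then show ?case unfolding eq .
  qed
  from this[of "fst y - fst x" "snd y - snd x"] have "good (\<lambda>t \<sigma>. b t \<sigma> x y)"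
    by (simp add: plus_prod_def)
  then obtain P N where PN: "sided_mono P" "sided_mono N" "locally_constant P u" "locally_constant N u"
      "\<And>t \<sigma>. 0 < t \<Longrightarrow> t < 1 \<Longrightarrow> b t \<sigma> x y = P t \<sigma> - N t \<sigma>"
    unfolding good_def by blast
  obtain \<alpha> \<beta> where 1: "0 < \<alpha>" "\<alpha> < u" "u < \<beta>" "\<beta> < 1" "P \<alpha> Plus = P \<beta> Plus"
    using PN(3) by (auto simp: locally_constant_def)
  obtain \<alpha>' \<beta>' where 2: "0 < \<alpha>'" "\<alpha>' < u" "u < \<beta>'" "\<beta>' < 1" "N \<alpha>' Plus = N \<beta>' Plus"
    using PN(4) by (auto simp: locally_constant_def)
  obtain p q where "0 < p" "p < u" "u < q" "q < 1" "P p Plus = P q Plus" "N p Plus = N q Plus"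
    by (rule sided_mono.constant_on_common_interval[OF PN(1,2) order_refl 1 2])
  then show ?thesis
    using PN(1,2,5) by (intro not_in_supp_mu[where P = P and N = N and \<alpha> = p and \<beta> = q]) auto
qed

end

lemma dual_minus_e: "dual x - e1 = dual (x - e1)" "dual x - e2 = dual (x - e2)"
  by (auto simp: dual_def emb_def e1_def e2_def algebra_simps)

lemma inj_dual: "inj dual"
  by (auto simp: inj_def dual_def emb_def prod_eq_iff)

lemma dual_eq_iff [simp]: "dual x = dual y \<longleftrightarrow> x = y"
  by (rule inj_eq[OF inj_dual])

lemma dual_inner_ehat: "dual x \<bullet> ehat = real_of_int (level x + 1)"
  by (simp add: dual_def emb_def ehat_def e1_def e2_def level_def inner_prod_def)

lemma level_minus_e [simp]: "level (x - e1) = level x - 1" "level (x - e2) = level x - 1"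
  by (simp_all add: level_def e1_def e2_def)

context busemann_sample
begin

lemma w_le: "0 < t \<Longrightarrow> t < 1 \<Longrightarrow> w x \<le> b t \<sigma> x (x + e1)" "0 < t \<Longrightarrow> t < 1 \<Longrightarrow> w x \<le> b t \<sigma> x (x + e2)"
  using recovery[of t \<sigma> x] by linarith+

lemma w_cases: "0 < t \<Longrightarrow> t < 1 \<Longrightarrow> b t \<sigma> x (x + e1) = w x \<or> b t \<sigma> x (x + e2) = w x"
  using recovery[of t \<sigma> x] by linarith

lemma antimono1:
  assumes "0 < s" "s < t" "t < 1"
  shows "b t Plus x (x + e1) \<le> b s \<sigma> x (x + e1)" "b t \<sigma> x (x + e1) \<le> b s Plus x (x + e1)"
proof -
  interpret sided_mono "\<lambda>t \<sigma>. - b t \<sigma> x (x + e1)" by (rule mono1)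
  show "b t Plus x (x + e1) \<le> b s \<sigma> x (x + e1)"
    using Plus_le_Minus[of s t] Minus_le_Plus[of s] Minus_le_Plus[of t] assms by (cases \<sigma>) auto
  show "b t \<sigma> x (x + e1) \<le> b s Plus x (x + e1)"
    using Plus_le_Minus[of s t] Minus_le_Plus[of t] assms by (cases \<sigma>) auto
qed

lemma incr2:
  assumes "0 < s" "s < t" "t < 1"
  shows "b s \<sigma> x (x + e2) \<le> b t Plus x (x + e2)" "b s Plus x (x + e2) \<le> b t \<sigma> x (x + e2)"
proof -
  interpret sided_mono "\<lambda>t \<sigma>. b t \<sigma> x (x + e2)" by (rule mono2)
  show "b s \<sigma> x (x + e2) \<le> b t Plus x (x + e2)"
    using Plus_le_Minus[of s t] Minus_le_Plus[of s] Minus_le_Plus[of t] assms by (cases \<sigma>) auto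
  show "b s Plus x (x + e2) \<le> b t \<sigma> x (x + e2)"
    using Plus_le_Minus[of s t] Minus_le_Plus[of t] assms by (cases \<sigma>) auto
qed

lemma successor_e1: "successor B \<omega> (dir t) \<sigma> x = x + e1 \<longleftrightarrow>
    b t \<sigma> x (x + e1) < b t \<sigma> x (x + e2) \<or> b t \<sigma> x (x + e1) = b t \<sigma> x (x + e2) \<and> \<sigma> = Plus"
  by (cases \<sigma>) (auto simp: successor_def e1_def e2_def prod_eq_iff)

lemma successor_e2: "successor B \<omega> (dir t) \<sigma> x = x + e2 \<longleftrightarrow>
    b t \<sigma> x (x + e2) < b t \<sigma> x (x + e1) \<or> b t \<sigma> x (x + e1) = b t \<sigma> x (x + e2) \<and> \<sigma> = Minus"
  by (cases \<sigma>) (auto simp: successor_def e1_def e2_def prod_eq_iff)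

section \<open>Variation across an interval of directions\<close>

context
  fixes \<zeta> \<eta> :: real
  assumes bds: "0 < \<zeta>" "\<zeta> \<le> \<eta>" "\<eta> < 1"
begin

text \<open>Comparing \<open>Plus\<close> values strictly outside \<open>[\<zeta>, \<eta>]\<close>
  makes jumps at both ends count, including the one between \<open>Minus\<close> and
  \<open>Plus\<close> at \<open>\<zeta>\<close>, as well as variation that accumulates at an end
  from outside. This matches closed supports.\<close>

definition varies :: "(real \<Rightarrow> sign \<Rightarrow> real) \<Rightarrow> bool" where
  "varies \<phi> \<longleftrightarrow> (\<forall>\<alpha> \<beta>. 0 < \<alpha> \<and> \<alpha> < \<zeta> \<and> \<eta> < \<beta> \<and> \<beta> < 1 \<longrightarrow> \<phi> \<alpha> Plus \<noteq> \<phi> \<beta> Plus)"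

abbreviation varies1 where "varies1 x \<equiv> varies (\<lambda>t \<sigma>. b t \<sigma> x (x + e1))"
abbreviation varies2 where "varies2 x \<equiv> varies (\<lambda>t \<sigma>. b t \<sigma> x (x + e2))"
abbreviation inst where "inst x \<equiv> varies (\<rho> x)"

lemma varies_minus: "varies (\<lambda>t \<sigma>. - \<phi> t \<sigma>) \<longleftrightarrow> varies \<phi>"
  by (simp add: varies_def)

lemma varies_cong: "(\<And>t. 0 < t \<Longrightarrow> t < 1 \<Longrightarrow> \<phi> t Plus = \<psi> t Plus) \<Longrightarrow> varies \<phi> \<longleftrightarrow> varies \<psi>"
  unfolding varies_def using bds by auto

lemma varies_add:
  assumes "sided_mono \<phi>" "sided_mono \<psi>"
  shows "varies (\<lambda>t \<sigma>. \<phi> t \<sigma> + \<psi> t \<sigma>) \<longleftrightarrow> varies \<phi> \<or> varies \<psi>"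
proof
  interpret \<phi>: sided_mono \<phi> by fact
  interpret \<psi>: sided_mono \<psi> by fact
  show "varies \<phi> \<or> varies \<psi>" if sum: "varies (\<lambda>t \<sigma>. \<phi> t \<sigma> + \<psi> t \<sigma>)"
  proof (rule ccontr)
    assume "\<not> ?thesis"
    then obtain \<alpha> \<beta> \<alpha>' \<beta>' where ab: "0 < \<alpha>" "\<alpha> < \<zeta>" "\<eta> < \<beta>" "\<beta> < 1" "\<phi> \<alpha> Plus = \<phi> \<beta> Plus"
      "0 < \<alpha>'" "\<alpha>' < \<zeta>" "\<eta> < \<beta>'" "\<beta>' < 1" "\<psi> \<alpha>' Plus = \<psi> \<beta>' Plus"
      unfolding varies_def by auto
    obtain p q where "0 < p" "p < \<zeta>" "\<eta> < q" "q < 1" "\<phi> p Plus = \<phi> q Plus" "\<psi> p Plus = \<psi> q Plus"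
      by (rule \<phi>.constant_on_common_interval[OF assms(2) bds(2) ab])
    then show False using sum[unfolded varies_def, rule_format, of p q] by simp
  qed
  show "varies (\<lambda>t \<sigma>. \<phi> t \<sigma> + \<psi> t \<sigma>)" if one: "varies \<phi> \<or> varies \<psi>"
    unfolding varies_def
  proof (intro allI impI notI)
    fix \<alpha> \<beta> assume ab: "0 < \<alpha> \<and> \<alpha> < \<zeta> \<and> \<eta> < \<beta> \<and> \<beta> < 1"
      and eq: "\<phi> \<alpha> Plus + \<psi> \<alpha> Plus = \<phi> \<beta> Plus + \<psi> \<beta> Plus"
    have "\<phi> \<alpha> Plus \<le> \<phi> \<beta> Plus" "\<psi> \<alpha> Plus \<le> \<psi> \<beta> Plus"
      using \<phi>.mono_Plus[of \<alpha> \<beta>] \<psi>.mono_Plus[of \<alpha> \<beta>] ab bds by auto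
    with eq have "\<phi> \<alpha> Plus = \<phi> \<beta> Plus" "\<psi> \<alpha> Plus = \<psi> \<beta> Plus" by auto
    with one ab show False unfolding varies_def by auto
  qed
qed

lemma inst_iff_below: "inst x \<longleftrightarrow> varies1 x \<or> varies2 x"
proof -
  have "inst x \<longleftrightarrow> varies (\<lambda>t \<sigma>. - b t \<sigma> x (x + e1) + b t \<sigma> x (x + e2))"
    by (rule varies_cong) (simp add: \<rho>_below)
  then show ?thesis using varies_add[OF mono1 mono2] varies_minus[of "\<lambda>t \<sigma>. b t \<sigma> x (x + e1)"] by simp
qed

lemma inst_iff_above: "inst x \<longleftrightarrow> varies1 (x + e2) \<or> varies2 (x + e1)"
proof -
  have "inst x \<longleftrightarrow> varies (\<lambda>t \<sigma>. - b t \<sigma> (x + e2) (x + e2 + e1) + b t \<sigma> (x + e1) (x + e1 + e2))"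
    by (rule varies_cong) (simp add: \<rho>_above)
  then show ?thesis
    using varies_add[OF mono1 mono2] varies_minus[of "\<lambda>t \<sigma>. b t \<sigma> (x + e2) (x + e2 + e1)"] by simp
qed

text \<open>From here on the site \<open>x\<close> stands for the dual point \<open>dual x\<close>: \<open>edge x y\<close> is the arc from
  \<open>dual x\<close> to \<open>dual y\<close> in the union of the dual graphs.\<close>

definition arrow :: "site \<Rightarrow> site \<Rightarrow> bool" where
  "arrow e x \<longleftrightarrow> (\<exists>t \<sigma>. \<zeta> \<le> t \<and> t \<le> \<eta> \<and> successor B \<omega> (dir t) \<sigma> x = x + e)"

definition edge :: "site \<Rightarrow> site \<Rightarrow> bool" where
  "edge x y \<longleftrightarrow> y = x - e1 \<and> arrow e1 x \<or> y = x - e2 \<and> arrow e2 x"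

lemma arrow1_if_varies2:
  assumes "varies2 x"
  shows "arrow e1 x"
proof (rule ccontr)
  assume "\<not> arrow e1 x"
  \<comment> \<open>\<open>\<eta>\<close> with the sign \<open>Plus\<close> is the choice most
    favourable to \<open>e1\<close>, ties included.\<close>
  then have lt: "b \<eta> Plus x (x + e2) < b \<eta> Plus x (x + e1)"
    unfolding arrow_def using bds successor_e1[of \<eta> Plus x] by (auto simp: not_less)
  have lim1: "((\<lambda>s. b s Plus x (x + e1)) \<longlongrightarrow> b \<eta> Plus x (x + e1)) (at_right \<eta>)"
    using tendsto_minus[OF sided_mono.right_limit[OF mono1[of x], of \<eta>]] bds by simp
  have lim2: "((\<lambda>s. b s Plus x (x + e2)) \<longlongrightarrow> b \<eta> Plus x (x + e2)) (at_right \<eta>)"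
    using sided_mono.right_limit[OF mono2[of x], of \<eta>] bds by simp
  \<comment> \<open>The right limits carry the strict inequality past \<open>\<eta>\<close>. There
    the \<open>e2\<close> increment has its minimal value \<open>w x\<close>, so by monotonicity it
    equals \<open>w x\<close> also at \<open>\<zeta> / 2\<close>, which is just some direction below
    \<open>\<zeta>\<close>.\<close>
  have "\<forall>\<^sub>F s in at_right \<eta>. b s Plus x (x + e2) < b s Plus x (x + e1)"
    by (rule order_tendstoD(1)[OF tendsto_diff[OF lim1 lim2], of 0, simplified]) (use lt in simp)
  from eventually_conj[OF this eventually_at_right_real[OF bds(3)]]
  obtain \<beta> where \<beta>: "b \<beta> Plus x (x + e2) < b \<beta> Plus x (x + e1)" "\<eta> < \<beta>" "\<beta> < 1"
    using eventually_happens'[OF trivial_limit_at_right_real] by auto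
  then have "b \<beta> Plus x (x + e2) = w x" using w_cases[of \<beta> Plus x] w_le[of \<beta> x Plus] bds by force
  moreover have "b (\<zeta> / 2) Plus x (x + e2) \<le> b \<beta> Plus x (x + e2)" using incr2[of "\<zeta> / 2" \<beta>] \<beta> bds by auto
  moreover have "w x \<le> b (\<zeta> / 2) Plus x (x + e2)" using w_le(2)[of "\<zeta> / 2"] bds by auto
  ultimately have "b (\<zeta> / 2) Plus x (x + e2) = b \<beta> Plus x (x + e2)" by simp
  with assms \<beta> bds show False unfolding varies_def by auto
qed

lemma arrow2_if_varies1:
  assumes "varies1 x"
  shows "arrow e2 x"
proof (rule ccontr)
  assume "\<not> arrow e2 x"
  then have lt: "b \<zeta> Minus x (x + e1) < b \<zeta> Minus x (x + e2)"
    unfolding arrow_def using bds successor_e2[of \<zeta> Minus x] by (auto simp: not_less)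
  have lim1: "((\<lambda>s. b s Plus x (x + e1)) \<longlongrightarrow> b \<zeta> Minus x (x + e1)) (at_left \<zeta>)"
    using tendsto_minus[OF sided_mono.left_limit[OF mono1[of x], of \<zeta>]] bds by simp
  have lim2: "((\<lambda>s. b s Plus x (x + e2)) \<longlongrightarrow> b \<zeta> Minus x (x + e2)) (at_left \<zeta>)"
    using sided_mono.left_limit[OF mono2[of x], of \<zeta>] bds by simp
  have "\<forall>\<^sub>F s in at_left \<zeta>. b s Plus x (x + e1) < b s Plus x (x + e2)"
    by (rule order_tendstoD(1)[OF tendsto_diff[OF lim2 lim1], of 0, simplified]) (use lt in simp)
  from eventually_conj[OF this eventually_at_left_real[OF bds(1)]]
  obtain \<alpha> where \<alpha>: "b \<alpha> Plus x (x + e1) < b \<alpha> Plus x (x + e2)" "0 < \<alpha>" "\<alpha> < \<zeta>"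
    using eventually_happens'[OF trivial_limit_at_left_real] by auto
  define \<beta> where "\<beta> = (1 + \<eta>) / 2"
  have \<beta>: "\<eta> < \<beta>" "\<beta> < 1" using bds by (auto simp: \<beta>_def)
  have "b \<alpha> Plus x (x + e1) = w x" using w_cases[of \<alpha> Plus x] w_le[of \<alpha> x Plus] \<alpha> bds by force
  moreover have "b \<beta> Plus x (x + e1) \<le> b \<alpha> Plus x (x + e1)" using antimono1[of \<alpha> \<beta>] \<alpha> \<beta> bds by auto
  moreover have "w x \<le> b \<beta> Plus x (x + e1)" using w_le(1)[of \<beta>] \<beta> bds by auto
  ultimately have "b \<alpha> Plus x (x + e1) = b \<beta> Plus x (x + e1)" by simp
  with assms \<alpha> \<beta> show False unfolding varies_def by auto
qed

lemma inst_child: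
  assumes "inst x"
  shows "\<exists>y. edge x y \<and> inst y"
proof (cases "varies1 x")
  case True
  then have "edge x (x - e2)" "inst (x - e2)"
    using arrow2_if_varies1[of x] inst_iff_above[of "x - e2"] by (simp_all add: edge_def)
  then show ?thesis by blast
next
  case False
  then have "varies2 x" using assms inst_iff_below[of x] by simp
  then have "edge x (x - e1)" "inst (x - e1)"
    using arrow1_if_varies2[of x] inst_iff_above[of "x - e1"] by (simp_all add: edge_def)
  then show ?thesis by blast
qed

lemma inst_parent:
  assumes "inst x"
  shows "\<exists>y. edge y x \<and> inst y"
proof (cases "varies1 (x + e2)")
  case True
  then have "edge (x + e2) x" "inst (x + e2)"
    using arrow2_if_varies1[of "x + e2"] inst_iff_below[of "x + e2"] by (simp_all add: edge_def)
  then show ?thesis by blast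
next
  case False
  then have "varies2 (x + e1)" using assms inst_iff_above[of x] by simp
  then have "edge (x + e1) x" "inst (x + e1)"
    using arrow1_if_varies2[of "x + e1"] inst_iff_below[of "x + e1"] by (simp_all add: edge_def)
  then show ?thesis by blast
qed

lemma edge_level: "edge x y \<Longrightarrow> level y = level x - 1"
  by (auto simp: edge_def)

text \<open>The inner product of \<open>dual x\<close> with \<open>ehat\<close> is
  \<open>level x + 1\<close>; hence the shift by one against the indexing of
  \<open>bi_infinite_path\<close>.\<close>

definition lattice_path :: "(int \<Rightarrow> site) \<Rightarrow> bool" where
  "lattice_path q \<longleftrightarrow> (\<forall>n. level (q n) = n - 1 \<and> edge (q n) (q (n - 1)))"

lemma lattice_path_edge:
  assumes "lattice_path q"
  shows "edge (q (n + int (Suc m))) (q (n + int m))"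
proof -
  have "n + int (Suc m) - 1 = n + int m" by simp
  then show ?thesis using assms[unfolded lattice_path_def, rule_format, of "n + int (Suc m)"] by metis
qed

text \<open>The given arc stays in the middle, with iterated children below and iterated parents
  above, so that not only the vertices but also the arcs of the instability graph are covered by
  paths.\<close>

lemma inst_extend:
  assumes "edge x y" "inst x" "inst y"
  obtains q where "lattice_path q" "q (level x + 1) = x" "q (level x) = y"
proof -
  obtain F where F: "\<And>x. inst x \<Longrightarrow> edge x (F x) \<and> inst (F x)" using inst_child by metis
  obtain G where G: "\<And>x. inst x \<Longrightarrow> edge (G x) x \<and> inst (G x)" using inst_parent by metis
  define L where "L = level x"
  define q where "q n = (if n \<le> L then (F ^^ nat (L - n)) y else (G ^^ nat (n - L - 1)) x)" for n
  have FG: "inst ((F ^^ k) y) \<and> level ((F ^^ k) y) = L - 1 - int k"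
    "inst ((G ^^ k) x) \<and> level ((G ^^ k) x) = L + int k" for k
  proof (induction k)
    case (Suc k)
    show "inst ((F ^^ Suc k) y) \<and> level ((F ^^ Suc k) y) = L - 1 - int (Suc k)"
      using Suc(1) F[of "(F ^^ k) y"] edge_level by fastforce
    show "inst ((G ^^ Suc k) x) \<and> level ((G ^^ Suc k) x) = L + int (Suc k)"
      using Suc(2) G[of "(G ^^ k) x"] edge_level by fastforce
  qed (use assms edge_level in \<open>auto simp: L_def\<close>)
  have "lattice_path q"
    unfolding lattice_path_def
  proof (intro allI conjI)
    fix n
    show "level (q n) = n - 1" using FG by (auto simp: q_def)
    consider "n \<le> L" | "n = L + 1" | "n > L + 1" by linarith
    then show "edge (q n) (q (n - 1))"
    proof cases
      case 1
      then have "nat (L - (n - 1)) = Suc (nat (L - n))" by linarith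
      then show ?thesis using F FG(1)[of "nat (L - n)"] 1 by (simp add: q_def)
    next
      case 3
      then have "nat (n - L - 1) = Suc (nat (n - 1 - L - 1))" by linarith
      then show ?thesis using G FG(2)[of "nat (n - 1 - L - 1)"] 3 by (simp add: q_def)
    qed (use assms(1) in \<open>simp add: q_def\<close>)
  qed
  moreover have "q (level x + 1) = x" "q (level x) = y" by (simp_all add: q_def L_def)
  ultimately show ?thesis by (rule that)
qed

end

end

section \<open>Bi-infinite paths consist of instability points\<close>

declare split_paired_All [simp del] split_paired_Ex [simp del]

lemma in_graph_Union:
  "v \<in> pverts (graph_Union S) \<longleftrightarrow> (\<exists>G\<in>S. v \<in> pverts G)"
  "a \<in> parcs (graph_Union S) \<longleftrightarrow> (\<exists>G\<in>S. a \<in> parcs G)"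
  by (simp_all add: graph_Union_def)

context busemann_sample
begin

context
  fixes \<zeta> \<eta> :: real
  assumes bds: "0 < \<zeta>" "\<zeta> \<le> \<eta>" "\<eta> < 1"
begin

lemma parent_of_constant:
  assumes ab: "0 < \<alpha>" "\<alpha> < \<zeta>" "\<eta> < \<beta>" "\<beta> < 1"
    and no_ties: "b \<alpha> Plus y (y + e1) \<noteq> b \<alpha> Plus y (y + e2)" "b \<beta> Plus y (y + e1) \<noteq> b \<beta> Plus y (y + e2)"
    and edge: "edge \<zeta> \<eta> y x" and const: "\<rho> x \<alpha> Plus = \<rho> x \<beta> Plus"
  shows "\<rho> y \<alpha> Plus = \<rho> y \<beta> Plus" "dual_succ B \<omega> (dir \<beta>) Plus y = x"
proof -
  have \<alpha>\<beta>: "\<alpha> < \<beta>" "0 < \<beta>" "\<alpha> < 1" using ab bds by auto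
  have parts: "b \<alpha> Plus (x + e1) (x + e1 + e2) = b \<beta> Plus (x + e1) (x + e1 + e2)"
    "b \<alpha> Plus (x + e2) (x + e2 + e1) = b \<beta> Plus (x + e2) (x + e2 + e1)"
    using const \<rho>_above[of \<alpha> Plus x] \<rho>_above[of \<beta> Plus x] incr2(1)[of \<alpha> \<beta> Plus "x + e1"]
      antimono1(1)[of \<alpha> \<beta> "x + e2" Plus] ab \<alpha>\<beta> by auto
  note w = w_le[of \<alpha> y Plus] w_le[of \<beta> y Plus] w_cases[of \<alpha> Plus y] w_cases[of \<beta> Plus y]
  have "b \<alpha> Plus y (y + e1) = b \<beta> Plus y (y + e1) \<and> b \<alpha> Plus y (y + e2) = b \<beta> Plus y (y + e2) \<and>
    dual_succ B \<omega> (dir \<beta>) Plus y = x"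
    using edge unfolding edge_def[OF bds]
  proof (elim disjE conjE)
    assume x: "x = y - e1" and "arrow \<zeta> \<eta> e1 y"
    then obtain t \<sigma> where t: "\<zeta> \<le> t" "t \<le> \<eta>" "successor B \<omega> (dir t) \<sigma> y = y + e1"
      unfolding arrow_def[OF bds] by auto
    then have le: "b t \<sigma> y (y + e1) \<le> b t \<sigma> y (y + e2)" using successor_e1 by fastforce
    have c2: "b \<alpha> Plus y (y + e2) = b \<beta> Plus y (y + e2)" using parts(1) x by simp
    have t2: "b t \<sigma> y (y + e2) = b \<beta> Plus y (y + e2)"
      using incr2(2)[of \<alpha> t y \<sigma>] incr2(1)[of t \<beta> \<sigma> y] c2 ab t by auto
    have t1: "b \<beta> Plus y (y + e1) \<le> b t \<sigma> y (y + e1)" "b \<beta> Plus y (y + e1) \<le> b \<alpha> Plus y (y + e1)"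
      using antimono1(1)[of t \<beta> y \<sigma>] antimono1(1)[of \<alpha> \<beta> y Plus] ab t bds by auto
    have "b \<alpha> Plus y (y + e1) = b \<beta> Plus y (y + e1)"
      using w le c2 t1 t2 no_ties ab \<alpha>\<beta> by auto
    then show ?thesis using c2 x le t1 t2 by (simp add: dual_succ_Plus)
  next
    assume x: "x = y - e2" and "arrow \<zeta> \<eta> e2 y"
    then obtain t \<sigma> where t: "\<zeta> \<le> t" "t \<le> \<eta>" "successor B \<omega> (dir t) \<sigma> y = y + e2"
      unfolding arrow_def[OF bds] by auto
    then have le: "b t \<sigma> y (y + e2) \<le> b t \<sigma> y (y + e1)" using successor_e2 by fastforce
    have c1: "b \<alpha> Plus y (y + e1) = b \<beta> Plus y (y + e1)" using parts(2) x by simp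
    have t1: "b t \<sigma> y (y + e1) = b \<beta> Plus y (y + e1)"
      using antimono1(2)[of \<alpha> t \<sigma> y] antimono1(1)[of t \<beta> y \<sigma>] c1 ab t bds by auto
    have t2: "b \<alpha> Plus y (y + e2) \<le> b t \<sigma> y (y + e2)" "b \<alpha> Plus y (y + e2) \<le> b \<beta> Plus y (y + e2)"
      "b t \<sigma> y (y + e2) \<le> b \<beta> Plus y (y + e2)"
      using incr2(2)[of \<alpha> t y \<sigma>] incr2(1)[of \<alpha> \<beta> Plus y] incr2(1)[of t \<beta> \<sigma> y] ab t bds by auto
    have c2: "b \<alpha> Plus y (y + e2) = b \<beta> Plus y (y + e2)"
      using w le c1 t1 t2 no_ties ab \<alpha>\<beta> by auto
    then have "b \<beta> Plus y (y + e2) < b \<beta> Plus y (y + e1)" using le t1 t2 no_ties(2) by auto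
    then show ?thesis using c1 c2 x by (simp add: dual_succ_Plus)
  qed
  then show "\<rho> y \<alpha> Plus = \<rho> y \<beta> Plus" "dual_succ B \<omega> (dir \<beta>) Plus y = x"
    using \<rho>_below[of \<alpha> Plus y] \<rho>_below[of \<beta> Plus y] ab \<alpha>\<beta> by auto
qed

lemma inst_on_lattice_path:
  assumes no_ties: "\<And>r x. r \<in> \<rat> \<Longrightarrow> 0 < r \<Longrightarrow> r < 1 \<Longrightarrow> b r Plus x (x + e1) \<noteq> b r Plus x (x + e2)"
    and no_immortal: "\<And>r x. r \<in> \<rat> \<Longrightarrow> 0 < r \<Longrightarrow> r < 1 \<Longrightarrow> \<not> immortal (dual_succ B \<omega> (dir r) Plus) x"
    and q: "lattice_path \<zeta> \<eta> q"
  shows "inst \<zeta> \<eta> (q n)"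
proof (rule ccontr)
  assume "\<not> ?thesis"
  then obtain \<alpha>0 \<beta>0 where 0: "0 < \<alpha>0" "\<alpha>0 < \<zeta>" "\<eta> < \<beta>0" "\<beta>0 < 1" "\<rho> (q n) \<alpha>0 Plus = \<rho> (q n) \<beta>0 Plus"
    unfolding varies_def[OF bds] by auto
  \<comment> \<open>Moving the two directions towards the interval keeps the constancy and makes
    them rational, where ties are excluded.\<close>
  obtain \<alpha> \<beta> where ab: "\<alpha> \<in> \<rat>" "\<alpha>0 < \<alpha>" "\<alpha> < \<zeta>" "\<beta> \<in> \<rat>" "\<eta> < \<beta>" "\<beta> < \<beta>0"
    using Rats_dense_in_real[of \<alpha>0 \<zeta>] Rats_dense_in_real[of \<eta> \<beta>0] 0 by auto
  interpret sided_mono "\<rho> (q n)" by (rule sided_mono_\<rho>)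
  have start: "\<rho> (q n) \<alpha> Plus = \<rho> (q n) \<beta> Plus"
    using constant_within[of \<alpha>0 \<alpha> \<beta>0] constant_within[of \<alpha>0 \<beta> \<beta>0] 0 ab bds by auto
  note edge = lattice_path_edge[OF bds q, of n]
  have step: "\<rho> (q (n + int (Suc m))) \<alpha> Plus = \<rho> (q (n + int (Suc m))) \<beta> Plus \<and>
      dual_succ B \<omega> (dir \<beta>) Plus (q (n + int (Suc m))) = q (n + int m)"
    if "\<rho> (q (n + int m)) \<alpha> Plus = \<rho> (q (n + int m)) \<beta> Plus" for m
    using parent_of_constant[OF _ _ _ _ _ _ edge that] no_ties[of \<alpha> "q (n + int (Suc m))"]
      no_ties[of \<beta> "q (n + int (Suc m))"] 0 ab bds by auto
  have const: "\<rho> (q (n + int m)) \<alpha> Plus = \<rho> (q (n + int m)) \<beta> Plus" for m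
    by (induction m) (use start step in auto)
  have "immortal (dual_succ B \<omega> (dir \<beta>) Plus) (q (n + int 0))"
  proof (rule immortal_if_infinite_path)
    show "dual_succ B \<omega> (dir \<beta>) Plus (q (n + int (Suc m))) = q (n + int m)" for m
      using step[OF const] by blast
    show "q (n + int (Suc m)) = q (n + int m) + e1 \<or> q (n + int (Suc m)) = q (n + int m) + e2" for m
      using edge[of m] unfolding edge_def[OF bds] by auto
  qed
  with no_immortal[of \<beta>] ab 0 bds show False by auto
qed

text \<open>Off the support, constancy holds near each single direction of the interval;
  \<open>locally_constant_imp_constant\<close> turns this into one neighbourhood of the whole
  interval, which is the negation of \<open>varies\<close>.\<close>

lemma inst_iff_supp:
  "inst \<zeta> \<eta> x \<longleftrightarrow> dIcc (dir \<zeta>) (dir \<eta>) \<inter> supp_mu B \<omega> (x + e1) (x + e2) \<noteq> {}"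
proof
  interpret sided_mono "\<rho> x" by (rule sided_mono_\<rho>)
  show "dIcc (dir \<zeta>) (dir \<eta>) \<inter> supp_mu B \<omega> (x + e1) (x + e2) \<noteq> {}" if "inst \<zeta> \<eta> x"
  proof (rule ccontr)
    assume "\<not> ?thesis"
    moreover have "dir u \<in> dIcc (dir \<zeta>) (dir \<eta>)" if "\<zeta> \<le> u" "u \<le> \<eta>" for u
      using that bds by (simp add: dIcc_dir)
    ultimately have off: "dir u \<notin> supp_mu B \<omega> (x + e1) (x + e2)" if "\<zeta> \<le> u" "u \<le> \<eta>" for u
      using that by blast
    have "\<exists>\<alpha> \<beta>. 0 < \<alpha> \<and> \<alpha> < u \<and> u < \<beta> \<and> \<beta> < 1 \<and> \<rho> x \<alpha> Plus = \<rho> x \<beta> Plus" if u: "\<zeta> \<le> u" "u \<le> \<eta>" for u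
      by (rule locally_constant_off_supp_mu[where P = "\<rho> x" and B = B and x = "x + e1" and y = "x + e2" and \<omega> = \<omega> and u = u])
         (use off[OF u] u bds sided_mono_\<rho>[of x] in auto)
    then have "\<exists>\<alpha> \<beta>. 0 < \<alpha> \<and> \<alpha> < \<zeta> \<and> \<eta> < \<beta> \<and> \<beta> < 1 \<and> \<rho> x \<alpha> Plus = \<rho> x \<beta> Plus"
      using locally_constant_imp_constant bds by blast
    then show False using \<open>inst \<zeta> \<eta> x\<close> unfolding varies_def[OF bds] by auto
  qed
  show "inst \<zeta> \<eta> x" if "dIcc (dir \<zeta>) (dir \<eta>) \<inter> supp_mu B \<omega> (x + e1) (x + e2) \<noteq> {}"
  proof (rule ccontr)
    assume "\<not> inst \<zeta> \<eta> x"
    then obtain \<alpha> \<beta> where ab: "0 < \<alpha>" "\<alpha> < \<zeta>" "\<eta> < \<beta>" "\<beta> < 1" "\<rho> x \<alpha> Plus = \<rho> x \<beta> Plus"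
      unfolding varies_def[OF bds] by auto
    from that obtain \<xi> where \<xi>: "\<xi> \<in> dIcc (dir \<zeta>) (dir \<eta>)" "\<xi> \<in> supp_mu B \<omega> (x + e1) (x + e2)" by blast
    then obtain u where u: "\<zeta> \<le> u" "u \<le> \<eta>" "dir u \<in> supp_mu B \<omega> (x + e1) (x + e2)"
      using bds by (auto simp: dIcc_dir)
    have "dir u \<notin> supp_mu B \<omega> (x + e1) (x + e2)"
      by (rule not_in_supp_mu[where P = "\<rho> x" and N = "\<lambda>_ _. 0" and \<alpha> = \<alpha> and \<beta> = \<beta>])
         (use ab u sided_mono_\<rho>[of x] sided_mono_const[of 0] in auto)
    with u show False by simp
  qed
qed

text \<open>Exceptional directions come from arbitrary pairs of sites, instability points from pairs
  \<open>x + e1\<close>, \<open>x + e2\<close>. The bridge is a single lattice step that is not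
  locally constant at \<open>u\<close> and therefore varies.\<close>

lemma ex_inst:
  assumes "dIcc (dir \<zeta>) (dir \<eta>) \<inter> exceptional_dirs B \<omega> \<noteq> {}"
  shows "\<exists>x. inst \<zeta> \<eta> x"
proof -
  obtain u x y where u: "\<zeta> \<le> u" "u \<le> \<eta>" "dir u \<in> supp_mu B \<omega> x y"
    using assms bds by (auto simp: dIcc_dir exceptional_dirs_def)
  have "\<not> ((\<forall>z. locally_constant (\<lambda>t \<sigma>. b t \<sigma> z (z + e1)) u) \<and> (\<forall>z. locally_constant (\<lambda>t \<sigma>. b t \<sigma> z (z + e2)) u))"
    using not_in_supp_mu_if_steps_locally_constant[of u x y] u bds by fastforce
  moreover have "locally_constant \<phi> u" if "\<not> varies \<zeta> \<eta> \<phi>" for \<phi>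
    using that u unfolding varies_def[OF bds] locally_constant_def by (meson le_less_trans less_le_trans)
  ultimately show ?thesis using inst_iff_below[OF bds] by blast
qed

section \<open>The graphs of the statement expressed by sites\<close>

lemma parcs_dual_graph_Union:
  "parcs (dual_graph_Union B \<omega> (dir \<zeta>) (dir \<eta>)) = {(dual x, dual y) | x y. edge \<zeta> \<eta> x y}"
proof -
  have arr: "arrow \<zeta> \<eta> e x \<longleftrightarrow> (\<exists>\<xi> \<sigma>. \<xi> \<in> dIcc (dir \<zeta>) (dir \<eta>) \<and> (x, x + e) \<in> parcs (geo_graph B \<omega> \<xi> \<sigma>))" for e x
  proof -
    have "(x, x + e) \<in> parcs (geo_graph B \<omega> \<xi> \<sigma>) \<longleftrightarrow> successor B \<omega> \<xi> \<sigma> x = x + e" for \<xi> \<sigma>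
      by (auto simp: geo_graph_def)
    then show ?thesis unfolding arrow_def[OF bds] using bds by (auto simp: dIcc_dir)
  qed
  have single: "a \<in> parcs (dual_graph B \<omega> \<xi> \<sigma>) \<longleftrightarrow>
      (\<exists>x. a = (dual x, dual x - e1) \<and> (x, x + e1) \<in> parcs (geo_graph B \<omega> \<xi> \<sigma>)) \<or>
      (\<exists>x. a = (dual x, dual x - e2) \<and> (x, x + e2) \<in> parcs (geo_graph B \<omega> \<xi> \<sigma>))" for a \<xi> \<sigma>
    by (simp add: dual_graph_def)
  have union: "a \<in> parcs (dual_graph_Union B \<omega> (dir \<zeta>) (dir \<eta>)) \<longleftrightarrow>
      (\<exists>\<xi> \<sigma>. \<xi> \<in> dIcc (dir \<zeta>) (dir \<eta>) \<and> a \<in> parcs (dual_graph B \<omega> \<xi> \<sigma>))" for a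
    unfolding dual_graph_Union_def in_graph_Union by blast
  have "parcs (dual_graph_Union B \<omega> (dir \<zeta>) (dir \<eta>)) =
    {(dual x, dual x - e1) | x. arrow \<zeta> \<eta> e1 x} \<union> {(dual x, dual x - e2) | x. arrow \<zeta> \<eta> e2 x}"
    (is "?L = ?R")
  proof (rule set_eqI)
    fix a
    show "a \<in> ?L \<longleftrightarrow> a \<in> ?R"
      unfolding union single arr Un_iff mem_Collect_eq by blast
  qed
  also have "\<dots> = {(dual x, dual y) | x y. edge \<zeta> \<eta> x y}"
    unfolding dual_minus_e edge_def[OF bds] by blast
  finally show ?thesis .
qed

lemma pverts_dual_graph_Union: "pverts (dual_graph_Union B \<omega> (dir \<zeta>) (dir \<eta>)) = range dual"
proof -
  have "dir \<zeta> \<in> dIcc (dir \<zeta>) (dir \<eta>)" using bds by (simp add: dIcc_dir)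
  moreover have "pverts (dual_graph B \<omega> \<xi> \<sigma>) = range dual" for \<xi> \<sigma> by (simp add: dual_graph_def)
  moreover have "v \<in> pverts (dual_graph_Union B \<omega> (dir \<zeta>) (dir \<eta>)) \<longleftrightarrow>
      (\<exists>\<xi> \<sigma>. \<xi> \<in> dIcc (dir \<zeta>) (dir \<eta>) \<and> v \<in> pverts (dual_graph B \<omega> \<xi> \<sigma>))" for v
    unfolding dual_graph_Union_def in_graph_Union by blast
  ultimately show ?thesis by blast
qed

lemma bi_infinite_path_iff:
  "bi_infinite_path (dual_graph_Union B \<omega> (dir \<zeta>) (dir \<eta>)) p \<longleftrightarrow>
    (\<exists>q. p = (\<lambda>n. dual (q n)) \<and> lattice_path \<zeta> \<eta> q)"
proof
  assume p: "bi_infinite_path (dual_graph_Union B \<omega> (dir \<zeta>) (dir \<eta>)) p"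
  then have "\<forall>n. \<exists>x. p n = dual x"
    unfolding bi_infinite_path_def pverts_dual_graph_Union by blast
  then obtain q where q: "\<And>n. p n = dual (q n)" by metis
  have "lattice_path \<zeta> \<eta> q"
    unfolding lattice_path_def[OF bds]
  proof (intro allI conjI)
    fix n
    have "real_of_int (level (q n) + 1) = real_of_int n"
      using p q[of n] dual_inner_ehat[of "q n"] unfolding bi_infinite_path_def by metis
    then show "level (q n) = n - 1" by linarith
    have "(dual (q n), dual (q (n - 1))) \<in> parcs (dual_graph_Union B \<omega> (dir \<zeta>) (dir \<eta>))"
      using p q unfolding bi_infinite_path_def by metis
    then show "edge \<zeta> \<eta> (q n) (q (n - 1))"
      unfolding parcs_dual_graph_Union by auto
  qed
  with q show "\<exists>q. p = (\<lambda>n. dual (q n)) \<and> lattice_path \<zeta> \<eta> q" by blast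
next
  assume "\<exists>q. p = (\<lambda>n. dual (q n)) \<and> lattice_path \<zeta> \<eta> q"
  then obtain q where q: "p = (\<lambda>n. dual (q n))" "\<And>n. level (q n) = n - 1" "\<And>n. edge \<zeta> \<eta> (q n) (q (n - 1))"
    unfolding lattice_path_def[OF bds] by blast
  then show "bi_infinite_path (dual_graph_Union B \<omega> (dir \<zeta>) (dir \<eta>)) p"
    unfolding bi_infinite_path_def pverts_dual_graph_Union parcs_dual_graph_Union
    by (auto simp: dual_inner_ehat)
qed

lemma instability_graph_structure:
  assumes on_path: "\<And>q n. lattice_path \<zeta> \<eta> q \<Longrightarrow> inst \<zeta> \<eta> (q n)"
  shows "pair_wf_digraph (instability_graph B \<omega> (dir \<zeta>) (dir \<eta>))"
    and "instability_graph B \<omega> (dir \<zeta>) (dir \<eta>) =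
      graph_Union {path_graph p | p. bi_infinite_path (dual_graph_Union B \<omega> (dir \<zeta>) (dir \<eta>)) p}"
    and "\<exists>x. inst \<zeta> \<eta> x \<Longrightarrow> infinite (pverts (instability_graph B \<omega> (dir \<zeta>) (dir \<eta>)))"
proof -
  have points: "instability_points B \<omega> (dir \<zeta>) (dir \<eta>) = {dual x | x. inst \<zeta> \<eta> x}"
    unfolding instability_points_def inst_iff_supp ..
  have verts: "pverts (instability_graph B \<omega> (dir \<zeta>) (dir \<eta>)) = {dual x | x. inst \<zeta> \<eta> x}"
    by (simp add: instability_graph_def points)
  have arcs: "parcs (instability_graph B \<omega> (dir \<zeta>) (dir \<eta>)) =
      {(dual x, dual y) | x y. edge \<zeta> \<eta> x y \<and> inst \<zeta> \<eta> x \<and> inst \<zeta> \<eta> y}"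
    unfolding instability_graph_def points parcs_dual_graph_Union by auto
  show "pair_wf_digraph (instability_graph B \<omega> (dir \<zeta>) (dir \<eta>))"
    by unfold_locales (auto simp: verts arcs)
  let ?U = "graph_Union {path_graph p | p. bi_infinite_path (dual_graph_Union B \<omega> (dir \<zeta>) (dir \<eta>)) p}"
  have path: "v \<in> pverts (path_graph p) \<longleftrightarrow> (\<exists>n. v = p n)" "a \<in> parcs (path_graph p) \<longleftrightarrow> (\<exists>n. a = (p n, p (n - 1)))"
    for v a p by (auto simp: path_graph_def)
  have Uverts: "pverts ?U = {dual (q n) | q n. lattice_path \<zeta> \<eta> q}"
  proof (intro set_eqI)
    fix v
    have "v \<in> pverts ?U \<longleftrightarrow> (\<exists>p. bi_infinite_path (dual_graph_Union B \<omega> (dir \<zeta>) (dir \<eta>)) p \<and> (\<exists>n. v = p n))"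
      unfolding in_graph_Union path[symmetric] by blast
    then show "v \<in> pverts ?U \<longleftrightarrow> v \<in> {dual (q n) | q n. lattice_path \<zeta> \<eta> q}"
      unfolding bi_infinite_path_iff by blast
  qed
  have Uarcs: "parcs ?U = {(dual (q n), dual (q (n - 1))) | q n. lattice_path \<zeta> \<eta> q}"
  proof (intro set_eqI)
    fix a
    have "a \<in> parcs ?U \<longleftrightarrow> (\<exists>p. bi_infinite_path (dual_graph_Union B \<omega> (dir \<zeta>) (dir \<eta>)) p \<and> (\<exists>n. a = (p n, p (n - 1))))"
      unfolding in_graph_Union path[symmetric] by blast
    then show "a \<in> parcs ?U \<longleftrightarrow> a \<in> {(dual (q n), dual (q (n - 1))) | q n. lattice_path \<zeta> \<eta> q}"
      unfolding bi_infinite_path_iff by blast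
  qed
  have "{dual x | x. inst \<zeta> \<eta> x} = {dual (q n) | q n. lattice_path \<zeta> \<eta> q}"
  proof (intro equalityI subsetI)
    fix v assume "v \<in> {dual x | x. inst \<zeta> \<eta> x}"
    then obtain x where x: "v = dual x" "inst \<zeta> \<eta> x" by blast
    then obtain y where y: "edge \<zeta> \<eta> x y" "inst \<zeta> \<eta> y" using inst_child[OF bds] by blast
    obtain q where q: "lattice_path \<zeta> \<eta> q" "q (level x + 1) = x" "q (level x) = y"
      by (rule inst_extend[OF bds y(1) x(2) y(2)])
    then have "v = dual (q (level x + 1))" using x by simp
    then show "v \<in> {dual (q n) | q n. lattice_path \<zeta> \<eta> q}" using q by blast
  qed (use on_path in blast)
  moreover have "{(dual x, dual y) | x y. edge \<zeta> \<eta> x y \<and> inst \<zeta> \<eta> x \<and> inst \<zeta> \<eta> y} =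
      {(dual (q n), dual (q (n - 1))) | q n. lattice_path \<zeta> \<eta> q}"
  proof (intro equalityI subsetI)
    fix v assume "v \<in> {(dual x, dual y) | x y. edge \<zeta> \<eta> x y \<and> inst \<zeta> \<eta> x \<and> inst \<zeta> \<eta> y}"
    then obtain x y where x: "v = (dual x, dual y)" "edge \<zeta> \<eta> x y" "inst \<zeta> \<eta> x" "inst \<zeta> \<eta> y" by blast
    obtain q where q: "lattice_path \<zeta> \<eta> q" "q (level x + 1) = x" "q (level x) = y"
      by (rule inst_extend[OF bds x(2-4)])
    then have "v = (dual (q (level x + 1)), dual (q (level x + 1 - 1)))" using x by simp
    then show "v \<in> {(dual (q n), dual (q (n - 1))) | q n. lattice_path \<zeta> \<eta> q}" using q by blast
  next
    fix v assume "v \<in> {(dual (q n), dual (q (n - 1))) | q n. lattice_path \<zeta> \<eta> q}"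
    then obtain q n where "v = (dual (q n), dual (q (n - 1)))" "lattice_path \<zeta> \<eta> q" by blast
    then show "v \<in> {(dual x, dual y) | x y. edge \<zeta> \<eta> x y \<and> inst \<zeta> \<eta> x \<and> inst \<zeta> \<eta> y}"
      using on_path unfolding lattice_path_def[OF bds] by blast
  qed
  ultimately show "instability_graph B \<omega> (dir \<zeta>) (dir \<eta>) = ?U"
    using verts arcs Uverts Uarcs by (intro pair_pre_digraph.equality) simp_all
  show "infinite (pverts (instability_graph B \<omega> (dir \<zeta>) (dir \<eta>)))" if ex: "\<exists>x. inst \<zeta> \<eta> x"
  proof -
    obtain x y where xy: "inst \<zeta> \<eta> x" "edge \<zeta> \<eta> x y" "inst \<zeta> \<eta> y" using ex inst_child[OF bds] by blast
    obtain q where q: "lattice_path \<zeta> \<eta> q" by (rule inst_extend[OF bds xy(2,1,3)])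
    have "inj q"
    proof (rule injI)
      fix m n assume eq: "q m = q n"
      have lev: "level (q k) = k - 1" for k using q unfolding lattice_path_def[OF bds] by blast
      from trans[OF sym[OF lev[of m, unfolded eq]] lev[of n]] show "m = n" by linarith
    qed
    then have "inj (\<lambda>n. dual (q n))" by (simp add: inj_def)
    then have "infinite (range (\<lambda>n. dual (q n)))" using finite_imageD infinite_UNIV_int by blast
    moreover have "range (\<lambda>n. dual (q n)) \<subseteq> pverts (instability_graph B \<omega> (dir \<zeta>) (dir \<eta>))"
      using on_path[OF q] unfolding verts by blast
    ultimately show ?thesis by (rule infinite_super[rotated])
  qed
qed

end

end

section \<open>Directedness\<close>

lemma finite_quadrant_sphere: "finite (quadrant_sphere n)"
proof (rule finite_subset)
  show "quadrant_sphere n \<subseteq> {0..int n} \<times> {0..int n}"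
    by (auto simp: quadrant_sphere_def level_def less_eq_prod_def)
qed simp

lemma limit_of_quadrant_spheres:
  assumes x: "\<And>n. x n \<in> quadrant_sphere n" and r: "strict_mono r"
    and lim: "(\<lambda>k. (1 / real (r k)) *\<^sub>R emb (x (r k))) \<longlonglongrightarrow> l"
  obtains s where "l = dir s" "0 \<le> s" "s \<le> 1"
proof -
  have ev: "\<forall>\<^sub>F k in sequentially. (1 / real (r k)) *\<^sub>R emb (x (r k)) \<in> segU"
    unfolding eventually_sequentially
  proof (intro exI allI impI)
    fix k :: nat assume "1 \<le> k"
    then have pos: "0 < r k" using strict_mono_imp_increasing[OF r, of k] by linarith
    define i where "i = fst (x (r k))"
    have i: "0 \<le> i" "i \<le> int (r k)" "x (r k) = (i, int (r k) - i)"
      using x[of "r k"] by (auto simp: i_def quadrant_sphere_def level_def less_eq_prod_def prod_eq_iff)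
    then have "(1 / real (r k)) *\<^sub>R emb (x (r k)) = dir (real_of_int i / real (r k))"
      using pos by (simp add: emb_def dir_def field_simps)
    moreover have "0 \<le> real_of_int i / real (r k)" "real_of_int i / real (r k) \<le> 1"
      using i pos by (auto simp: divide_le_eq)
    ultimately show "(1 / real (r k)) *\<^sub>R emb (x (r k)) \<in> segU"
      by (auto simp: segU_eq)
  qed
  have "closed segU"
    unfolding segU_eq by (intro compact_imp_closed compact_continuous_image continuous_on_dir compact_Icc)
  then have "l \<in> segU" by (rule Lim_in_closed_set[OF _ ev _ lim]) simp
  then show ?thesis using that by (auto simp: segU_eq)
qed

definition linear_growth :: "(site \<Rightarrow> real) \<Rightarrow> point \<Rightarrow> bool" where
  "linear_growth \<beta> v \<longleftrightarrow>
     (\<lambda>n. Max ((\<lambda>x. \<bar>\<beta> x - emb x \<bullet> v\<bar>) ` quadrant_sphere n) / real n) \<longlonglongrightarrow> 0"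

lemma linear_growth_limit:
  assumes \<beta>: "linear_growth \<beta> v" and x: "\<And>n. x n \<in> quadrant_sphere n" and r: "strict_mono r"
    and lim: "(\<lambda>k. (1 / real (r k)) *\<^sub>R emb (x (r k))) \<longlonglongrightarrow> l"
  shows "(\<lambda>k. \<beta> (x (r k)) / real (r k)) \<longlonglongrightarrow> l \<bullet> v"
proof -
  define err where "err n = Max ((\<lambda>x. \<bar>\<beta> x - emb x \<bullet> v\<bar>) ` quadrant_sphere n) / real n" for n
  have "err \<longlonglongrightarrow> 0" using \<beta> by (simp add: linear_growth_def err_def[abs_def])
  then have err0: "(\<lambda>k. err (r k)) \<longlonglongrightarrow> 0" using LIMSEQ_subseq_LIMSEQ[OF _ r] by (auto simp: o_def)
  have le: "\<bar>\<beta> (x n) / real n - ((1 / real n) *\<^sub>R emb (x n)) \<bullet> v\<bar> \<le> err n" for n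
  proof -
    have "\<beta> (x n) / real n - ((1 / real n) *\<^sub>R emb (x n)) \<bullet> v = (\<beta> (x n) - emb (x n) \<bullet> v) / real n"
      by (simp add: diff_divide_distrib)
    also have "\<bar>\<dots>\<bar> = \<bar>\<beta> (x n) - emb (x n) \<bullet> v\<bar> / real n" by simp
    also have "\<dots> \<le> err n"
      unfolding err_def by (intro divide_right_mono Max_ge) (use x finite_quadrant_sphere in auto)
    finally show ?thesis .
  qed
  have "(\<lambda>k. \<beta> (x (r k)) / real (r k) - ((1 / real (r k)) *\<^sub>R emb (x (r k))) \<bullet> v) \<longlonglongrightarrow> 0"
    by (rule Lim_null_comparison[OF always_eventually[OF allI] err0]) (simp only: real_norm_def le)
  from tendsto_add[OF this tendsto_inner[OF lim tendsto_const[of v]]] show ?thesis by simp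
qed

context busemann_sample
begin

context
  fixes \<zeta> \<eta> :: real and g :: "point \<Rightarrow> real"
  assumes bds: "0 < \<zeta>" "\<zeta> \<le> \<eta>" "\<eta> < 1"
    and g: "concave_shape g"
    and growth: "\<And>r z. r \<in> \<rat> \<Longrightarrow> 0 < r \<Longrightarrow> r < 1 \<Longrightarrow>
      linear_growth (\<lambda>x. b r Plus z (z + x)) (grad g (dir r) Plus)"
begin

interpretation concave_shape g by (rule g)

text \<open>After division by the length of the displacement, an ordering of two Busemann functions
  becomes an ordering of two tangents of the profile at \<open>s\<close>.\<close>

lemma tangents_ordered_along_limit:
  assumes x: "\<And>n. x n \<in> quadrant_sphere n" and r: "strict_mono r"
    and lim: "(\<lambda>k. (1 / real (r k)) *\<^sub>R emb (x (r k))) \<longlonglongrightarrow> dir s"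
    and rat: "\<beta> \<in> \<rat>" "0 < \<beta>" "\<beta> < 1" "\<beta>' \<in> \<rat>" "0 < \<beta>'" "\<beta>' < 1"
    and le: "\<And>n. b \<beta> Plus z (z + x n) \<le> b \<beta>' Plus z (z + x n)"
  shows "f \<beta> + side_deriv f Plus \<beta> * (s - \<beta>) \<le> f \<beta>' + side_deriv f Plus \<beta>' * (s - \<beta>')"
proof -
  have "(\<lambda>k. b \<beta> Plus z (z + x (r k)) / real (r k)) \<longlonglongrightarrow> dir s \<bullet> grad g (dir \<beta>) Plus"
    using linear_growth_limit[OF growth[OF rat(1-3)] x r lim] .
  moreover have "(\<lambda>k. b \<beta>' Plus z (z + x (r k)) / real (r k)) \<longlonglongrightarrow> dir s \<bullet> grad g (dir \<beta>') Plus"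
    using linear_growth_limit[OF growth[OF rat(4-6)] x r lim] .
  ultimately have "dir s \<bullet> grad g (dir \<beta>) Plus \<le> dir s \<bullet> grad g (dir \<beta>') Plus"
    by (rule LIMSEQ_le) (use le in \<open>auto intro!: divide_right_mono\<close>)
  then show ?thesis using rat by (simp add: dir_inner_grad)
qed

lemma increments_along_path:
  assumes q: "lattice_path \<zeta> \<eta> q" and ab: "0 < \<beta>" "\<beta> < 1" "0 < \<beta>'" "\<beta>' < 1"
    and step: "\<And>x y. edge \<zeta> \<eta> y x \<Longrightarrow> b \<beta> Plus (x + e) (y + e) \<le> b \<beta>' Plus (x + e) (y + e)"
  shows "b \<beta> Plus (q 0 + e) (q 0 + e + (q (int n) - q 0)) \<le> b \<beta>' Plus (q 0 + e) (q 0 + e + (q (int n) - q 0))"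
proof -
  have "b \<beta> Plus (q 0 + e) (q (int n) + e) \<le> b \<beta>' Plus (q 0 + e) (q (int n) + e)"
  proof (induction n)
    case 0
    then show ?case using b_refl ab by simp
  next
    case (Suc n)
    have "edge \<zeta> \<eta> (q (int (Suc n))) (q (int n))" using lattice_path_edge[OF bds q, of 0 n] by simp
    from step[OF this] Suc show ?case
      using cocycle[of \<beta> Plus "q 0 + e" "q (int n) + e" "q (int (Suc n)) + e"]
        cocycle[of \<beta>' Plus "q 0 + e" "q (int n) + e" "q (int (Suc n)) + e"] ab by linarith
  qed
  then show ?thesis by (simp add: algebra_simps)
qed

text \<open>Translated by \<open>e1\<close>, every horizontal step of a dual path follows a primal edge which is used in
  all directions \<open>\<beta>\<close> beyond \<open>\<eta>\<close>, so that its Busemann increment is the weight, the smallest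
  possible value; vertical increments increase with \<open>\<beta>\<close> anyway.\<close>
lemma increment_right:
  assumes edge: "edge \<zeta> \<eta> y x" and ab: "\<eta> < \<beta>" "\<beta> < \<beta>'" "\<beta>' < 1"
  shows "b \<beta> Plus (x + e1) (y + e1) \<le> b \<beta>' Plus (x + e1) (y + e1)"
  using edge unfolding edge_def[OF bds]
proof (elim disjE conjE)
  assume x: "x = y - e1" and "arrow \<zeta> \<eta> e1 y"
  then obtain t \<sigma> where t: "\<zeta> \<le> t" "t \<le> \<eta>" "successor B \<omega> (dir t) \<sigma> y = y + e1"
    unfolding arrow_def[OF bds] by auto
  then have "b t \<sigma> y (y + e1) \<le> b t \<sigma> y (y + e2)" using successor_e1 by fastforce
  then have "b t \<sigma> y (y + e1) = w y"
    using w_cases[of t \<sigma> y] w_le[of t y \<sigma>] t bds by auto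
  then have "b \<beta> Plus y (y + e1) \<le> w y" using antimono1(1)[of t \<beta> y \<sigma>] t ab bds by auto
  also have "w y \<le> b \<beta>' Plus y (y + e1)" using w_le(1)[of \<beta>' y Plus] ab bds by auto
  finally show ?thesis by (simp add: x)
next
  assume x: "x = y - e2"
  have y: "y + e1 = (x + e1) + e2" by (simp add: x)
  show ?thesis unfolding y using ab bds by (intro incr2) auto
qed

lemma increment_left:
  assumes edge: "edge \<zeta> \<eta> y x" and ab: "0 < \<beta>'" "\<beta>' < \<beta>" "\<beta> < \<zeta>"
  shows "b \<beta> Plus (x + e2) (y + e2) \<le> b \<beta>' Plus (x + e2) (y + e2)"
  using edge unfolding edge_def[OF bds]
proof (elim disjE conjE)
  assume x: "x = y - e2" and "arrow \<zeta> \<eta> e2 y"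
  then obtain t \<sigma> where t: "\<zeta> \<le> t" "t \<le> \<eta>" "successor B \<omega> (dir t) \<sigma> y = y + e2"
    unfolding arrow_def[OF bds] by auto
  then have "b t \<sigma> y (y + e2) \<le> b t \<sigma> y (y + e1)" using successor_e2 by fastforce
  then have "b t \<sigma> y (y + e2) = w y"
    using w_cases[of t \<sigma> y] w_le[of t y \<sigma>] t bds by auto
  then have "b \<beta> Plus y (y + e2) \<le> w y" using incr2(2)[of \<beta> t y \<sigma>] t ab bds by auto
  also have "w y \<le> b \<beta>' Plus y (y + e2)" using w_le(2)[of \<beta>' y Plus] ab bds by auto
  finally show ?thesis by (simp add: x)
next
  assume x: "x = y - e1"
  have y: "y + e2 = (x + e2) + e1" by (simp add: x)
  show ?thesis unfolding y using ab bds by (intro antimono1) auto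
qed

lemma lattice_path_directed:
  assumes q: "lattice_path \<zeta> \<eta> q"
    and ends: "lower_end g (dir \<zeta>) = dir l" "upper_end g (dir \<eta>) = dir h" "0 < l" "l \<le> \<zeta>" "\<eta> \<le> h" "h < 1"
    and contact: "contact Minus \<zeta> \<subseteq> {l..}" "contact Plus \<eta> \<subseteq> {..h}"
  shows "backward_directed (dIcc (lower_end g (dir \<zeta>)) (upper_end g (dir \<eta>))) (\<lambda>n. dual (q n))"
  unfolding backward_directed_def limit_points_def
proof safe
  fix v r assume r: "strict_mono r" and lim: "((\<lambda>n. (1 / real n) *\<^sub>R dual (q (int n))) \<circ> r) \<longlonglongrightarrow> v"
  \<comment> \<open>Displacements instead of positions lie in the quadrant, where the shape theorem
    applies; the offset \<open>dual (q 0)\<close> disappears after division by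
    \<open>n\<close>.\<close>
  define x where "x n = q (int n) - q 0" for n
  have x: "x n \<in> quadrant_sphere n" for n
  proof -
    have "0 \<le> x n"
    proof (induction n)
      case (Suc n)
      have "edge \<zeta> \<eta> (q (int (Suc n))) (q (int n))" using lattice_path_edge[OF bds q, of 0 n] by simp
      then have "q (int (Suc n)) = q (int n) + e1 \<or> q (int (Suc n)) = q (int n) + e2"
        unfolding edge_def[OF bds] by auto
      then have "x (Suc n) = x n + e1 \<or> x (Suc n) = x n + e2"
        unfolding x_def by (auto simp: algebra_simps)
      then show ?case using Suc le_add_e[of "x n"] by (metis order_trans)
    qed (simp add: x_def)
    moreover have "level (q (int n)) = int n - 1" "level (q 0) = 0 - 1"
      using q unfolding lattice_path_def[OF bds] by blast+
    then have "level (x n) = int n" by (simp add: x_def level_def)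
    ultimately show ?thesis by (simp add: quadrant_sphere_def)
  qed
  have "(1 / real n) *\<^sub>R dual (q (int n)) - (1 / real n) *\<^sub>R dual (q 0) = (1 / real n) *\<^sub>R emb (x n)" for n
    by (simp add: x_def dual_def emb_def prod_eq_iff algebra_simps)
  moreover have "(\<lambda>k. (1 / real (r k)) *\<^sub>R dual (q (int (r k))) - (1 / real (r k)) *\<^sub>R dual (q 0)) \<longlonglongrightarrow> v - 0 *\<^sub>R dual (q 0)"
  proof (intro tendsto_diff tendsto_scaleR tendsto_const)
    show "(\<lambda>k. (1 / real (r k)) *\<^sub>R dual (q (int (r k)))) \<longlonglongrightarrow> v" using lim by (simp add: o_def)
    show "(\<lambda>k. 1 / real (r k)) \<longlonglongrightarrow> 0"
      using LIMSEQ_subseq_LIMSEQ[OF lim_1_over_n r] by (simp add: o_def)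
  qed
  ultimately have xlim: "(\<lambda>k. (1 / real (r k)) *\<^sub>R emb (x (r k))) \<longlonglongrightarrow> v" by simp
  obtain s where s: "v = dir s" "0 \<le> s" "s \<le> 1" by (rule limit_of_quadrant_spheres[OF x r xlim])
  note xlim = xlim[unfolded s(1)]
  have "s \<le> h"
  proof (rule right_of_contact_bounded[OF _ bds(3) s(3) ends(5) contact(2)])
    fix \<beta> \<beta>' assume ab: "\<beta> \<in> \<rat>" "\<beta>' \<in> \<rat>" "\<eta> < \<beta>" "\<beta> < \<beta>'" "\<beta>' < 1"
    have "b \<beta> Plus (q 0 + e1) (q 0 + e1 + x n) \<le> b \<beta>' Plus (q 0 + e1) (q 0 + e1 + x n)" for n
      unfolding x_def by (rule increments_along_path[OF q _ _ _ _ increment_right[OF _ ab(3-5)]]) (use ab bds in auto)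
    then show "f \<beta> + side_deriv f Plus \<beta> * (s - \<beta>) \<le> f \<beta>' + side_deriv f Plus \<beta>' * (s - \<beta>')"
      using ab bds by (intro tangents_ordered_along_limit[OF x r xlim]) auto
  qed (use bds in simp)
  moreover have "l \<le> s"
  proof (rule left_of_contact_bounded[OF bds(1) _ s(2) ends(4) contact(1)])
    fix \<beta> \<beta>' assume ab: "\<beta> \<in> \<rat>" "\<beta>' \<in> \<rat>" "0 < \<beta>'" "\<beta>' < \<beta>" "\<beta> < \<zeta>"
    have "b \<beta> Plus (q 0 + e2) (q 0 + e2 + x n) \<le> b \<beta>' Plus (q 0 + e2) (q 0 + e2 + x n)" for n
      unfolding x_def by (rule increments_along_path[OF q _ _ _ _ increment_left[OF _ ab(3-5)]]) (use ab bds in auto)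
    then show "f \<beta> + side_deriv f Plus \<beta> * (s - \<beta>) \<le> f \<beta>' + side_deriv f Plus \<beta>' * (s - \<beta>')"
      using ab bds by (intro tangents_ordered_along_limit[OF x r xlim]) auto
  qed (use bds in simp)
  ultimately show "v \<in> dIcc (lower_end g (dir \<zeta>)) (upper_end g (dir \<eta>))"
    using s ends by (simp add: dIcc_dir)
qed

end

end

section \<open>Corners of the segment of directions and almost sure properties\<close>

lemma filterlim_dir_0: "filterlim dir (at e2 within riU) (at_right 0)"
  and filterlim_dir_1: "filterlim dir (at e1 within riU) (at_left 1)"
proof -
  have d: "dir 0 = e2" "dir 1 = e1" by (simp_all add: dir_def e1_def e2_def)
  have "isCont dir t" for t
    using continuous_on_dir[of UNIV] by (simp add: continuous_on_eq_continuous_at)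
  then have "(dir \<longlongrightarrow> dir t) (at t within S)" for t S
    by (meson isCont_def tendsto_within_subset subset_UNIV)
  then have lim: "(dir \<longlongrightarrow> e2) (at_right 0)" "(dir \<longlongrightarrow> e1) (at_left 1)"
    unfolding d[symmetric] by blast+
  have "\<forall>\<^sub>F t in at_right (0::real). t \<in> {0<..<1}" by (intro eventually_at_right_real) simp
  then have "\<forall>\<^sub>F t in at_right 0. dir t \<in> riU \<and> dir t \<noteq> e2"
    by eventually_elim (simp add: d(1)[symmetric])
  with lim(1) show "filterlim dir (at e2 within riU) (at_right 0)" by (simp add: filterlim_at)
  have "\<forall>\<^sub>F t in at_left (1::real). t \<in> {0<..<1}" by (intro eventually_at_left_real) simp
  then have "\<forall>\<^sub>F t in at_left 1. dir t \<in> riU \<and> dir t \<noteq> e1"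
    by eventually_elim (simp add: d(2)[symmetric])
  with lim(2) show "filterlim dir (at e1 within riU) (at_left 1)" by (simp add: filterlim_at)
qed

lemma not_filterlim_at_top_if_constant:
  fixes \<phi> :: "real \<Rightarrow> real"
  assumes "filterlim \<phi> at_top F" "\<forall>\<^sub>F t in F. \<phi> t = c" "F \<noteq> bot"
  shows False
proof -
  have "\<forall>\<^sub>F t in F. c < \<phi> t" using assms(1) by (simp add: filterlim_at_top_dense)
  with assms(2) have "\<forall>\<^sub>F t in F. False" by eventually_elim simp
  with assms(3) show False by (simp add: eventually_False)
qed

context busemann_process
begin

lemma concave_shape: "concave_shape g"
  using shape unfolding shape_function_def by unfold_locales auto

text \<open>A gradient that is constant near a corner would make the Busemann functions constant
  there, against their blow-up. The conclusion is deterministic, so a single sample with both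
  properties suffices.\<close>

lemma grad_nonconstant_near_boundary:
  assumes r: "0 < r" "r < 1"
  shows "\<exists>s\<in>{0<..<r}. \<exists>s'\<in>{0<..<r}. grad g (dir s) Plus \<noteq> grad g (dir s') Plus"
    and "\<exists>s\<in>{r<..<1}. \<exists>s'\<in>{r<..<1}. grad g (dir s) Plus \<noteq> grad g (dir s') Plus"
proof -
  obtain \<omega> where det: "\<forall>\<zeta>\<in>riU. \<forall>\<eta>\<in>riU. \<forall>\<sigma>. grad g \<zeta> \<sigma> = grad g \<eta> \<sigma> \<longrightarrow> (\<forall>x y. B \<zeta> \<sigma> x y \<omega> = B \<eta> \<sigma> x y \<omega>)"
    and blow: "\<forall>\<sigma> x. filterlim (\<lambda>\<xi>. B \<xi> \<sigma> x (x + e1) \<omega>) at_top (at e2 within riU) \<and>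
     filterlim (\<lambda>\<xi>. B \<xi> \<sigma> x (x + e2) \<omega>) at_top (at e1 within riU)"
    using eventually_happens'[OF ae_filter_bot eventually_conj[OF B_grad_determined AE_blow_up]] by blast
  have \<omega>: "B (dir s) Plus x y \<omega> = B (dir s') Plus x y \<omega>"
    if "0 < s" "s < 1" "0 < s'" "s' < 1" "grad g (dir s) Plus = grad g (dir s') Plus" for s s' x y
    using det[rule_format, of "dir s" "dir s'" Plus x y] that by simp
  have up: "filterlim (\<lambda>\<xi>. B \<xi> Plus 0 (0 + e1) \<omega>) at_top (at e2 within riU)"
      "filterlim (\<lambda>\<xi>. B \<xi> Plus 0 (0 + e2) \<omega>) at_top (at e1 within riU)"
    using blow by blast+
  have vary: "\<exists>s\<in>I. \<exists>s'\<in>I. grad g (dir s) Plus \<noteq> grad g (dir s') Plus"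
    if I: "I \<subseteq> {0<..<1}" "s0 \<in> I" "\<forall>\<^sub>F s in F. s \<in> I" "F \<noteq> bot"
      and top: "filterlim (\<lambda>s. B (dir s) Plus 0 (0 + e) \<omega>) at_top F" for I s0 F e
  proof (rule ccontr)
    assume *: "\<not> ?thesis"
    have "B (dir s) Plus 0 (0 + e) \<omega> = B (dir s0) Plus 0 (0 + e) \<omega>" if "s \<in> I" for s
    proof (rule \<omega>)
      show "grad g (dir s) Plus = grad g (dir s0) Plus" using * that I(2) by blast
    qed (use that I(1,2) in auto)
    then have "\<forall>\<^sub>F s in F. B (dir s) Plus 0 (0 + e) \<omega> = B (dir s0) Plus 0 (0 + e) \<omega>"
      by (intro eventually_mono[OF I(3)])
    from not_filterlim_at_top_if_constant[OF top this I(4)] show False .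
  qed
  show "\<exists>s\<in>{0<..<r}. \<exists>s'\<in>{0<..<r}. grad g (dir s) Plus \<noteq> grad g (dir s') Plus"
    by (rule vary[of _ "r / 2", OF _ _ eventually_at_right_real _ filterlim_compose[OF up(1) filterlim_dir_0]])
      (use r in auto)
  show "\<exists>s\<in>{r<..<1}. \<exists>s'\<in>{r<..<1}. grad g (dir s) Plus \<noteq> grad g (dir s') Plus"
    by (rule vary[of _ "(1 + r) / 2", OF _ _ eventually_at_left_real _ filterlim_compose[OF up(2) filterlim_dir_1]])
      (use r in auto)
qed

lemma lin_seg_bounds:
  assumes t: "0 < t" "t < 1"
  shows "\<exists>a b. 0 < a \<and> a \<le> t \<and> t \<le> b \<and> b < 1 \<and> lower_end g (dir t) = dir a \<and> upper_end g (dir t) = dir b \<and>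
    (\<forall>\<sigma>. concave_profile.contact (\<lambda>t. g (dir t)) \<sigma> t \<subseteq> {a..b})"
proof -
  interpret concave_shape g by (rule concave_shape)
  show ?thesis
  proof (rule lin_seg_ends[OF t])
    show "\<exists>s\<in>{0<..<r}. \<exists>s'\<in>{0<..<r}. grad g (dir s) Plus \<noteq> grad g (dir s') Plus" if "0 < r" "r < 1" for r
      by (rule grad_nonconstant_near_boundary(1)[OF that])
    show "\<exists>s\<in>{r<..<1}. \<exists>s'\<in>{r<..<1}. grad g (dir s) Plus \<noteq> grad g (dir s') Plus" if "0 < r" "r < 1" for r
      by (rule grad_nonconstant_near_boundary(2)[OF that])
  qed blast
qed

lemma AE_busemann_sample: "AE \<omega> in M. busemann_sample B \<omega> (\<lambda>x. wt x \<omega>)"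
  using AE_cocycle AE_recovery AE_monotone AE_one_sided_limits
proof eventually_elim
  case (elim \<omega>)
  have lim: "((\<lambda>s. B (dir s) \<sigma> x y \<omega>) \<longlongrightarrow> B (dir t) Minus x y \<omega>) (at_left t)"
    "((\<lambda>s. B (dir s) \<sigma> x y \<omega>) \<longlongrightarrow> B (dir t) Plus x y \<omega>) (at_right t)"
    if t: "0 < t" "t < 1" for t \<sigma> x y
  proof -
    have "isCont dir t"
      using continuous_on_dir[of UNIV] by (simp add: continuous_on_eq_continuous_at)
    then have d: "(dir \<longlongrightarrow> dir t) (at t within S)" for S
      by (meson isCont_def tendsto_within_subset subset_UNIV)
    have "\<forall>\<^sub>F s in at_left t. s \<in> {0<..<t}" using t by (intro eventually_at_left_real)
    then have "\<forall>\<^sub>F s in at_left t. dir s \<in> {\<zeta>\<in>riU. dprec \<zeta> (dir t)} \<and> dir s \<noteq> dir t"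
      by eventually_elim (use t in simp)
    with d have l: "filterlim dir (at (dir t) within {\<zeta>\<in>riU. dprec \<zeta> (dir t)}) (at_left t)"
      by (simp add: filterlim_at)
    have "\<forall>\<^sub>F s in at_right t. s \<in> {t<..<1}" using t by (intro eventually_at_right_real)
    then have "\<forall>\<^sub>F s in at_right t. dir s \<in> {\<zeta>\<in>riU. dprec (dir t) \<zeta>} \<and> dir s \<noteq> dir t"
      by eventually_elim (use t in simp)
    with d have r: "filterlim dir (at (dir t) within {\<zeta>\<in>riU. dprec (dir t) \<zeta>}) (at_right t)"
      by (simp add: filterlim_at)
    have "dir t \<in> riU" using t by simp
    with elim(4) have *: "((\<lambda>\<zeta>. B \<zeta> \<sigma> x y \<omega>) \<longlongrightarrow> B (dir t) Minus x y \<omega>) (at (dir t) within {\<zeta>\<in>riU. dprec \<zeta> (dir t)})"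
      "((\<lambda>\<zeta>. B \<zeta> \<sigma> x y \<omega>) \<longlongrightarrow> B (dir t) Plus x y \<omega>) (at (dir t) within {\<zeta>\<in>riU. dprec (dir t) \<zeta>})"
      by blast+
    show "((\<lambda>s. B (dir s) \<sigma> x y \<omega>) \<longlongrightarrow> B (dir t) Minus x y \<omega>) (at_left t)"
      "((\<lambda>s. B (dir s) \<sigma> x y \<omega>) \<longlongrightarrow> B (dir t) Plus x y \<omega>) (at_right t)"
      using filterlim_compose[OF *(1) l] filterlim_compose[OF *(2) r] .
  qed
  have mono: "B (dir s) Minus x (x + e1) \<omega> \<ge> B (dir s) Plus x (x + e1) \<omega> \<and>
      B (dir s) Plus x (x + e1) \<omega> \<ge> B (dir t) Minus x (x + e1) \<omega> \<and>
      B (dir s) Minus x (x + e2) \<omega> \<le> B (dir s) Plus x (x + e2) \<omega> \<and>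
      B (dir s) Plus x (x + e2) \<omega> \<le> B (dir t) Minus x (x + e2) \<omega>" if "0 < s" "s < t" "t < 1" for s t x
    using elim(3)[rule_format, of "dir s" "dir t" x] that by auto
  show ?case
  proof (rule busemann_sample.intro)
    fix x
    show "sided_mono (\<lambda>t \<sigma>. - B (dir t) \<sigma> x (x + e1) \<omega>)"
    proof
      fix s t :: real
      \<comment> \<open>Monotonicity is given for pairs of directions; \<open>(1 + t) / 2\<close> is
        just some direction beyond \<open>t\<close>.\<close>
      show "- B (dir t) Minus x (x + e1) \<omega> \<le> - B (dir t) Plus x (x + e1) \<omega>" if "0 < t" "t < 1"
        using mono[of t "(1 + t) / 2" x] that by auto
      show "- B (dir s) Plus x (x + e1) \<omega> \<le> - B (dir t) Minus x (x + e1) \<omega>" if "0 < s" "s < t" "t < 1"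
        using mono[OF that, of x] by simp
      show "((\<lambda>s. - B (dir s) Plus x (x + e1) \<omega>) \<longlongrightarrow> - B (dir t) Minus x (x + e1) \<omega>) (at_left t)"
        "((\<lambda>s. - B (dir s) Plus x (x + e1) \<omega>) \<longlongrightarrow> - B (dir t) Plus x (x + e1) \<omega>) (at_right t)"
        if "0 < t" "t < 1"
        by (rule tendsto_minus, rule lim[OF that])+
    qed
    show "sided_mono (\<lambda>t \<sigma>. B (dir t) \<sigma> x (x + e2) \<omega>)"
    proof
      fix s t :: real
      show "B (dir t) Minus x (x + e2) \<omega> \<le> B (dir t) Plus x (x + e2) \<omega>" if "0 < t" "t < 1"
        using mono[of t "(1 + t) / 2" x] that by auto
      show "B (dir s) Plus x (x + e2) \<omega> \<le> B (dir t) Minus x (x + e2) \<omega>" if "0 < s" "s < t" "t < 1"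
        using mono[OF that, of x] by simp
      show "((\<lambda>s. B (dir s) Plus x (x + e2) \<omega>) \<longlongrightarrow> B (dir t) Minus x (x + e2) \<omega>) (at_left t)"
        "((\<lambda>s. B (dir s) Plus x (x + e2) \<omega>) \<longlongrightarrow> B (dir t) Plus x (x + e2) \<omega>) (at_right t)"
        if "0 < t" "t < 1"
        by (rule lim[OF that])+
    qed
  qed (use elim(1,2) in auto)
qed

lemma AE_rational_directions:
  assumes "\<And>r. 0 < r \<Longrightarrow> r < 1 \<Longrightarrow> AE \<omega> in M. P r \<omega>"
  shows "AE \<omega> in M. \<forall>r\<in>\<rat>. 0 < r \<longrightarrow> r < 1 \<longrightarrow> P r \<omega>"
  by (rule AE_ball_countable'[OF _ countable_rat]) (use assms in auto)

text \<open>Paths start at arbitrary sites, so the shape theorem at the origin is carried to every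
  base point \<open>z\<close> by stationarity.\<close>

lemma AE_linear_growth:
  assumes \<xi>: "\<xi> \<in> riU"
  shows "AE \<omega> in M. \<forall>z. linear_growth (\<lambda>x. B \<xi> Plus z (z + x) \<omega>) (grad g \<xi> Plus)"
proof -
  have "AE \<omega> in M. linear_growth (\<lambda>x. B \<xi> Plus 0 x \<omega>) (grad g \<xi> Plus)"
    using B_shape[OF \<xi>] by eventually_elim (simp add: linear_growth_def)
  then have "AE \<omega> in M. linear_growth (\<lambda>x. B \<xi> Plus 0 x (T z \<omega>)) (grad g \<xi> Plus)" for z
    by (rule AE_T)
  then have "AE \<omega> in M. \<forall>z. linear_growth (\<lambda>x. B \<xi> Plus 0 x (T z \<omega>)) (grad g \<xi> Plus)"
    by (subst AE_all_countable) blast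
  with AE_shift show ?thesis
  proof eventually_elim
    case (elim \<omega>)
    have "B \<xi> Plus 0 x (T z \<omega>) = B \<xi> Plus z (z + x) \<omega>" for x z
      using elim(1)[rule_format, OF \<xi>, of Plus 0 z x] by (simp add: add.commute)
    with elim(2) show ?case by simp
  qed
qed

end

section \<open>Assembly on one event of full probability\<close>

theorem theorem4p3:
  fixes M :: "'w::polish_space measure"
    and T :: "site \<Rightarrow> 'w \<Rightarrow> 'w"
    and wt :: "site \<Rightarrow> 'w \<Rightarrow> real"
    and g :: "point \<Rightarrow> real"
    and B :: "point \<Rightarrow> sign \<Rightarrow> site \<Rightarrow> site \<Rightarrow> 'w \<Rightarrow> real"
  assumes "busemann_process M T wt g B"
  shows "AE \<omega> in M. \<forall>\<zeta>\<in>riU. \<forall>\<eta>\<in>riU.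
           \<zeta> \<preceq> \<eta> \<and> dIcc \<zeta> \<eta> \<inter> exceptional_dirs B \<omega> \<noteq> {} \<longrightarrow>
             (pair_wf_digraph (instability_graph B \<omega> \<zeta> \<eta>) \<and>
              infinite (pverts (instability_graph B \<omega> \<zeta> \<eta>))) \<and>
             instability_graph B \<omega> \<zeta> \<eta> =
               graph_Union {path_graph p | p. bi_infinite_path (dual_graph_Union B \<omega> \<zeta> \<eta>) p} \<and>
             (\<forall>p. bi_infinite_path (dual_graph_Union B \<omega> \<zeta> \<eta>) p \<longrightarrow>
                backward_directed (dIcc (lower_end g \<zeta>) (upper_end g \<eta>)) p)"
proof -
  interpret busemann_process M T wt g B by fact
  interpret concave_shape g by (rule concave_shape)
  have no_immortal: "AE \<omega> in M. \<forall>r\<in>\<rat>. 0 < r \<longrightarrow> r < 1 \<longrightarrow> (\<forall>x. \<not> immortal (dual_succ B \<omega> (dir r) Plus) x)"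
    by (rule AE_rational_directions) (use AE_no_immortal in simp)
  have no_ties: "AE \<omega> in M. \<forall>r\<in>\<rat>. 0 < r \<longrightarrow> r < 1 \<longrightarrow>
      (\<forall>x \<sigma>. B (dir r) \<sigma> x (x + e1) \<omega> \<noteq> B (dir r) \<sigma> x (x + e2) \<omega>)"
    by (rule AE_rational_directions) (use B_no_ties in simp)
  have growth: "AE \<omega> in M. \<forall>r\<in>\<rat>. 0 < r \<longrightarrow> r < 1 \<longrightarrow>
      (\<forall>z. linear_growth (\<lambda>x. B (dir r) Plus z (z + x) \<omega>) (grad g (dir r) Plus))"
    by (rule AE_rational_directions) (use AE_linear_growth in simp)
  from AE_busemann_sample no_immortal no_ties growth show ?thesis
  proof eventually_elim
    case (elim \<omega>)
    interpret busemann_sample B \<omega> "\<lambda>x. wt x \<omega>" by (rule elim(1))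
    show ?case (is "\<forall>\<zeta>\<in>riU. \<forall>\<eta>\<in>riU. ?hyp \<zeta> \<eta> \<longrightarrow> ?concl \<zeta> \<eta>")
    proof (intro ballI impI)
      fix \<zeta>' \<eta>' assume dirs: "\<zeta>' \<in> riU" "\<eta>' \<in> riU" "\<zeta>' \<preceq> \<eta>' \<and> dIcc \<zeta>' \<eta>' \<inter> exceptional_dirs B \<omega> \<noteq> {}"
      from dirs(1) obtain \<zeta> where \<zeta>: "\<zeta>' = dir \<zeta>" "0 < \<zeta>" by (rule riU_cases)
      from dirs(2) obtain \<eta> where \<eta>: "\<eta>' = dir \<eta>" "\<eta> < 1" by (rule riU_cases)
      note eqs = \<zeta>(1) \<eta>(1)
      have bds: "0 < \<zeta>" "\<zeta> \<le> \<eta>" "\<eta> < 1"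
        using \<zeta>(2) \<eta>(2) conjunct1[OF dirs(3)] by (simp_all add: eqs)
      have on_path: "varies \<zeta> \<eta> (\<rho> (q n))" if "lattice_path \<zeta> \<eta> q" for q n
        by (rule inst_on_lattice_path[OF bds _ _ that]) (use elim(2,3) in auto)
      have ex: "\<exists>x. varies \<zeta> \<eta> (\<rho> x)" using ex_inst[OF bds] dirs(3) unfolding eqs by blast
      have bounds: "\<zeta> < 1" "0 < \<eta>" using bds by auto
      \<comment> \<open>Only the lower end at \<open>\<zeta>\<close> and the upper end at
        \<open>\<eta>\<close> enter the conclusion; \<open>h0\<close> and \<open>l0\<close> are
        by-products.\<close>
      obtain l h0 where l: "0 < l" "l \<le> \<zeta>" "lower_end g (dir \<zeta>) = dir l" "\<forall>\<sigma>. contact \<sigma> \<zeta> \<subseteq> {l..h0}"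
        using lin_seg_bounds[OF bds(1) bounds(1)] by blast
      obtain l0 h where h: "\<eta> \<le> h" "h < 1" "upper_end g (dir \<eta>) = dir h" "\<forall>\<sigma>. contact \<sigma> \<eta> \<subseteq> {l0..h}"
        using lin_seg_bounds[OF bounds(2) bds(3)] by blast
      have directed: "backward_directed (dIcc (lower_end g (dir \<zeta>)) (upper_end g (dir \<eta>))) (\<lambda>n. dual (q n))"
        if q: "lattice_path \<zeta> \<eta> q" for q
      proof (rule lattice_path_directed[OF bds concave_shape _ q])
        show "contact Minus \<zeta> \<subseteq> {l..}" "contact Plus \<eta> \<subseteq> {..h}" using l(4)[rule_format, of Minus] h(4)[rule_format, of Plus] by auto
      qed (use l h elim(4) in auto)
      show "?concl \<zeta>' \<eta>'"
        unfolding eqs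
      proof (intro conjI allI impI)
        show "pair_wf_digraph (instability_graph B \<omega> (dir \<zeta>) (dir \<eta>))"
          by (rule instability_graph_structure(1)[OF bds]) (rule on_path)
        show "infinite (pverts (instability_graph B \<omega> (dir \<zeta>) (dir \<eta>)))"
          by (rule instability_graph_structure(3)[OF bds _ ex]) (rule on_path)
        show "instability_graph B \<omega> (dir \<zeta>) (dir \<eta>) =
            graph_Union {path_graph p | p. bi_infinite_path (dual_graph_Union B \<omega> (dir \<zeta>) (dir \<eta>)) p}"
          by (rule instability_graph_structure(2)[OF bds]) (rule on_path)
        show "backward_directed (dIcc (lower_end g (dir \<zeta>)) (upper_end g (dir \<eta>))) p"
          if "bi_infinite_path (dual_graph_Union B \<omega> (dir \<zeta>) (dir \<eta>)) p" for p
          using that directed unfolding bi_infinite_path_iff[OF bds] by blast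
      qed
    qed
  qed
qed

end
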